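(* Let $m\geq 1$ be an integer and let $G$ be a finite simple graph with vertex connectivity $\kappa(G)\geq 2m+1$. If the sun toughness of $G$ satisfies $s(G)\geq\frac{m+1}{m+2}$, then $G$ is a $(P_{\geq 3},m)$-factor deleted graph.
   Context: All graphs are finite and simple. $\kappa(G)$ denotes the vertex connectivity of $G$ (with $\kappa(K_n)=n-1$). A $P_{\geq k}$-factor of a graph $G$ (for an integer $k\geq 2$) is a spanning subgraph of $G$ each of whose components is isomorphic to a path of order (number of vertices) at least $k$. A graph $G$ is a $(P_{\geq k},m)$-factor deleted graph if $G-E'$ has a $P_{\geq k}$-factor for every $E'\subseteq E(G)$ with $|E'|=m$, where $G-E'$ is the graph obtained from $G$ by deleting the edges in $E'$ (keeping all vertices). For $X\subseteq V(G)$, $G-X$ is the subgraph induced by $V(G)\setminus X$. A graph $H$ is factor-critical if $H-v$ has a 1-factor (perfect matching) for each $v\in V(H)$. Given a factor-critical graph $H$ with $V(H)=\{v_1,\dots,v_n\}$, the graph obtained from $H$ by adding new vertices $u_1,\dots,u_n$ together with the new edges $v_iu_i$ ($1\leq i\leq n$) is called a sun. The graphs $K_1$ and $K_2$ are also regarded as suns. A sun component of a graph $G$ is a connected component of $G$ that is isomorphic to a sun, and $sun(G)$ denotes the number of sun components of $G$. The sun toughness $s(G)$ of a connected graph $G$ is defined by $s(G)=+\infty$ if $G$ is complete, and otherwise $$s(G)=\min\left\{\frac{|X|}{sun(G-X)}: X\subseteq V(G),\ sun(G-X)\geq 2\right\}.$$ *)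

theory Defs
  imports "HOL-Library.Extended_Real"
begin

type_synonym 'a ugraph = "'a set \<times> 'a set set"

abbreviation verts :: "'a ugraph \<Rightarrow> 'a set" where
  "verts G \<equiv> fst G"

abbreviation edges :: "'a ugraph \<Rightarrow> 'a set set" where
  "edges G \<equiv> snd G"

(* The null graph is admitted here, because it arises as a vertex-deleted subgraph. *)
definition simple_graph :: "'a ugraph \<Rightarrow> bool" where
  "simple_graph G \<longleftrightarrow>
     finite (verts G) \<and> (\<forall>e\<in>edges G. \<exists>u\<in>verts G. \<exists>v\<in>verts G. u \<noteq> v \<and> e = {u, v})"

definition induced_subgraph :: "'a ugraph \<Rightarrow> 'a set \<Rightarrow> 'a ugraph" where
  "induced_subgraph G S = (S, {e \<in> edges G. e \<subseteq> S})"

definition delete_verts :: "'a ugraph \<Rightarrow> 'a set \<Rightarrow> 'a ugraph" where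
  "delete_verts G X = induced_subgraph G (verts G - X)"

definition delete_edges :: "'a ugraph \<Rightarrow> 'a set set \<Rightarrow> 'a ugraph" where
  "delete_edges G F = (verts G, edges G - F)"

definition spanning_subgraph :: "'a ugraph \<Rightarrow> 'a ugraph \<Rightarrow> bool" where
  "spanning_subgraph F G \<longleftrightarrow> verts F = verts G \<and> edges F \<subseteq> edges G"

definition graph_iso :: "'a ugraph \<Rightarrow> 'b ugraph \<Rightarrow> bool" where
  "graph_iso G H \<longleftrightarrow>
     (\<exists>f. bij_betw f (verts G) (verts H) \<and>
          (\<forall>u\<in>verts G. \<forall>v\<in>verts G. {u, v} \<in> edges G \<longleftrightarrow> {f u, f v} \<in> edges H))"

definition reachable :: "'a ugraph \<Rightarrow> 'a \<Rightarrow> 'a \<Rightarrow> bool" where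
  "reachable G u v \<longleftrightarrow> (u, v) \<in> {(x, y). {x, y} \<in> edges G}\<^sup>*"

definition connected_graph :: "'a ugraph \<Rightarrow> bool" where
  "connected_graph G \<longleftrightarrow>
     verts G \<noteq> {} \<and> (\<forall>u\<in>verts G. \<forall>v\<in>verts G. reachable G u v)"

definition components :: "'a ugraph \<Rightarrow> 'a ugraph set" where
  "components G = {induced_subgraph G {v \<in> verts G. reachable G u v} | u. u \<in> verts G}"

definition complete :: "'a ugraph \<Rightarrow> bool" where
  "complete G \<longleftrightarrow> (\<forall>u\<in>verts G. \<forall>v\<in>verts G. u \<noteq> v \<longrightarrow> {u, v} \<in> edges G)"

definition complete_graph :: "nat \<Rightarrow> nat ugraph" where
  "complete_graph n = ({..<n}, {{i, j} | i j. i < n \<and> j < n \<and> i \<noteq> j})"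

definition path_graph :: "nat \<Rightarrow> nat ugraph" where
  "path_graph n = ({..<n}, {{i, Suc i} | i. Suc i < n})"

(* A graph that is not complete has two non-adjacent vertices, and deleting all the other
   vertices disconnects it, so the minimum is taken over a nonempty set. *)
definition vertex_connectivity :: "'a ugraph \<Rightarrow> nat" where
  "vertex_connectivity G =
     (if complete G then card (verts G) - 1
      else Min {card X | X. X \<subset> verts G \<and> \<not> connected_graph (delete_verts G X)})"

definition path_factor :: "nat \<Rightarrow> 'a ugraph \<Rightarrow> 'a ugraph \<Rightarrow> bool" where
  "path_factor k G F \<longleftrightarrow>
     spanning_subgraph F G \<and> (\<forall>C\<in>components F. \<exists>n\<ge>k. graph_iso C (path_graph n))"

definition path_factor_deleted :: "nat \<Rightarrow> nat \<Rightarrow> 'a ugraph \<Rightarrow> bool" where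
  "path_factor_deleted k m G \<longleftrightarrow>
     (\<forall>E'. E' \<subseteq> edges G \<and> card E' = m \<longrightarrow> (\<exists>F. path_factor k (delete_edges G E') F))"

definition perfect_matching :: "'a ugraph \<Rightarrow> 'a set set \<Rightarrow> bool" where
  "perfect_matching G M \<longleftrightarrow> M \<subseteq> edges G \<and> (\<forall>v\<in>verts G. \<exists>!e. e \<in> M \<and> v \<in> e)"

definition factor_critical :: "'a ugraph \<Rightarrow> bool" where
  "factor_critical H \<longleftrightarrow> (\<forall>v\<in>verts H. \<exists>M. perfect_matching (delete_verts H {v}) M)"

(* Inl v stands for the original vertex v and Inr v for the new vertex attached to it. *)
definition add_pendants :: "'a ugraph \<Rightarrow> ('a + 'a) ugraph" where
  "add_pendants H =
     (Inl ` verts H \<union> Inr ` verts H,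
      (\<lambda>e. Inl ` e) ` edges H \<union> {{Inl v, Inr v} | v. v \<in> verts H})"

(* Taking H over the vertex type of G loses no generality: if G is isomorphic to
   add_pendants H, then G has an induced subgraph isomorphic to H. *)
definition is_sun :: "'a ugraph \<Rightarrow> bool" where
  "is_sun G \<longleftrightarrow>
     graph_iso G (complete_graph 1) \<or> graph_iso G (complete_graph 2) \<or>
     (\<exists>H :: 'a ugraph. simple_graph H \<and> factor_critical H \<and> graph_iso G (add_pendants H))"

definition sun :: "'a ugraph \<Rightarrow> nat" where
  "sun G = card {C \<in> components G. is_sun C}"

(* As for vertex_connectivity, deleting all but two non-adjacent vertices leaves two
   copies of K_1, so the minimum is taken over a nonempty set. *)
definition sun_toughness :: "'a ugraph \<Rightarrow> ereal" where
  "sun_toughness G =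
     (if complete G then \<infinity>
      else Min {ereal (real (card X) / real (sun (delete_verts G X))) | X.
                X \<subseteq> verts G \<and> sun (delete_verts G X) \<ge> 2})"

end

(* If G - E' has no P_{>=3}-factor, Kaneko's theorem gives X with sun(G - E' - X) > 2|X|.
   A sun has a vertex of degree at most 1, so the minimum degree 2m + 1 of G forces |X| >= m.
   Every sun of G - E' - X that is not already a sun of G - X contains one of the at most 2m
   ends of deleted edges. If |X| <= 2m, then G - X is connected and at most 2m suns arise; if
   |X| > 2m, the suns of G - X are few by toughness.

   Kaneko's theorem is proved by induction on the numbers of vertices and edges. A largest X with
   sun(G - X) = 2|X| splits G by Hall's theorem into pieces sun - x - sun and smaller graphs. If
   only the empty set is tight and G is connected, then sun(G - X) <= 2|X| - 1 for all nonempty X.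
   Either equality never holds, and any edge can be removed, or a largest X with equality is
   taken. One unit of surplus in Hall's condition then lets one of the suns be served twice, which
   gives a factor unless G is itself a corona of some H; in that case the surplus makes H
   factor-critical, by the form of Tutte's theorem that counts factor-critical components, so
   that G would be a sun. *)
theory Submission
  imports Defs
begin

section \<open>Connected vertex sets and components\<close>

text \<open>Up to the transfer to graphs, everything concerns a symmetric relation \<open>A\<close>
  on a vertex set \<open>S\<close>: deleting vertices shrinks \<open>S\<close>, deleting an edge
  changes \<open>A\<close>, and no new graph has to be formed. Connectedness is stated by cuts, so
  it is used by exhibiting a set closed under adjacency. What shapes the induction is how far one
  change can raise the number of suns. For a nonempty deleted set X, removing an edge can create two
  suns, one at each end, so 2|X| must exceed the count by two; hanging a leaf on a component can
  create one, so one unit is enough. Equality and near-equality are left to matching arguments, and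
  near-equality means that one sun is missing when each vertex of X is to join two. The constants of
  the theorem meet exactly. If |X| < m, a vertex of degree at most 1 in a sun has at most (m - 1) +
  1 + m neighbours in G, one fewer than the minimum degree. If |X| > 2m, a violation of Kaneko's
  condition forces m|X| \<le> 2m^2 + m - 1 by toughness, one less than m(2m + 1).\<close>

definition connected_set :: "('a \<Rightarrow> 'a \<Rightarrow> bool) \<Rightarrow> 'a set \<Rightarrow> bool" where
  "connected_set A C \<longleftrightarrow> (\<forall>T\<subseteq>C. T \<noteq> {} \<and> T \<noteq> C \<longrightarrow> (\<exists>u\<in>T. \<exists>v\<in>C - T. A u v))"

text \<open>Maximality is not demanded explicitly: a connected set with no edge to the rest of
  \<open>S\<close> cannot be enlarged.\<close>

definition comps :: "('a \<Rightarrow> 'a \<Rightarrow> bool) \<Rightarrow> 'a set \<Rightarrow> 'a set set" where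
  "comps A S = {C. C \<noteq> {} \<and> C \<subseteq> S \<and> connected_set A C \<and> (\<forall>u\<in>C. \<forall>v\<in>S - C. \<not> A u v)}"

text \<open>The predicate is a parameter because suns, factor-critical sets and induced subgraphs
  satisfying \<open>is_sun\<close> are counted by the same arguments.\<close>

definition ncomps :: "('a set \<Rightarrow> bool) \<Rightarrow> ('a \<Rightarrow> 'a \<Rightarrow> bool) \<Rightarrow> 'a set \<Rightarrow> nat" where
  "ncomps P A S = card {C \<in> comps A S. P C}"

text \<open>For a deleted set \<open>X\<close> this is the set system to which Hall's theorem is
  applied: each component of \<open>S - X\<close> with its neighbours in \<open>X\<close>.\<close>

definition nbrs :: "('a \<Rightarrow> 'a \<Rightarrow> bool) \<Rightarrow> 'a set \<Rightarrow> 'a set \<Rightarrow> 'a set" where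
  "nbrs A X C = {x \<in> X. \<exists>w\<in>C. A x w}"

lemma connected_set_cong:
  assumes "\<And>u v. u \<in> C \<Longrightarrow> v \<in> C \<Longrightarrow> A u v = B u v"
  shows "connected_set A C = connected_set B C"
proof -
  have "(\<exists>u\<in>T. \<exists>v\<in>C - T. A u v) = (\<exists>u\<in>T. \<exists>v\<in>C - T. B u v)" if "T \<subseteq> C" for T
    using assms that by blast
  then show ?thesis unfolding connected_set_def by simp
qed

lemma comps_cong:
  assumes "\<And>u v. u \<in> S \<Longrightarrow> v \<in> S \<Longrightarrow> A u v = B u v"
  shows "comps A S = comps B S"
proof -
  have "connected_set A C = connected_set B C" if "C \<subseteq> S" for C
    using assms that by (intro connected_set_cong) blast
  then show ?thesis unfolding comps_def using assms by blast
qed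

lemma compsD:
  assumes "C \<in> comps A S"
  shows "C \<noteq> {}" "C \<subseteq> S" "connected_set A C" "\<And>u v. u \<in> C \<Longrightarrow> v \<in> S \<Longrightarrow> A u v \<Longrightarrow> v \<in> C"
  using assms unfolding comps_def by auto

lemma connected_setD:
  assumes "connected_set A C" "T \<subseteq> C" "T \<noteq> {}" "\<And>u v. u \<in> T \<Longrightarrow> v \<in> C \<Longrightarrow> A u v \<Longrightarrow> v \<in> T"
  shows "T = C"
  using assms unfolding connected_set_def by blast

lemma connected_setI:
  assumes "\<And>T. T \<subseteq> C \<Longrightarrow> T \<noteq> {} \<Longrightarrow> (\<And>u v. u \<in> T \<Longrightarrow> v \<in> C \<Longrightarrow> A u v \<Longrightarrow> v \<in> T) \<Longrightarrow> T = C"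
  shows "connected_set A C"
  using assms unfolding connected_set_def by blast

lemma compsI:
  assumes "C \<noteq> {}" "C \<subseteq> S" "connected_set A C" "\<And>u v. u \<in> C \<Longrightarrow> v \<in> S \<Longrightarrow> A u v \<Longrightarrow> v \<in> C"
  shows "C \<in> comps A S"
  using assms unfolding comps_def by blast

lemma connected_set_singleton: "connected_set A {v}"
  by (rule connected_setI) blast

text \<open>The intersection is closed under adjacency inside \<open>C\<close> and inside
  \<open>D\<close>, hence equal to both.\<close>

lemma comps_disjoint:
  assumes "C \<in> comps A S" "D \<in> comps A S" "C \<inter> D \<noteq> {}"
  shows "C = D"
proof -
  have "C \<inter> D = C"
    using compsD[OF assms(1)] compsD[OF assms(2)] assms(3)
    by (intro connected_setD[of A]) blast+
  moreover have "D \<inter> C = D"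
    using compsD[OF assms(1)] compsD[OF assms(2)] assms(3)
    by (intro connected_setD[of A]) blast+
  ultimately show ?thesis by blast
qed

text \<open>The component is the least set containing \<open>u\<close> that no edge of
  \<open>S\<close> leaves. If a cut of it were crossed by no edge, the side containing
  \<open>u\<close> would be a smaller such set; symmetry is what allows either side to be
  taken.\<close>

lemma comps_cover:
  assumes "symp A" "u \<in> S"
  obtains C where "C \<in> comps A S" "u \<in> C"
proof -
  define Q where "Q T \<longleftrightarrow> u \<in> T \<and> T \<subseteq> S \<and> (\<forall>x\<in>T. \<forall>y\<in>S - T. \<not> A x y)" for T
  define K where "K = \<Inter>{T. Q T}"
  have QS: "Q S" using assms unfolding Q_def by auto
  have QK: "Q K" unfolding K_def Q_def using QS unfolding Q_def by blast
  have le: "K \<subseteq> T" if "Q T" for T using that unfolding K_def by auto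
  have "connected_set A K"
    unfolding connected_set_def
  proof (intro allI impI)
    fix T assume T: "T \<subseteq> K" "T \<noteq> {} \<and> T \<noteq> K"
    show "\<exists>u\<in>T. \<exists>v\<in>K - T. A u v"
    proof (rule ccontr)
      assume no: "\<not> ?thesis"
      have QK': "u \<in> K" "K \<subseteq> S" "\<And>x y. x \<in> K \<Longrightarrow> y \<in> S \<Longrightarrow> A x y \<Longrightarrow> y \<in> K"
        using QK unfolding Q_def by blast+
      have noA: "\<not> A x y" "\<not> A y x" if "x \<in> T" "y \<in> K - T" for x y
        using no that sympD[OF assms(1)] by blast+
      have "Q T" if "u \<in> T"
        unfolding Q_def using that T(1) QK'(2) QK'(3) noA(1) by blast
      moreover have "Q (K - T)" if "u \<notin> T"
        unfolding Q_def using that T(1) QK' noA(2) by blast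
      ultimately show False using le[of T] le[of "K - T"] T by blast
    qed
  qed
  then have "K \<in> comps A S" using QK unfolding comps_def Q_def by auto
  then show ?thesis using that QK unfolding Q_def by auto
qed

lemma Union_comps: "symp A \<Longrightarrow> \<Union>(comps A S) = S"
  using comps_cover[of A _ S] compsD(2)[of _ A S] by (metis Sup_le_iff UnionI subsetI subset_antisym)

lemma finite_comps: "finite S \<Longrightarrow> finite (comps A S)"
  by (rule finite_subset[of _ "Pow S"]) (auto simp: comps_def)

lemma self_comps: "connected_set A S \<Longrightarrow> S \<noteq> {} \<Longrightarrow> comps A S = {S}"
proof -
  assume S: "connected_set A S" "S \<noteq> {}"
  then have SS: "S \<in> comps A S" unfolding comps_def by simp
  have "C = S" if C: "C \<in> comps A S" for C
    by (rule comps_disjoint[OF C SS]) (use compsD(1,2)[OF C] in blast)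
  then show ?thesis using SS by blast
qed

lemma comps_connected: "C \<in> comps A S \<Longrightarrow> comps A C = {C}"
  using self_comps compsD by metis

lemma comps_subset_closed:
  assumes "C \<in> comps A S" "C \<subseteq> S'" "\<And>u v. u \<in> C \<Longrightarrow> v \<in> S' - S \<Longrightarrow> \<not> A u v"
  shows "C \<in> comps A S'"
  using assms unfolding comps_def by blast

text \<open>Since \<open>C\<close> itself is not counted, deleting \<open>Y\<close> inside it loses
  no counted component and gains those of \<open>C - Y\<close>. In this way a bound for
  \<open>S\<close> that is attained at some set is inherited by the uncounted components.\<close>

lemma ncomps_split:
  assumes "finite S" "C \<in> comps A S" "Y \<subseteq> C" "\<not> P C"
  shows "ncomps P A S + ncomps P A (C - Y) \<le> ncomps P A (S - Y)"
proof -
  let ?X = "{D \<in> comps A S. P D}" and ?Y = "{D \<in> comps A (C - Y). P D}"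
  have fin: "finite ?X" "finite ?Y"
    using finite_comps[OF assms(1), of A] finite_comps[of "C - Y" A]
      finite_subset[OF compsD(2)[OF assms(2)] assms(1)] by auto
  have "D \<in> comps A (S - Y)" if "D \<in> comps A S" "D \<noteq> C" for D
    using comps_disjoint[OF that(1) assms(2)] that assms(3) unfolding comps_def by blast
  moreover have "D \<in> comps A (S - Y)" if "D \<in> comps A (C - Y)" for D
    using compsD[OF that] compsD[OF assms(2)] unfolding comps_def by blast
  ultimately have "?X \<union> ?Y \<subseteq> {D \<in> comps A (S - Y). P D}" using assms(4) by auto
  moreover have "?X \<inter> ?Y = {}"
  proof -
    have False if D: "D \<in> ?X" "D \<in> ?Y" for D
    proof -
      have "D \<noteq> {}" "D \<subseteq> C" using compsD(1,2)[of D A "C - Y"] D by auto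
      then have "D = C" using D(1) by (intro comps_disjoint[OF _ assms(2)]) auto
      then show False using D(1) assms(4) by simp
    qed
    then show ?thesis by blast
  qed
  moreover have "finite {D \<in> comps A (S - Y). P D}"
    using finite_comps[of "S - Y" A] assms(1) by simp
  ultimately show ?thesis
    unfolding ncomps_def using card_Un_disjoint[OF fin] card_mono[of "{D \<in> comps A (S - Y). P D}" "?X \<union> ?Y"]
    by linarith
qed

text \<open>The members of \<open>T\<close> see nothing of \<open>X\<close> outside
  \<open>N\<close>, so putting the vertices of \<open>X - N\<close> back does not enlarge
  them.\<close>

lemma comps_nbrs:
  assumes "symp A" "T \<subseteq> comps A (S - X)" "X \<subseteq> S" "\<And>D. D \<in> T \<Longrightarrow> nbrs A X D \<subseteq> N" "N \<subseteq> X"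
  shows "T \<subseteq> comps A (S - N)"
proof
  fix D assume D: "D \<in> T"
  then have Dc: "D \<in> comps A (S - X)" using assms by auto
  show "D \<in> comps A (S - N)"
  proof (rule comps_subset_closed[OF Dc])
    show "D \<subseteq> S - N" using compsD(2)[OF Dc] assms by auto
    fix u v assume "u \<in> D" "v \<in> S - N - (S - X)"
    then show "\<not> A u v" using assms(4)[OF D] sympD[OF assms(1)] unfolding nbrs_def by blast
  qed
qed

text \<open>This converts a bound on the number of components after deletion into Hall's condition:
  one deletes only the joint neighbourhood of \<open>T\<close>.\<close>

lemma card_le_ncomps_nbrs:
  assumes "symp A" "finite S" "T \<subseteq> {C \<in> comps A (S - X). P C}" "X \<subseteq> S"
  shows "card T \<le> ncomps P A (S - (\<Union>D\<in>T. nbrs A X D))"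
proof -
  have "T \<subseteq> comps A (S - (\<Union>D\<in>T. nbrs A X D))"
  proof (rule comps_nbrs[OF assms(1) _ assms(4)])
    show "T \<subseteq> comps A (S - X)" using assms(3) by blast
    show "(\<Union>D\<in>T. nbrs A X D) \<subseteq> X" unfolding nbrs_def by blast
  qed blast
  then have "T \<subseteq> {C \<in> comps A (S - (\<Union>D\<in>T. nbrs A X D)). P C}" using assms by auto
  then show ?thesis unfolding ncomps_def
    using finite_comps[of "S - (\<Union>D\<in>T. nbrs A X D)" A] assms(2) by (intro card_mono) auto
qed

lemma card_comps_hitting:
  assumes "finite U"
  shows "card {C \<in> comps A S. C \<inter> U \<noteq> {}} \<le> card U"
proof -
  define f where "f C = (SOME u. u \<in> C \<inter> U)" for C
  have f: "f C \<in> C \<inter> U" if "C \<inter> U \<noteq> {}" for C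
    using that unfolding f_def by (metis some_in_eq)
  show ?thesis
  proof (rule card_inj_on_le[of f])
    show "inj_on f {C \<in> comps A S. C \<inter> U \<noteq> {}}"
    proof (rule inj_onI)
      fix C D assume CD: "C \<in> {C \<in> comps A S. C \<inter> U \<noteq> {}}" "D \<in> {C \<in> comps A S. C \<inter> U \<noteq> {}}"
        and eq: "f C = f D"
      then have "f C \<in> C \<inter> D" using f[of C] f[of D] by auto
      then show "C = D" using CD comps_disjoint[of C A S D] by auto
    qed
    show "f ` {C \<in> comps A S. C \<inter> U \<noteq> {}} \<subseteq> U" using f by auto
  qed (fact assms)
qed

text \<open>Without neighbours in \<open>X\<close>, the set \<open>D\<close> would be a component of
  the connected set \<open>S\<close>, hence all of \<open>S\<close>.\<close>

lemma comps_nbrs_nonempty: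
  assumes "symp A" "connected_set A S" "D \<in> comps A (S - X)" "X \<subseteq> S" "X \<noteq> {}"
  shows "nbrs A X D \<noteq> {}"
proof
  assume "nbrs A X D = {}"
  then have "{D} \<subseteq> comps A (S - {})"
    using comps_nbrs[of A "{D}" S X "{}"] assms by auto
  then have "D = S" using self_comps[OF assms(2)] assms(4,5) by auto
  then show False using compsD(2)[OF assms(3)] assms(4,5) by blast
qed

section \<open>Hall's theorem\<close>

definition hall :: "'i set \<Rightarrow> ('i \<Rightarrow> 'a set) \<Rightarrow> bool" where
  "hall I N \<longleftrightarrow> (\<forall>T\<subseteq>I. card T \<le> card (\<Union>i\<in>T. N i))"

text \<open>If a nonempty proper subfamily is tight, it is solved alone and its targets are
  withdrawn from the others. Otherwise every nonempty proper subfamily has a surplus of one, which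
  pays for reserving an arbitrary target \<open>x\<close> for \<open>i0\<close>.\<close>

theorem hall_marriage:
  assumes "finite I" "\<And>i. i \<in> I \<Longrightarrow> finite (N i)" "hall I N"
  shows "\<exists>f. inj_on f I \<and> (\<forall>i\<in>I. f i \<in> N i)"
  using assms
proof (induction "card I" arbitrary: I N rule: less_induct)
  case less
  note fin = less.prems(1) and finN = less.prems(2)
  have hall: "card T \<le> card (\<Union>i\<in>T. N i)" if "T \<subseteq> I" for T
    using less.prems(3) that unfolding hall_def by blast
  show ?case
  proof (cases "I = {}")
    case False
    then obtain i0 where i0: "i0 \<in> I" by blast
    show ?thesis
    proof (cases "\<exists>T\<subset>I. T \<noteq> {} \<and> card (\<Union>i\<in>T. N i) = card T")
      case True
      then obtain T where T: "T \<subset> I" "T \<noteq> {}" "card (\<Union>i\<in>T. N i) = card T" by blast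
      have finT: "finite T" using T fin finite_subset by blast
      have hT: "hall T N" using hall T unfolding hall_def by blast
      obtain f where f: "inj_on f T" "\<forall>i\<in>T. f i \<in> N i"
        using less.hyps[OF _ finT _ hT] psubset_card_mono[OF fin T(1)] finN T by blast
      define M where "M i = N i - (\<Union>i\<in>T. N i)" for i
      have "hall (I - T) M"
        unfolding hall_def
      proof (intro allI impI)
        fix U assume U: "U \<subseteq> I - T"
        have finU: "finite U" using U fin finite_subset by blast
        have "card U + card T = card (U \<union> T)"
          using U finU finT by (subst card_Un_disjoint) auto
        also have "\<dots> \<le> card (\<Union>i\<in>U \<union> T. N i)" using U T by (intro hall) auto
        also have "(\<Union>i\<in>U \<union> T. N i) = (\<Union>i\<in>U. M i) \<union> (\<Union>i\<in>T. N i)" unfolding M_def by auto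
        also have "card \<dots> \<le> card (\<Union>i\<in>U. M i) + card (\<Union>i\<in>T. N i)" by (rule card_Un_le)
        finally show "card U \<le> card (\<Union>i\<in>U. M i)" using T by simp
      qed
      moreover have "card (I - T) < card I"
        using T fin by (intro psubset_card_mono) auto
      ultimately obtain g where g: "inj_on g (I - T)" "\<forall>i\<in>I - T. g i \<in> M i"
        using less.hyps[of "I - T" M] fin finN unfolding M_def by blast
      define h where "h i = (if i \<in> T then f i else g i)" for i
      have cross: "f i \<noteq> g j" if "i \<in> T" "j \<in> I - T" for i j
      proof -
        have "f i \<in> (\<Union>i\<in>T. N i)" "g j \<notin> (\<Union>i\<in>T. N i)" using f(2) g(2) that unfolding M_def by auto
        then show ?thesis by metis
      qed
      have "inj_on h I"
      proof (rule inj_onI)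
        fix i j assume ij: "i \<in> I" "j \<in> I" "h i = h j"
        then show "i = j"
          using inj_onD[OF f(1), of i j] inj_onD[OF g(1), of i j] cross[of i j] cross[of j i]
          unfolding h_def by (cases "i \<in> T"; cases "j \<in> T") simp_all
      qed
      moreover have "\<forall>i\<in>I. h i \<in> N i" using f g unfolding h_def M_def by auto
      ultimately show ?thesis by blast
    next
      case False
      have "card {i0} \<le> card (\<Union>i\<in>{i0}. N i)" using i0 by (intro hall) auto
      then obtain x where x: "x \<in> N i0" by (cases "N i0 = {}") auto
      define M where "M i = N i - {x}" for i
      have "hall (I - {i0}) M"
        unfolding hall_def
      proof (intro allI impI)
        fix U assume U: "U \<subseteq> I - {i0}"
        show "card U \<le> card (\<Union>i\<in>U. M i)"
        proof (cases "U = {}")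
          case nonempty: False
          have "U \<subset> I" using U i0 by blast
          then have "card U < card (\<Union>i\<in>U. N i)" 
            using False nonempty hall[of U] by (metis order_less_le psubset_imp_subset)
          moreover have "(\<Union>i\<in>U. M i) = (\<Union>i\<in>U. N i) - {x}" unfolding M_def by auto
          ultimately show ?thesis
            using card_Diff_singleton_if[of "\<Union>i\<in>U. N i" x] by auto
        qed auto
      qed
      moreover have "card (I - {i0}) < card I" using i0 fin by (intro psubset_card_mono) auto
      ultimately obtain g where g: "inj_on g (I - {i0})" "\<forall>i\<in>I - {i0}. g i \<in> M i"
        using less.hyps[of "I - {i0}" M] fin finN unfolding M_def by blast
      define h where "h i = (if i = i0 then x else g i)" for i
      have "inj_on h I"
      proof (rule inj_onI)
        fix i j assume ij: "i \<in> I" "j \<in> I" "h i = h j"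
        have "g k \<noteq> x" if "k \<in> I - {i0}" for k using g(2) that unfolding M_def by blast
        then show "i = j"
          using ij inj_onD[OF g(1), of i j] unfolding h_def by (auto split: if_splits)
      qed
      moreover have "\<forall>i\<in>I. h i \<in> N i" using g x unfolding h_def M_def by auto
      ultimately show ?thesis by blast
    qed
  qed auto
qed

text \<open>Each target is doubled by a Boolean tag. The equality of cardinalities makes Hall's
  injection onto, so both copies of every \<open>x\<close> are used.\<close>

lemma hall_pairs:
  assumes "finite I" "finite X" "\<And>i. i \<in> I \<Longrightarrow> N i \<subseteq> X" "card I = 2 * card X"
    and hall: "\<And>T. T \<subseteq> I \<Longrightarrow> card T \<le> 2 * card (\<Union>i\<in>T. N i)"
  shows "\<exists>g. (\<forall>i\<in>I. g i \<in> N i) \<and> (\<forall>x\<in>X. card {i \<in> I. g i = x} = 2)"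
proof -
  define M where "M i = N i \<times> (UNIV :: bool set)" for i
  have finN: "finite (N i)" if "i \<in> I" for i using assms(2,3) that finite_subset by blast
  have "hall I M"
    unfolding hall_def
  proof (intro allI impI)
    fix T assume "T \<subseteq> I"
    moreover have "(\<Union>i\<in>T. M i) = (\<Union>i\<in>T. N i) \<times> UNIV" unfolding M_def by auto
    ultimately show "card T \<le> card (\<Union>i\<in>T. M i)" using hall[of T] by (simp add: card_cartesian_product)
  qed
  then obtain f where f: "inj_on f I" "\<forall>i\<in>I. f i \<in> M i"
    using hall_marriage[of I M] assms finN unfolding M_def by auto
  have "f ` I = X \<times> UNIV"
  proof (rule card_subset_eq)
    show "f ` I \<subseteq> X \<times> UNIV" using f(2) assms(3) unfolding M_def by fastforce
    show "card (f ` I) = card (X \<times> (UNIV :: bool set))"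
      using card_image[OF f(1)] assms(4) by (simp add: card_cartesian_product)
  qed (use assms in auto)
  have "card {i \<in> I. fst (f i) = x} = 2" if "x \<in> X" for x
  proof -
    have "f ` {i \<in> I. fst (f i) = x} = {x} \<times> UNIV"
      using \<open>f ` I = X \<times> UNIV\<close> that by (auto simp: image_iff set_eq_iff) (metis fst_conv)+
    then have "card (f ` {i \<in> I. fst (f i) = x}) = 2" by (simp add: card_cartesian_product)
    then show ?thesis using card_image[of f "{i \<in> I. fst (f i) = x}"] f(1)
      by (metis (no_types, lifting) inj_on_subset mem_Collect_eq subsetI)
  qed
  moreover have "\<forall>i\<in>I. fst (f i) \<in> N i" using f(2) unfolding M_def by auto
  ultimately show ?thesis by (intro exI[of _ "\<lambda>i. fst (f i)"]) auto
qed

text \<open>The item \<open>d\<close> is served twice, once from \<open>P\<close> and once from \<open>Q\<close>. The surplus in the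
  hypothesis pays for the additional service.\<close>

lemma hall_pairs_split:
  assumes "finite I" "finite X" "\<And>i. i \<in> I \<Longrightarrow> N i \<subseteq> X" "card I + 1 = 2 * card X"
    and surplus: "\<And>T. T \<subseteq> I \<Longrightarrow> T \<noteq> {} \<Longrightarrow> card T + 1 \<le> 2 * card (\<Union>i\<in>T. N i)"
    and d: "d \<in> I" "N d \<subseteq> P \<union> Q" "P \<noteq> {}" "Q \<noteq> {}" "P \<subseteq> X" "Q \<subseteq> X"
  shows "\<exists>g z. (\<forall>i\<in>I - {d}. g i \<in> N i) \<and> g d \<in> P \<and> z \<in> Q \<and>
           (\<forall>x\<in>X. card {i \<in> I. g i = x} + (if z = x then 1 else 0) = 2)"
proof -
  \<comment> \<open>\<open>None\<close> is a second copy of \<open>d\<close>. It asks for a target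
    in \<open>Q\<close> while \<open>Some d\<close> asks for one in \<open>P\<close>, and the extra
    index supplies the equality required by \<open>hall_pairs\<close>.\<close>
  define J where "J = insert None (Some ` I)"
  define M where "M j = (case j of None \<Rightarrow> Q | Some i \<Rightarrow> if i = d then P else N i)" for j
  have finX: "finite Y" if "Y \<subseteq> X" for Y using that assms(2) finite_subset by blast
  have cardJ: "card J = 2 * card X"
    unfolding J_def using assms(1,4) by (simp add: card_insert_if card_image)
  have pos: "1 \<le> card P" "1 \<le> card Q" using d finX by (auto simp: Suc_le_eq card_gt_0_iff)
  have "\<exists>g. (\<forall>j\<in>J. g j \<in> M j) \<and> (\<forall>x\<in>X. card {j \<in> J. g j = x} = 2)"
  proof (rule hall_pairs)
    show "finite J" unfolding J_def using assms(1) by simp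
    show MX: "M j \<subseteq> X" if "j \<in> J" for j
      using that assms(3) d unfolding M_def J_def by (auto split: option.splits if_splits)
    fix T assume T: "T \<subseteq> J"
    define T' where "T' = Some -` T"
    have T': "T' \<subseteq> I" using T unfolding T'_def J_def by auto
    have finT': "finite T'" using T' assms(1) finite_subset by blast
    have TT: "T = Some ` T' \<or> T = insert None (Some ` T')"
      unfolding T'_def by (auto simp: image_iff) (metis option.exhaust)+
    have cT: "card (Some ` T') = card T'" by (simp add: card_image)
    have finU: "finite (\<Union>j\<in>T. M j)" using MX T by (intro finX) auto
    have le: "card Y \<le> card (\<Union>j\<in>T. M j)" if "Y \<subseteq> (\<Union>j\<in>T. M j)" for Y
      using that finU by (rule card_mono[rotated])
    have sub: "(\<Union>i\<in>T' - {d}. N i) \<subseteq> (\<Union>j\<in>T. M j)"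
    proof
      fix x assume "x \<in> (\<Union>i\<in>T' - {d}. N i)"
      then obtain i where "i \<in> T'" "i \<noteq> d" "x \<in> N i" by auto
      then have "Some i \<in> T" "x \<in> M (Some i)" unfolding T'_def M_def by auto
      then show "x \<in> (\<Union>j\<in>T. M j)" by blast
    qed
    have subP: "P \<subseteq> (\<Union>j\<in>T. M j)" if "d \<in> T'"
    proof -
      have "Some d \<in> T" "M (Some d) = P" using that unfolding T'_def M_def by auto
      then show ?thesis by blast
    qed
    have subQ: "Q \<subseteq> (\<Union>j\<in>T. M j)" if "None \<in> T"
      using that unfolding M_def by fastforce
    have cT': "card T' \<le> card (T' - {d}) + (if d \<in> T' then 1 else 0)"
      using finT' card_Suc_Diff1[of T' d] by auto
    show "card T \<le> 2 * card (\<Union>j\<in>T. M j)"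
    proof (cases "None \<in> T")
      case False
      then have "card T = card T'" using TT cT by auto
      moreover have "card T' \<le> 2 * card (\<Union>j\<in>T. M j)"
      proof (cases "T' - {d} = {}")
        case True
        then have "T' = {} \<or> (T' = {d} \<and> d \<in> T')" by blast
        then show ?thesis using le[OF subP] pos by (auto simp: card_eq_0_iff)
      next
        case False
        have "card (T' - {d}) + 1 \<le> 2 * card (\<Union>i\<in>T' - {d}. N i)"
          using T' False by (intro surplus) auto
        then show ?thesis using le[OF sub] cT' by (auto split: if_splits)
      qed
      ultimately show ?thesis by simp
    next
      case True
      then have cardT: "card T = card T' + 1" using TT cT finT' by auto
      show ?thesis
      proof (cases "d \<in> T'")
        case dT: True
        \<comment> \<open>With both copies of \<open>d\<close> present, \<open>P\<close> and
          \<open>Q\<close> together cover \<open>N d\<close>. The neighbourhood is thus no smaller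
          than that of \<open>T'\<close>, and its surplus pays for the second copy.\<close>
        have "(\<Union>i\<in>T'. N i) \<subseteq> (\<Union>j\<in>T. M j)"
        proof
          fix x assume "x \<in> (\<Union>i\<in>T'. N i)"
          then obtain i where "i \<in> T'" "x \<in> N i" by blast
          then have "x \<in> (\<Union>i\<in>T' - {d}. N i) \<or> x \<in> P \<or> x \<in> Q" using d(2) by (cases "i = d") auto
          then show "x \<in> (\<Union>j\<in>T. M j)" using sub subP[OF dT] subQ[OF True] by auto
        qed
        then have "card (\<Union>i\<in>T'. N i) \<le> card (\<Union>j\<in>T. M j)" by (rule le)
        moreover have "card T' + 1 \<le> 2 * card (\<Union>i\<in>T'. N i)"
          using T' dT by (intro surplus) auto
        ultimately show ?thesis using cardT by linarith
      next
        case False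
        show ?thesis
        proof (cases "T' = {}")
          case True
          then show ?thesis using cardT le[OF subQ] \<open>None \<in> T\<close> pos by simp
        next
          case ne: False
          have "card T' + 1 \<le> 2 * card (\<Union>i\<in>T'. N i)" using T' ne by (intro surplus) auto
          moreover have "card (\<Union>i\<in>T'. N i) \<le> card (\<Union>j\<in>T. M j)"
            using sub False by (intro le) auto
          ultimately show ?thesis using cardT by linarith
        qed
      qed
    qed
  qed (use assms cardJ in auto)
  then obtain g where g: "\<forall>j\<in>J. g j \<in> M j" "\<forall>x\<in>X. card {j \<in> J. g j = x} = 2" by blast
  have "card {i \<in> I. g (Some i) = x} + (if g None = x then 1 else 0) = 2" if "x \<in> X" for x
  proof -
    have eq: "{j \<in> J. g j = x} = (if g None = x then {None} else {}) \<union> Some ` {i \<in> I. g (Some i) = x}"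
      unfolding J_def by auto
    have "finite {i \<in> I. g (Some i) = x}" using assms(1) by simp
    then have "card {j \<in> J. g j = x} = (if g None = x then 1 else 0) + card {i \<in> I. g (Some i) = x}"
      unfolding eq by (subst card_Un_disjoint) (auto simp: card_image)
    then show ?thesis using g(2) that by simp
  qed
  moreover have "g (Some i) \<in> N i" if "i \<in> I - {d}" for i
  proof -
    have "g (Some i) \<in> M (Some i)" using g(1) that unfolding J_def by blast
    then show ?thesis using that unfolding M_def by auto
  qed
  moreover have "g (Some d) \<in> P"
  proof -
    have "g (Some d) \<in> M (Some d)" using g(1) d(1) unfolding J_def by blast
    then show ?thesis unfolding M_def by auto
  qed
  moreover have "g None \<in> Q"
  proof -
    have "g None \<in> M None" using g(1) unfolding J_def by blast
    then show ?thesis unfolding M_def by auto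
  qed
  ultimately show ?thesis
    by (intro exI[of _ "\<lambda>i. g (Some i)"] exI[of _ "g None"]) auto
qed

section \<open>Path covers and matchings\<close>

definition path_in :: "('a \<Rightarrow> 'a \<Rightarrow> bool) \<Rightarrow> 'a list \<Rightarrow> bool" where
  "path_in A p \<longleftrightarrow> distinct p \<and> successively A p"

text \<open>A spanning family of disjoint paths of order at least 3, added one at a time; unions of
  disjoint covered sets then follow by induction without naming the family.\<close>

inductive path_coverable :: "('a \<Rightarrow> 'a \<Rightarrow> bool) \<Rightarrow> 'a set \<Rightarrow> bool" for A where
  empty: "path_coverable A {}"
| add: "path_coverable A S \<Longrightarrow> path_in A p \<Longrightarrow> 3 \<le> length p \<Longrightarrow> set p \<inter> S = {} \<Longrightarrow>
    path_coverable A (set p \<union> S)"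

inductive matchable :: "('a \<Rightarrow> 'a \<Rightarrow> bool) \<Rightarrow> 'a set \<Rightarrow> bool" for A where
  empty: "matchable A {}"
| add: "matchable A S \<Longrightarrow> A u v \<Longrightarrow> u \<noteq> v \<Longrightarrow> u \<notin> S \<Longrightarrow> v \<notin> S \<Longrightarrow> matchable A (insert u (insert v S))"

text \<open>A cover in progress: \<open>p\<close> may have fewer than three vertices and is kept
  apart so that it can still be prolonged at its ends. Its length is checked only when the cover is
  closed by \<open>path_cover_along_coverable\<close>.\<close>

definition path_cover_along :: "('a \<Rightarrow> 'a \<Rightarrow> bool) \<Rightarrow> 'a set \<Rightarrow> 'a list \<Rightarrow> bool" where
  "path_cover_along A S p \<longleftrightarrow> path_in A p \<and> set p \<subseteq> S \<and> path_coverable A (S - set p)"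

lemma path_coverable_mono:
  assumes "path_coverable A S" "\<And>u v. A u v \<Longrightarrow> B u v"
  shows "path_coverable B S"
  using assms(1)
proof induction
  case (add S p)
  have "path_in B p"
    using add(2) assms(2) unfolding path_in_def by (auto intro: successively_mono)
  then show ?case using add by (intro path_coverable.add) auto
qed (rule path_coverable.empty)

lemma path_coverable_Un:
  assumes "path_coverable A S" "path_coverable A T" "S \<inter> T = {}"
  shows "path_coverable A (S \<union> T)"
  using assms(1,3)
proof induction
  case empty
  then show ?case using assms(2) by simp
next
  case (add S p)
  have "path_coverable A (set p \<union> (S \<union> T))"
    using add by (intro path_coverable.add) auto
  then show ?case by (simp add: Un_assoc)
qed

lemma path_coverable_UN:
  assumes "finite I" "\<And>i. i \<in> I \<Longrightarrow> path_coverable A (F i)"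
    "\<And>i j. i \<in> I \<Longrightarrow> j \<in> I \<Longrightarrow> i \<noteq> j \<Longrightarrow> F i \<inter> F j = {}"
  shows "path_coverable A (\<Union>i\<in>I. F i)"
  using assms
proof (induction I)
  case empty
  then show ?case by (simp add: path_coverable.empty)
next
  case (insert i I)
  have "path_coverable A (F i \<union> (\<Union>i\<in>I. F i))"
  proof (rule path_coverable_Un)
    show "F i \<inter> (\<Union>i\<in>I. F i) = {}" using insert by fastforce
  qed (use insert in auto)
  then show ?case by simp
qed

lemma matchable_Un:
  assumes "matchable A S" "matchable A T" "S \<inter> T = {}"
  shows "matchable A (S \<union> T)"
  using assms(1,3)
proof induction
  case empty
  then show ?case using assms(2) by simp
next
  case (add S u v)
  have "matchable A (insert u (insert v (S \<union> T)))"
    using add by (intro matchable.add) auto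
  then show ?case by simp
qed

lemma matchable_UN:
  assumes "finite I" "\<And>i. i \<in> I \<Longrightarrow> matchable A (F i)"
    "\<And>i j. i \<in> I \<Longrightarrow> j \<in> I \<Longrightarrow> i \<noteq> j \<Longrightarrow> F i \<inter> F j = {}"
  shows "matchable A (\<Union>i\<in>I. F i)"
  using assms
proof (induction I)
  case empty
  then show ?case by (simp add: matchable.empty)
next
  case (insert i I)
  have "matchable A (F i \<union> (\<Union>i\<in>I. F i))"
  proof (rule matchable_Un)
    show "F i \<inter> (\<Union>i\<in>I. F i) = {}" using insert by fastforce
  qed (use insert in auto)
  then show ?case by simp
qed

lemma matchable_cong:
  assumes "matchable A S" "\<And>u v. u \<in> S \<Longrightarrow> v \<in> S \<Longrightarrow> A u v \<Longrightarrow> B u v"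
  shows "matchable B S"
  using assms by (induction) (auto intro: matchable.intros)

lemma matchable_finite_even: "matchable A S \<Longrightarrow> finite S \<and> even (card S)"
  by (induction rule: matchable.induct) auto

text \<open>The edge at \<open>v\<close> may have been added at any stage; the induction rebuilds
  the rest of the matching around it so that this edge can be split off.\<close>

lemma matchable_partner:
  assumes "matchable A S" "symp A" "v \<in> S"
  obtains u where "u \<in> S" "u \<noteq> v" "A v u" "matchable A (S - {u, v})"
proof -
  have "\<exists>u\<in>S. u \<noteq> v \<and> A v u \<and> matchable A (S - {u, v})"
    using assms(1,3)
  proof induction
    case (add S x y)
    show ?case
    proof (cases "v = x \<or> v = y")
      case True
      then have "insert x (insert y S) - {y, x} = S" "insert x (insert y S) - {x, y} = S" using add by auto
      moreover have "A y x" using add(2) sympD[OF assms(2)] by blast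
      ultimately show ?thesis using True add by (metis insertCI)
    next
      case False
      then obtain u where u: "u \<in> S" "u \<noteq> v" "A v u" "matchable A (S - {u, v})" using add by auto
      have "matchable A (insert x (insert y (S - {u, v})))"
        using u add by (intro matchable.add) auto
      moreover have "insert x (insert y (S - {u, v})) = insert x (insert y S) - {u, v}"
        using u False add by auto
      ultimately show ?thesis using u by auto
    qed
  qed auto
  then show ?thesis using that by blast
qed

lemma path_cover_along_coverable:
  assumes "path_cover_along A S p" "3 \<le> length p"
  shows "path_coverable A S"
proof -
  have "path_coverable A (set p \<union> (S - set p))"
    using assms unfolding path_cover_along_def by (intro path_coverable.add) auto
  moreover have "set p \<union> (S - set p) = S" using assms unfolding path_cover_along_def by auto
  ultimately show ?thesis by simp
qed

lemma path_in_rev: "symp A \<Longrightarrow> path_in A (rev p) = path_in A p"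
  unfolding path_in_def by (simp add: successively_rev symp_def) (metis successively_mono)

lemma path_cover_along_rev: "symp A \<Longrightarrow> path_cover_along A S (rev p) = path_cover_along A S p"
  unfolding path_cover_along_def by (simp add: path_in_rev)

lemma path_in_append:
  "path_in A (p @ q) \<longleftrightarrow> path_in A p \<and> path_in A q \<and> set p \<inter> set q = {} \<and>
     (p = [] \<or> q = [] \<or> A (last p) (hd q))"
  unfolding path_in_def by (auto simp: successively_append_iff)

lemma path_cover_along_append:
  assumes "path_cover_along A S p" "path_cover_along A T q" "S \<inter> T = {}"
    "p = [] \<or> q = [] \<or> A (last p) (hd q)"
  shows "path_cover_along A (S \<union> T) (p @ q)"
proof -
  have "path_coverable A ((S - set p) \<union> (T - set q))"
    using assms unfolding path_cover_along_def by (intro path_coverable_Un) auto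
  moreover have "(S - set p) \<union> (T - set q) = S \<union> T - set (p @ q)"
    using assms unfolding path_cover_along_def by auto
  ultimately show ?thesis
    using assms unfolding path_cover_along_def path_in_append by auto
qed

lemma path_cover_along_path: "path_in A p \<Longrightarrow> path_cover_along A (set p) p"
  unfolding path_cover_along_def by (simp add: path_coverable.empty)

lemma path_cover_along_singleton: "path_cover_along A {x} [x]"
  using path_cover_along_path[of A "[x]"] by (simp add: path_in_def)

lemma path_coverable_elem:
  assumes "path_coverable A S" "v \<in> S"
  shows "\<exists>p. v \<in> set p \<and> 3 \<le> length p \<and> path_cover_along A S p"
  using assms
proof induction
  case (add S p)
  show ?case
  proof (cases "v \<in> set p")
    case True
    moreover have "set p \<union> S - set p = S" using add by auto
    ultimately show ?thesis using add unfolding path_cover_along_def by (intro exI[of _ p]) auto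
  next
    case False
    then obtain q where q: "v \<in> set q" "3 \<le> length q" "path_cover_along A S q" using add by auto
    have "path_coverable A (set p \<union> (S - set q))"
      using q add unfolding path_cover_along_def by (intro path_coverable.add) auto
    moreover have "set p \<union> (S - set q) = set p \<union> S - set q"
      using q add unfolding path_cover_along_def by auto
    ultimately show ?thesis using q unfolding path_cover_along_def by (intro exI[of _ q]) auto
  qed
qed auto

section \<open>Suns\<close>

definition factor_critical_set :: "('a \<Rightarrow> 'a \<Rightarrow> bool) \<Rightarrow> 'a set \<Rightarrow> bool" where
  "factor_critical_set A H \<longleftrightarrow> (\<forall>v\<in>H. matchable A (H - {v}))"

text \<open>\<open>H\<close> is the set of hubs and \<open>p\<close> sends each hub to its pendant
  vertex. The edges among hubs are unrestricted.\<close>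

definition corona :: "('a \<Rightarrow> 'a \<Rightarrow> bool) \<Rightarrow> 'a set \<Rightarrow> ('a \<Rightarrow> 'a) \<Rightarrow> 'a set \<Rightarrow> bool" where
  "corona A H p S \<longleftrightarrow> S = H \<union> p ` H \<and> inj_on p H \<and> H \<inter> p ` H = {} \<and>
     (\<forall>h\<in>H. A h (p h) \<and> (\<forall>w\<in>S. A (p h) w \<longrightarrow> w = h))"

text \<open>\<open>K_2\<close> is the corona of a single vertex, which is factor-critical because
  the empty set is matchable; so only \<open>K_1\<close> is listed separately.\<close>

definition sun_set :: "('a \<Rightarrow> 'a \<Rightarrow> bool) \<Rightarrow> 'a set \<Rightarrow> bool" where
  "sun_set A S \<longleftrightarrow> (\<exists>v. S = {v}) \<or> (\<exists>H p. H \<noteq> {} \<and> factor_critical_set A H \<and> corona A H p S)"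

lemma factor_critical_set_cong:
  assumes "\<And>u v. u \<in> H \<Longrightarrow> v \<in> H \<Longrightarrow> A u v = B u v"
  shows "factor_critical_set A H = factor_critical_set B H"
  unfolding factor_critical_set_def
  using matchable_cong[of A _ B] matchable_cong[of B _ A] assms by (metis DiffD1)

lemma corona_cong:
  assumes "\<And>u v. u \<in> S \<Longrightarrow> v \<in> S \<Longrightarrow> A u v = B u v"
  shows "corona A H p S = corona B H p S"
  unfolding corona_def using assms by auto

lemma sun_set_cong:
  assumes "\<And>u v. u \<in> S \<Longrightarrow> v \<in> S \<Longrightarrow> A u v = B u v"
  shows "sun_set A S = sun_set B S"
proof -
  have "factor_critical_set A H = factor_critical_set B H" if "corona B H p S" for H p
    using assms that by (intro factor_critical_set_cong) (auto simp: corona_def)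
  then show ?thesis unfolding sun_set_def using corona_cong[of S A B] assms by auto
qed

lemma ncomps_sun_cong:
  assumes "\<And>u v. u \<in> S \<Longrightarrow> v \<in> S \<Longrightarrow> A u v = B u v"
  shows "ncomps (sun_set A) A S = ncomps (sun_set B) B S"
proof -
  have "sun_set A C = sun_set B C" if "C \<in> comps B S" for C
    using compsD(2)[OF that] assms by (intro sun_set_cong) blast
  moreover have "comps A S = comps B S" by (rule comps_cong) (rule assms)
  ultimately have "{C \<in> comps A S. sun_set A C} = {C \<in> comps B S. sun_set B C}" by blast
  then show ?thesis unfolding ncomps_def by simp
qed

section \<open>Covering coronas and suns by paths\<close>

lemma coronaD:
  assumes "corona A H p S" "h \<in> H"
  shows "A h (p h)" "p h \<notin> H" "h \<in> S" "p h \<in> S" "\<And>w. w \<in> S \<Longrightarrow> A (p h) w \<Longrightarrow> w = h"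
    "\<And>g. g \<in> H \<Longrightarrow> p h \<noteq> g" "\<And>g. g \<in> H \<Longrightarrow> p h = p g \<longleftrightarrow> h = g"
  using assms unfolding corona_def by (auto simp: inj_on_eq_iff)

text \<open>Each edge \<open>u v\<close> of a matching of hubs gives the four-vertex path
  \<open>p u, u, v, p v\<close>.\<close>

lemma corona_matchable_coverable:
  assumes "corona A H p S" "symp A" "matchable A M" "M \<subseteq> H"
  shows "path_coverable A (M \<union> p ` M)"
  using assms(3,4)
proof induction
  case empty
  then show ?case by (simp add: path_coverable.empty)
next
  case (add M u v)
  have uv: "u \<in> H" "v \<in> H" using add by auto
  have "path_in A [p u, u, v, p v]"
    using coronaD[OF assms(1) uv(1)] coronaD[OF assms(1) uv(2)] uv add(2,3) sympD[OF assms(2)]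
    unfolding path_in_def by auto
  moreover have "set [p u, u, v, p v] \<inter> (M \<union> p ` M) = {}"
  proof -
    have M: "M \<subseteq> H" using add.prems by auto
    have "x \<noteq> p u \<and> x \<noteq> p v \<and> p x \<noteq> u \<and> p x \<noteq> v \<and> p x \<noteq> p u \<and> p x \<noteq> p v"
      if "x \<in> M" for x
      using coronaD(6,7)[OF assms(1)] uv M that add.hyps by blast
    then show ?thesis using add.hyps by auto metis+
  qed
  ultimately have "path_coverable A (set [p u, u, v, p v] \<union> (M \<union> p ` M))"
    using add by (intro path_coverable.add) auto
  moreover have "set [p u, u, v, p v] \<union> (M \<union> p ` M)
      = insert u (insert v M) \<union> p ` insert u (insert v M)" by auto
  ultimately show ?case by simp
qed

text \<open>Factor-criticality matches the hubs other than \<open>h\<close>, so everything except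
  the pair \<open>h\<close>, \<open>p h\<close> splits into four-vertex paths, and this pair stays
  available as a short path with either end first.\<close>

lemma corona_hub_coverable:
  assumes "corona A H p S" "symp A" "factor_critical_set A H" "h \<in> H"
  shows "path_coverable A (S - {h, p h})" "path_in A [h, p h]" "path_in A [p h, h]"
proof -
  have "path_coverable A ((H - {h}) \<union> p ` (H - {h}))"
    using assms by (intro corona_matchable_coverable[OF assms(1,2)]) (auto simp: factor_critical_set_def)
  moreover have "(H - {h}) \<union> p ` (H - {h}) = S - {h, p h}"
    using assms(1,4) unfolding corona_def by (auto simp: inj_on_eq_iff)
  ultimately show "path_coverable A (S - {h, p h})" by simp
  show "path_in A [h, p h]" "path_in A [p h, h]"
    using coronaD[OF assms(1,4)] assms(4) sympD[OF assms(2)] unfolding path_in_def by auto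
qed

lemma sun_set_nonempty: "sun_set A D \<Longrightarrow> D \<noteq> {}"
  unfolding sun_set_def corona_def by auto

text \<open>Every vertex of a sun that is not \<open>K_1\<close> belongs to a pair of a hub and its
  pendant vertex, and such a pair can be the short path left over. Hence a sun can be attached
  through any of its vertices.\<close>

lemma sun_cover_along:
  assumes "sun_set A D" "symp A" "w \<in> D"
  obtains r where "path_cover_along A D (w # r)" "D \<noteq> {w} \<Longrightarrow> r \<noteq> []"
proof (cases "D = {w}")
  case True
  then show ?thesis using that[of "[]"] path_cover_along_singleton by metis
next
  case False
  then have "\<not> (\<exists>v. D = {v})" using assms(3) by auto
  then obtain H p where H: "factor_critical_set A H" "corona A H p D"
    using assms(1) unfolding sun_set_def by blast
  obtain h where h: "h \<in> H" "w = h \<or> w = p h" using H(2) assms(3) unfolding corona_def by auto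
  note c = corona_hub_coverable[OF H(2) assms(2) H(1) h(1)]
  have sub: "{h, p h} \<subseteq> D" using H(2) h(1) unfolding corona_def by auto
  have "path_cover_along A D [h, p h]" "path_cover_along A D [p h, h]"
    using c sub unfolding path_cover_along_def by (auto simp: insert_commute)
  then show ?thesis using h(2) that by auto
qed

text \<open>The short paths of the two suns, started at \<open>v\<close> and \<open>w\<close>, are
  joined through \<open>x\<close>; even for two copies of \<open>K_1\<close> the result has three
  vertices.\<close>

lemma sun_pair_coverable:
  assumes "symp A" "sun_set A D" "sun_set A E" "D \<inter> E = {}" "x \<notin> D \<union> E" "v \<in> D" "w \<in> E" "A x v" "A x w"
  shows "path_coverable A (insert x (D \<union> E))"
proof -
  obtain r where r: "path_cover_along A D (v # r)" using sun_cover_along[OF assms(2,1,6)] by blast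
  obtain s where s: "path_cover_along A E (w # s)" using sun_cover_along[OF assms(3,1,7)] by blast
  have "path_cover_along A D (rev r @ [v])" using r path_cover_along_rev[OF assms(1), of D "v # r"] by simp
  moreover have "path_cover_along A ({x} \<union> E) ([x] @ w # s)"
    using assms by (intro path_cover_along_append path_cover_along_singleton s) auto
  ultimately have "path_cover_along A (D \<union> ({x} \<union> E)) ((rev r @ [v]) @ ([x] @ w # s))"
    by (rule path_cover_along_append) (use assms in \<open>auto dest: sympD\<close>)
  then have "path_coverable A (D \<union> ({x} \<union> E))" by (rule path_cover_along_coverable) simp
  then show ?thesis by simp
qed

text \<open>Apart from \<open>K_1\<close>, a sun contributes a path of two vertices starting at
  \<open>w\<close>, and \<open>x\<close> is the third. One such sun therefore already suffices for
  \<open>x\<close>.\<close>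

lemma big_sun_coverable:
  assumes "symp A" "sun_set A D" "\<nexists>v. D = {v}" "x \<notin> D" "w \<in> D" "A x w"
  shows "path_coverable A (insert x D)"
proof -
  obtain r where r: "path_cover_along A D (w # r)" "r \<noteq> []"
    using sun_cover_along[OF assms(2,1,5)] assms(3) by metis
  have "path_cover_along A ({x} \<union> D) ([x] @ w # r)"
    using assms by (intro path_cover_along_append path_cover_along_singleton r(1)) auto
  then have "path_coverable A ({x} \<union> D)"
    by (rule path_cover_along_coverable) (use r in \<open>cases r; simp\<close>)
  then show ?thesis by simp
qed

text \<open>With \<open>Z\<close> a largest tight set, Hall's theorem matches \<open>Z\<close> to the factor-critical components.
  The other components are smaller than \<open>H\<close>: otherwise \<open>Z\<close> is empty, every \<open>H - {v}\<close> satisfies the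
  hypothesis, and \<open>H\<close> is factor-critical.\<close>

theorem matchable_if_factor_critical_comps:
  assumes "finite H" "symp A"
    "\<And>Z. Z \<subseteq> H \<Longrightarrow> ncomps (factor_critical_set A) A (H - Z) \<le> card Z"
  shows "matchable A H"
  using assms(1,3)
proof (induction "card H" arbitrary: H rule: less_induct)
  case less
  let ?c = "ncomps (factor_critical_set A) A"
  note bound = less.prems(2)
  define tight where "tight Z \<longleftrightarrow> Z \<subseteq> H \<and> ?c (H - Z) = card Z" for Z
  have t0: "tight {}" using bound[of "{}"] unfolding tight_def by simp
  have t1: "\<forall>Z. tight Z \<longrightarrow> card Z < Suc (card H)"
    using card_mono[OF less.prems(1)] unfolding tight_def by (simp add: less_Suc_eq_le)
  obtain Z where Z: "tight Z" and max: "\<And>Y. tight Y \<Longrightarrow> card Y \<le> card Z"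
    using ex_has_greatest_nat[of tight "{}" card, OF t0 t1] by auto
  have ZH: "Z \<subseteq> H" and cZ: "?c (H - Z) = card Z" using Z unfolding tight_def by auto
  have finZ: "finite Z" using ZH less.prems(1) finite_subset by blast
  define F where "F = {C \<in> comps A (H - Z). factor_critical_set A C}"
  define R where "R = comps A (H - Z) - F"
  have finFR: "finite F" "finite R" unfolding F_def R_def
    using finite_comps[of "H - Z" A] less.prems(1) by auto
  have cover: "\<Union>F \<union> \<Union>R = H - Z" using Union_comps[OF assms(2), of "H - Z"] unfolding F_def R_def by auto
  have R: "matchable A C" if C: "C \<in> R" for C
  proof -
    have Cc: "C \<in> comps A (H - Z)" and nfc: "\<not> factor_critical_set A C"
      using C unfolding R_def F_def by auto
    show ?thesis
    proof (cases "C = H")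
      case False
      then have CH: "C \<subset> H" using compsD(2)[OF Cc] by blast
      show ?thesis
      proof (rule less.hyps)
        show "card C < card H" using CH less.prems(1) psubset_card_mono by blast
        show "finite C" using CH less.prems(1) finite_subset by blast
        fix Y assume Y: "Y \<subseteq> C"
        have "?c (H - Z) + ?c (C - Y) \<le> ?c (H - Z - Y)"
          by (rule ncomps_split[where P = "factor_critical_set A", OF _ Cc Y nfc])
            (use less.prems(1) in simp)
        also have "H - Z - Y = H - (Z \<union> Y)" by auto
        also have "?c (H - (Z \<union> Y)) \<le> card (Z \<union> Y)" using ZH Y CH by (intro bound) auto
        also have "\<dots> \<le> card Z + card Y" by (rule card_Un_le)
        finally show "?c (C - Y) \<le> card Y" using cZ by simp
      qed
    next
      case True
      then have Z0: "Z = {}" using compsD(2)[OF Cc] ZH by auto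
      have "matchable A (H - {v})" if v: "v \<in> H" for v
      proof (rule less.hyps)
        show "card (H - {v}) < card H" using v less.prems(1) by (intro psubset_card_mono) auto
        show "finite (H - {v})" using less.prems(1) by simp
        fix Y assume Y: "Y \<subseteq> H - {v}"
        then have "finite Y" "v \<notin> Y" using less.prems(1) finite_subset[of Y "H - {v}"] by auto
        then have card: "card (insert v Y) = Suc (card Y)" by simp
        have sub: "insert v Y \<subseteq> H" using Y v by auto
        have eq: "H - {v} - Y = H - insert v Y" by auto
        \<comment> \<open>The largest tight set has size 0, so the bound is not attained at
          \<open>insert v Y\<close>; the unit gained pays for \<open>v\<close>.\<close>
        have "\<not> tight (insert v Y)" using max[of "insert v Y"] card Z0 by auto
        then have "?c (H - insert v Y) \<noteq> Suc (card Y)" using sub card unfolding tight_def by auto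
        then show "?c (H - {v} - Y) \<le> card Y" using bound[OF sub] card unfolding eq by simp
      qed
      then show ?thesis using nfc True unfolding factor_critical_set_def by blast
    qed
  qed
  have "hall F (nbrs A Z)"
    unfolding hall_def
  proof (intro allI impI)
    fix T assume "T \<subseteq> F"
    then have "card T \<le> ?c (H - (\<Union>D\<in>T. nbrs A Z D))"
      using less.prems(1) assms(2) ZH unfolding F_def by (intro card_le_ncomps_nbrs) auto
    also have "\<dots> \<le> card (\<Union>D\<in>T. nbrs A Z D)"
      using ZH unfolding nbrs_def by (intro bound) auto
    finally show "card T \<le> card (\<Union>D\<in>T. nbrs A Z D)" .
  qed
  then obtain f where f: "inj_on f F" "\<forall>D\<in>F. f D \<in> nbrs A Z D"
    using hall_marriage[of F "nbrs A Z"] finFR finZ unfolding nbrs_def by auto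
  have fZ: "f ` F = Z"
  proof (rule card_subset_eq[OF finZ])
    show "f ` F \<subseteq> Z" using f(2) unfolding nbrs_def by auto
    show "card (f ` F) = card Z" using card_image[OF f(1)] cZ unfolding F_def ncomps_def by simp
  qed
  have FD: "D \<subseteq> H - Z" "D \<in> comps A (H - Z)" if "D \<in> F" for D
    using that compsD(2)[of D A "H - Z"] unfolding F_def by auto
  have "matchable A (\<Union>D\<in>F. insert (f D) D)"
  proof (rule matchable_UN[OF finFR(1)])
    fix D assume D: "D \<in> F"
    then obtain w where w: "w \<in> D" "A (f D) w" "f D \<in> Z" using f(2) unfolding nbrs_def by auto
    have "matchable A (D - {w})" using D w unfolding F_def factor_critical_set_def by auto
    then have "matchable A (insert (f D) (insert w (D - {w})))"
      using w FD(1)[OF D] by (intro matchable.add) auto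
    then show "matchable A (insert (f D) D)" using w by (simp add: insert_absorb)
  next
    fix D E assume DE: "D \<in> F" "E \<in> F" "D \<noteq> E"
    then have "D \<inter> E = {}" using comps_disjoint FD(2) by metis
    moreover have "f D \<noteq> f E" using f(1) DE by (auto simp: inj_on_eq_iff)
    moreover have "f D \<in> Z" "f E \<in> Z" using fZ DE by auto
    ultimately show "insert (f D) D \<inter> insert (f E) E = {}" using FD(1)[OF DE(1)] FD(1)[OF DE(2)] by blast
  qed
  moreover have "matchable A (\<Union>C\<in>R. C)"
    using R comps_disjoint[of _ A "H - Z"] by (intro matchable_UN finFR(2)) (auto simp: R_def)
  moreover have "(\<Union>D\<in>F. insert (f D) D) \<inter> (\<Union>C\<in>R. C) = {}"
  proof -
    have False if "D \<in> F" "C \<in> R" "v \<in> insert (f D) D" "v \<in> C" for C D v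
    proof -
      have "C \<in> comps A (H - Z)" "C \<noteq> D" using that unfolding R_def by auto
      moreover have "f D \<in> Z" using fZ that by auto
      ultimately show False
        using comps_disjoint[of C A "H - Z" D] FD(2)[OF that(1)] compsD(2)[of C A "H - Z"] that by auto
    qed
    then show ?thesis by blast
  qed
  ultimately have "matchable A ((\<Union>D\<in>F. insert (f D) D) \<union> (\<Union>C\<in>R. C))" by (rule matchable_Un)
  moreover have "(\<Union>D\<in>F. insert (f D) D) \<union> (\<Union>C\<in>R. C) = f ` F \<union> (\<Union>F \<union> \<Union>R)" by auto
  ultimately show ?case using cover fZ ZH by (simp add: Un_absorb1)
qed

lemma corona_sun_comps:
  assumes "corona A H p S" "symp A" "finite S" "Z \<subseteq> H"
  shows "card Z + ncomps (factor_critical_set A) A (H - Z) \<le> ncomps (sun_set A) A (S - Z)"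
proof -
  note c = coronaD[OF assms(1)]
  have Sdef: "S = H \<union> p ` H" using assms(1) unfolding corona_def by auto
  have finH: "finite H" using assms(3) Sdef by auto
  define F where "F = {C \<in> comps A (H - Z). factor_critical_set A C}"
  define h where "h C = C \<union> p ` C" for C
  have finF: "finite F" using finite_comps[of "H - Z" A] finH unfolding F_def by auto
  have FD: "C \<subseteq> H - Z" "C \<noteq> {}" "factor_critical_set A C" "C \<in> comps A (H - Z)" if "C \<in> F" for C
    using that compsD(1,2)[of C A "H - Z"] unfolding F_def by auto
  have pend: "{p z} \<in> {C \<in> comps A (S - Z). sun_set A C}" if z: "z \<in> Z" for z
  proof -
    have zH: "z \<in> H" using z assms(4) by auto
    have "{p z} \<in> comps A (S - Z)"
      using c(4,5)[OF zH] c(6)[OF zH] assms(4) z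
      by (intro compsI connected_set_singleton) auto
    then show ?thesis unfolding sun_set_def by auto
  qed
  have hub: "h C \<in> {C \<in> comps A (S - Z). sun_set A C}" if C: "C \<in> F" for C
  proof -
    have CH: "C \<subseteq> H" using FD(1)[OF C] by auto
    have "h C \<in> comps A (S - Z)"
    proof (rule compsI)
      show "h C \<noteq> {}" using FD(2)[OF C] unfolding h_def by auto
      show "h C \<subseteq> S - Z" using FD(1)[OF C] c(2) assms(4) unfolding h_def Sdef by blast
      show "connected_set A (h C)"
      proof (rule connected_setI)
        fix T assume T: "T \<subseteq> h C" "T \<noteq> {}" "\<And>u v. u \<in> T \<Longrightarrow> v \<in> h C \<Longrightarrow> A u v \<Longrightarrow> v \<in> T"
        have up: "x \<in> T" if "p x \<in> T" "x \<in> C" for x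
          using T(3)[OF that(1), of x] c(1)[of x] that(2) CH sympD[OF assms(2)] unfolding h_def by blast
        have "T \<inter> C = C"
        proof (rule connected_setD[OF compsD(3)[OF FD(4)[OF C]]])
          show "T \<inter> C \<noteq> {}" using up T(1,2) unfolding h_def by blast
        qed (use T(3) in \<open>auto simp: h_def\<close>)
        then have "C \<subseteq> T" by auto
        moreover have "p x \<in> T" if "x \<in> C" for x
          using T(3)[of x "p x"] c(1)[of x] that CH \<open>C \<subseteq> T\<close> unfolding h_def by auto
        ultimately show "T = h C" using T(1) unfolding h_def by auto
      qed
      fix u v assume uv: "u \<in> h C" "v \<in> S - Z" "A u v"
      show "v \<in> h C"
      proof (cases "u \<in> C")
        case True
        show ?thesis
        proof (cases "v \<in> H")
          case vH: True
          then show ?thesis using compsD(4)[OF FD(4)[OF C] True, of v] uv unfolding h_def by auto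
        next
          case False
          then obtain x where x: "x \<in> H" "v = p x" using uv(2) Sdef by auto
          then have "u = x" using c(5)[OF x(1), of u] c(3)[of u] True CH uv(3) sympD[OF assms(2)] by blast
          then show ?thesis using x True unfolding h_def by auto
        qed
      next
        case False
        then obtain x where "x \<in> C" "u = p x" using uv(1) unfolding h_def by auto
        then show ?thesis using c(5)[of x v] CH uv unfolding h_def by auto
      qed
    qed
    moreover have "corona A C p (h C)"
      unfolding corona_def
    proof (intro conjI ballI allI impI)
      show "inj_on p C" using assms(1) CH unfolding corona_def by (auto intro: inj_on_subset)
      show "C \<inter> p ` C = {}" using CH c(2) by blast
      fix x w assume x: "x \<in> C"
      then show "A x (p x)" using CH c(1) by auto
      assume "w \<in> h C" "A (p x) w"
      moreover have "h C \<subseteq> S" using CH unfolding h_def Sdef by auto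
      ultimately show "w = x" using c(5)[of x w] x CH by auto
    qed (simp add: h_def)
    ultimately show ?thesis using FD(2,3)[OF C] unfolding sun_set_def by auto
  qed
  have hH: "h C \<inter> H = C" if "C \<in> F" for C
    using FD(1)[OF that] c(2) unfolding h_def by auto
  have inj: "inj_on h F" using hH by (metis inj_onI)
  have "card Z = card ((\<lambda>z. {p z}) ` Z)"
  proof (intro card_image[symmetric] inj_onI)
    fix y z assume "y \<in> Z" "z \<in> Z" "{p y} = {p z}"
    then show "y = z" using c(7)[of y z] assms(4) by auto
  qed
  moreover have "card F = card (h ` F)" using inj by (simp add: card_image)
  moreover have "(\<lambda>z. {p z}) ` Z \<inter> h ` F = {}"
  proof -
    have "{p z} \<noteq> h C" if "z \<in> Z" "C \<in> F" for z C
    proof -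
      have "p z \<notin> H" using c(2) that(1) assms(4) by auto
      then have "{p z} \<inter> H = {}" by simp
      then show ?thesis using hH[OF that(2)] FD(2)[OF that(2)] by metis
    qed
    then show ?thesis by blast
  qed
  moreover have "finite Z" using finH assms(4) finite_subset by blast
  ultimately have "card Z + card F = card ((\<lambda>z. {p z}) ` Z \<union> h ` F)"
    using finF by (simp add: card_Un_disjoint)
  also have "\<dots> \<le> ncomps (sun_set A) A (S - Z)"
    unfolding ncomps_def
  proof (rule card_mono)
    show "finite {C \<in> comps A (S - Z). sun_set A C}" using finite_comps[of "S - Z" A] assms(3) by simp
    show "(\<lambda>z. {p z}) ` Z \<union> h ` F \<subseteq> {C \<in> comps A (S - Z). sun_set A C}" using pend hub by blast
  qed
  finally show ?thesis unfolding ncomps_def F_def .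
qed

section \<open>Kaneko's theorem on path factors\<close>

abbreviation suns :: "('a \<Rightarrow> 'a \<Rightarrow> bool) \<Rightarrow> 'a set \<Rightarrow> nat" where
  "suns A \<equiv> ncomps (sun_set A) A"

text \<open>Used when the relation or the vertex set is altered near \<open>U\<close>: counted
  components away from \<open>U\<close> survive the change, and at most \<open>card U\<close>
  disjoint ones can meet it.\<close>

lemma ncomps_le_hitting:
  assumes "finite S" "finite S'" "finite U"
    "\<And>D. D \<in> comps B S \<Longrightarrow> P D \<Longrightarrow> D \<inter> U = {} \<Longrightarrow> D \<in> comps A S' \<and> Q D"
  shows "ncomps P B S \<le> ncomps Q A S' + card U"
proof -
  let ?K = "{D \<in> comps A S'. Q D}" and ?L = "{D \<in> comps B S. D \<inter> U \<noteq> {}}"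
  have "{D \<in> comps B S. P D} \<subseteq> ?K \<union> ?L" using assms(4) by blast
  moreover have "finite (?K \<union> ?L)" using finite_comps[OF assms(1), of B] finite_comps[OF assms(2), of A] by simp
  ultimately have "card {D \<in> comps B S. P D} \<le> card (?K \<union> ?L)" by (rule card_mono[rotated])
  also have "\<dots> \<le> card ?K + card ?L" by (rule card_Un_le)
  also have "card ?L \<le> card U" by (rule card_comps_hitting[OF assms(3)])
  finally show ?thesis unfolding ncomps_def by simp
qed

lemma sun_arm:
  assumes "symp A" "sun_set A D" "x \<notin> D" "w \<in> D" "A x w"
  obtains q where "path_cover_along A (insert x D) (x # q)" "q \<noteq> []"
proof -
  obtain r where r: "path_cover_along A D (w # r)" using sun_cover_along[OF assms(2,1,4)] by blast
  have "path_cover_along A ({x} \<union> D) ([x] @ w # r)"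
    by (rule path_cover_along_append[OF path_cover_along_singleton r]) (use assms in auto)
  then show ?thesis using that by auto
qed

text \<open>Each \<open>x\<close> in \<open>Y\<close> is joined to exactly two suns and forms with
  them a piece as in \<open>sun_pair_coverable\<close>; the pieces are disjoint because
  \<open>g\<close> assigns a sun only once.\<close>

lemma assigned_suns_coverable:
  assumes "symp A" "finite \<D>" "finite Y" "\<And>D. D \<in> \<D> \<Longrightarrow> sun_set A D"
    "\<And>D E. D \<in> \<D> \<Longrightarrow> E \<in> \<D> \<Longrightarrow> D \<noteq> E \<Longrightarrow> D \<inter> E = {}" "\<And>D. D \<in> \<D> \<Longrightarrow> D \<inter> Y = {}"
    "\<And>D. D \<in> \<D> \<Longrightarrow> g D \<in> Y \<Longrightarrow> \<exists>w\<in>D. A (g D) w"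
    "\<And>x. x \<in> Y \<Longrightarrow> card {D \<in> \<D>. g D = x} = 2"
  shows "path_coverable A (Y \<union> \<Union>{D \<in> \<D>. g D \<in> Y})"
proof -
  define F where "F x = insert x (\<Union>{D \<in> \<D>. g D = x})" for x
  have "path_coverable A (\<Union>x\<in>Y. F x)"
  proof (rule path_coverable_UN[OF assms(3)])
    fix x assume x: "x \<in> Y"
    obtain D E where DE: "{D \<in> \<D>. g D = x} = {D, E}" "D \<noteq> E"
      using assms(8)[OF x] by (meson card_2_iff)
    then have D: "D \<in> \<D>" "g D = x" "E \<in> \<D>" "g E = x" by auto
    obtain v w where vw: "v \<in> D" "A x v" "w \<in> E" "A x w"
      using assms(7)[OF D(1)] assms(7)[OF D(3)] D x by auto
    have "D \<inter> E = {}" using assms(5)[OF D(1,3) DE(2)] .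
    moreover have "x \<notin> D \<union> E" using assms(6)[OF D(1)] assms(6)[OF D(3)] x by blast
    ultimately have "path_coverable A (insert x (D \<union> E))"
      using assms(1) assms(4)[OF D(1)] assms(4)[OF D(3)] vw
      by (intro sun_pair_coverable[of A D E x v w])
    then show "path_coverable A (F x)" unfolding F_def DE(1) by simp
  next
    fix x y assume xy: "x \<in> Y" "y \<in> Y" "x \<noteq> y"
    have "D \<inter> E = {}" if "D \<in> \<D>" "E \<in> \<D>" "g D = x" "g E = y" for D E
      using assms(5)[OF that(1,2)] that xy by blast
    moreover have "x \<notin> E" "y \<notin> E" if "E \<in> \<D>" for E
      using assms(6)[OF that] xy by auto
    ultimately show "F x \<inter> F y = {}" using xy unfolding F_def by blast
  qed
  moreover have "(\<Union>x\<in>Y. F x) = Y \<union> \<Union>{D \<in> \<D>. g D \<in> Y}" unfolding F_def by auto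
  ultimately show ?thesis by simp
qed

lemma path_cover_along_mono:
  assumes "path_cover_along A S p" "\<And>u v. A u v \<Longrightarrow> B u v"
  shows "path_cover_along B S p"
  using assms path_coverable_mono[of A _ B] unfolding path_cover_along_def path_in_def
  by (auto intro: successively_mono)

text \<open>The vertex \<open>x\<close> becomes a leaf hanging at \<open>v\<close>, so that the path through \<open>x\<close> must start
  at \<open>x\<close> and can later be prolonged on the other side of \<open>x\<close>.\<close>

lemma strict_comp_cover_along:
  assumes "symp A" "irreflp A" "finite C" "connected_set A C" "\<not> sun_set A C"
    and strict: "\<And>Y. Y \<subseteq> C \<Longrightarrow> Y \<noteq> {} \<Longrightarrow> suns A (C - Y) + 1 \<le> 2 * card Y"
    and x: "x \<notin> C" "v \<in> C" "A x v"
    and IH: "\<And>B. symp B \<Longrightarrow> irreflp B \<Longrightarrow> (\<And>u w. B u w \<Longrightarrow> A u w) \<Longrightarrow>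
      (\<And>Z. Z \<subseteq> insert x C \<Longrightarrow> suns B (insert x C - Z) \<le> 2 * card Z) \<Longrightarrow> path_coverable B (insert x C)"
  shows "\<exists>r. path_cover_along A (insert x C) (x # v # r)"
proof -
  define B where "B u w \<longleftrightarrow> A u w \<and> (u \<in> C \<and> w \<in> C \<or> u = x \<and> w = v \<or> u = v \<and> w = x)" for u w
  have BA: "A u w" if "B u w" for u w using that unfolding B_def by auto
  have symB: "symp B" using sympD[OF assms(1)] unfolding B_def by (intro sympI) blast
  have irrB: "irreflp B" using irreflpD[OF assms(2)] unfolding B_def by (intro irreflpI) blast
  have agree: "B u w = A u w" if "u \<in> C" "w \<in> C" for u w using that unfolding B_def by auto
  have Bx: "w = v" if "B x w" for w using that x unfolding B_def by auto
  have Bxv: "B x v" "B v x" using x symB unfolding B_def by (auto dest: sympD)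
  have conB: "connected_set B C" using assms(4) connected_set_cong[of C B A] agree by auto
  have conx: "connected_set B (insert x C)"
  proof (rule connected_setI)
    fix T assume T: "T \<subseteq> insert x C" "T \<noteq> {}" "\<And>u w. u \<in> T \<Longrightarrow> w \<in> insert x C \<Longrightarrow> B u w \<Longrightarrow> w \<in> T"
    have "v \<in> T" if "x \<in> T" using T(3)[OF that, of v] Bxv x by auto
    then have ne: "T \<inter> C \<noteq> {}" using T(1,2) x by auto
    have "T \<inter> C = C" by (rule connected_setD[OF conB _ ne]) (use T(3) in auto)
    then have "C \<subseteq> T" by auto
    then have "x \<in> T" using T(3)[of v x] Bxv x by auto
    then show "T = insert x C" using \<open>C \<subseteq> T\<close> T(1) by auto
  qed
  have "\<exists>r. path_cover_along B (insert x C) (x # v # r)"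
  proof (cases "sun_set B (insert x C)")
    case True
    obtain r where r: "path_cover_along B (insert x C) (x # r)" "insert x C \<noteq> {x} \<Longrightarrow> r \<noteq> []"
      using sun_cover_along[OF True symB, of x] by blast
    then have "r \<noteq> []" using x by auto
    then obtain w s where ws: "r = w # s" by (cases r) auto
    then have "w = v" using r(1) Bx unfolding path_cover_along_def path_in_def by auto
    then show ?thesis using r(1) ws by auto
  next
    case False
    have "path_coverable B (insert x C)"
    proof (rule IH[OF symB irrB BA])
      fix Z assume Z: "Z \<subseteq> insert x C"
      have finZ: "finite Z" using Z assms(3) finite_subset by blast
      have sC: "suns B (C - Y) = suns A (C - Y)" for Y
        using agree by (intro ncomps_sun_cong) auto
      have "C \<noteq> {}" using x(2) by auto
      then have "{D \<in> comps A C. sun_set A D} = {}" using self_comps[OF assms(4)] assms(5) by auto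
      then have sC0: "suns A C = 0" unfolding ncomps_def by (metis card.empty)
      show "suns B (insert x C - Z) \<le> 2 * card Z"
      proof (cases "x \<in> Z")
        case True
        have eq: "insert x C - Z = C - (Z - {x})" using True x by auto
        have "suns A (C - (Z - {x})) \<le> 2 * card (Z - {x})"
        proof (cases "Z - {x} = {}")
          case True
          then show ?thesis using sC0 by (metis Diff_empty le0)
        next
          case False
          then show ?thesis using strict[of "Z - {x}"] Z by fastforce
        qed
        also have "\<dots> \<le> 2 * card Z" using finZ by (simp add: card_Diff1_le)
        finally show ?thesis unfolding eq sC .
      next
        case xZ: False
        show ?thesis
        proof (cases "Z = {}")
          case True
          then show ?thesis using self_comps[OF conx] \<open>\<not> sun_set B (insert x C)\<close> unfolding ncomps_def by auto
        next
          case ne: False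
          \<comment> \<open>Only the component containing \<open>x\<close> can be new, and the
            surplus in \<open>strict\<close> pays for it.\<close>
          have "suns B (insert x C - Z) \<le> suns A (C - Z) + card {x}"
          proof (rule ncomps_le_hitting)
            fix D assume D: "D \<in> comps B (insert x C - Z)" "sun_set B D" "D \<inter> {x} = {}"
            have DC: "D \<subseteq> C - Z" using compsD(2)[OF D(1)] D(3) by auto
            have "D \<in> comps B (C - Z)"
              using compsD[OF D(1)] DC by (intro compsI) auto
            moreover have "comps B (C - Z) = comps A (C - Z)" using agree by (intro comps_cong) auto
            moreover have "sun_set A D = sun_set B D" using DC agree by (intro sun_set_cong) blast
            ultimately show "D \<in> comps A (C - Z) \<and> sun_set A D" using D(2) by auto
          qed (use assms(3) in auto)
          also have "\<dots> \<le> 2 * card Z" using strict[of Z] Z xZ ne by auto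
          finally show ?thesis .
        qed
      qed
    qed
    then obtain p where p: "x \<in> set p" "3 \<le> length p" "path_cover_along B (insert x C) p"
      using path_coverable_elem[of B "insert x C" x] by auto
    \<comment> \<open>The vertices next to \<open>x\<close> on its path can only be
      \<open>v\<close>, and \<open>v\<close> occurs once; so \<open>x\<close> is an end and
      \<open>v\<close> comes next to it.\<close>
    then obtain q r where qr: "p = q @ x # r" by (meson split_list)
    have pp: "path_in B p" using p(3) unfolding path_cover_along_def by auto
    have hdr: "hd r = v" if "r \<noteq> []"
    proof -
      have "B x (hd r)" using pp that unfolding qr path_in_append by (cases r) (auto simp: path_in_def)
      then show ?thesis using Bx by auto
    qed
    have lastq: "last q = v" if "q \<noteq> []"
    proof -
      have "B (last q) x" using pp that unfolding qr path_in_append by auto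
      then show ?thesis using Bx sympD[OF symB] by auto
    qed
    show ?thesis
    proof (cases "q = []")
      case True
      then have "r \<noteq> []" using qr p(2) by auto
      then have "r = v # tl r" using hdr by (cases r) auto
      then show ?thesis using p(3) qr True by (metis append_Nil)
    next
      case False
      have "r = []"
      proof (rule ccontr)
        assume "r \<noteq> []"
        then have "v \<in> set q" "v \<in> set r" using hdr lastq False by (metis last_in_set, metis hd_in_set)
        then show False using pp unfolding qr path_in_def by auto
      qed
      moreover have "q = butlast q @ [v]" using lastq False append_butlast_last_id by metis
      ultimately have "rev p = x # v # rev (butlast q)" using qr by (metis append.assoc append_Cons append_Nil rev.simps(2) rev_append rev_singleton_conv rev_swap)
      then show ?thesis using p(3) path_cover_along_rev[OF symB, of "insert x C" p] by metis
    qed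
  qed
  then show ?thesis using path_cover_along_mono BA by metis
qed

definition remove_edge :: "('a \<Rightarrow> 'a \<Rightarrow> bool) \<Rightarrow> 'a \<Rightarrow> 'a \<Rightarrow> 'a \<Rightarrow> 'a \<Rightarrow> bool" where
  "remove_edge A u v a b \<longleftrightarrow> A a b \<and> {a, b} \<noteq> {u, v}"

lemma factor_critical_set_card:
  assumes "factor_critical_set A H" "finite H" "h \<in> H" "H \<noteq> {h}"
  shows "3 \<le> card H"
proof -
  have "matchable A (H - {h})" using assms unfolding factor_critical_set_def by auto
  then have "even (card (H - {h}))" using matchable_finite_even by auto
  moreover have "card (H - {h}) \<noteq> 0"
    using assms(2-4) by (metis card_0_eq finite_Diff insert_Diff)
  moreover have "card H = Suc (card (H - {h}))" using assms by (metis card.remove)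
  ultimately show ?thesis by presburger
qed

text \<open>For nonempty \<open>Z\<close> at most two suns arise, one for each end of the edge. For
  empty \<open>Z\<close> the slack at one-vertex sets is used: a new sun missing an end
  \<open>b\<close> would be a sun component of \<open>S - {b}\<close>; one containing both ends
  would be all of \<open>S\<close>, and deleting a suitable hub would isolate its pendant vertex
  even with the edge restored.\<close>

lemma suns_remove_edge:
  assumes "symp A" "finite S" "connected_set A S" "\<not> sun_set A S" "u \<in> S" "v \<in> S" "u \<noteq> v" "A u v"
    and slack: "\<And>X. X \<subseteq> S \<Longrightarrow> X \<noteq> {} \<Longrightarrow> suns A (S - X) + 2 \<le> 2 * card X"
    and Z: "Z \<subseteq> S"
  shows "suns (remove_edge A u v) (S - Z) \<le> 2 * card Z"
proof -
  define B where "B = remove_edge A u v"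
  have BA: "B a b \<longleftrightarrow> A a b \<and> {a, b} \<noteq> {u, v}" for a b unfolding B_def remove_edge_def by simp
  \<comment> \<open>For a single deleted vertex the slack reads
    \<open>suns + 2 \<le> 2\<close>.\<close>
  have no_sun: "\<not> sun_set A D" if "x \<in> S" "D \<in> comps A (S - {x})" for x D
  proof -
    have "suns A (S - {x}) = 0" using slack[of "{x}"] that by simp
    then show ?thesis using that finite_comps[of "S - {x}" A] assms(2) unfolding ncomps_def by auto
  qed
  have "suns B (S - Z) \<le> 2 * card Z"
  proof (cases "Z = {}")
    case False
    have "suns B (S - Z) \<le> suns A (S - Z) + card {u, v}"
    proof (rule ncomps_le_hitting)
      fix D assume D: "D \<in> comps B (S - Z)" "sun_set B D" "D \<inter> {u, v} = {}"
      have agree: "A a b = B a b" if "a \<in> D" for a b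
        using that D(3) unfolding BA by (auto simp: doubleton_eq_iff)
      have "connected_set A D" using compsD(3)[OF D(1)] connected_set_cong[of D A B] agree by auto
      then have "D \<in> comps A (S - Z)" using compsD[OF D(1)] agree by (intro compsI) auto
      moreover have "sun_set A D" using D(2) sun_set_cong[of D A B] agree by auto
      ultimately show "D \<in> comps A (S - Z) \<and> sun_set A D" by simp
    qed (use assms(2) in auto)
    then show ?thesis using slack[OF Z False] assms(7) by simp
  next
    case True
    have "\<not> sun_set B D" if D: "D \<in> comps B S" for D
    proof
      assume sD: "sun_set B D"
      have half: False if "b \<notin> D" "{a, b} = {u, v}" for a b
      proof -
        have agree: "A x y = B x y" if "x \<in> D" "y \<noteq> b" for x y
          using that \<open>b \<notin> D\<close> \<open>{a, b} = {u, v}\<close> unfolding BA by (auto simp: doubleton_eq_iff)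
        have agreeD: "A x y = B x y" if "x \<in> D" "y \<in> D" for x y
          using that agree[of x y] \<open>b \<notin> D\<close> by blast
        have "connected_set A D" using compsD(3)[OF D] connected_set_cong[of D A B] agreeD by auto
        then have "D \<in> comps A (S - {b})"
          using compsD[OF D] agree \<open>b \<notin> D\<close> by (intro compsI) auto
        moreover have "sun_set A D" using sD sun_set_cong[of D A B] agreeD by auto
        moreover have "b \<in> S" using that assms(5,6) by (auto simp: doubleton_eq_iff)
        ultimately show False using no_sun by blast
      qed
      have uvD: "u \<in> D" "v \<in> D" using half[of v u] half[of u v] by auto
      have DS: "D = S"
      proof (rule connected_setD[OF assms(3) compsD(2)[OF D] compsD(1)[OF D]])
        fix a b assume ab: "a \<in> D" "b \<in> S" "A a b"
        show "b \<in> D"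
        proof (cases "B a b")
          case True
          then show ?thesis using compsD(4)[OF D] ab by blast
        next
          case False
          then show ?thesis using ab uvD unfolding BA by (auto simp: doubleton_eq_iff)
        qed
      qed
      have "\<nexists>w. S = {w}" using assms(5-7) by auto
      then obtain H p where H: "H \<noteq> {}" "factor_critical_set B H" "corona B H p S"
        using sD unfolding DS sun_set_def by blast
      note c = coronaD[OF H(3)]
      have Sdef: "S = H \<union> p ` H" using H(3) unfolding corona_def by auto
      have finH: "finite H" using Sdef assms(2) by auto
      \<comment> \<open>A pendant vertex that is not an end of the removed edge. With several hubs
        there are at least three pendant vertices by parity; with one hub the removed edge would be
        the edge from that hub to its pendant vertex.\<close>
      obtain h where h: "h \<in> H" "p h \<noteq> u" "p h \<noteq> v"
      proof (cases "\<exists>h. H = {h}")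
        case True
        then obtain h where h: "H = {h}" by auto
        then have "{u, v} = {h, p h}" using assms(5-7) Sdef by auto
        then have False using c(1)[of h] h unfolding BA by auto
        then show ?thesis by simp
      next
        case False
        then have "3 \<le> card H" using H(1) factor_critical_set_card[OF H(2) finH] by blast
        moreover have "card (p ` H) = card H" using H(3) unfolding corona_def by (simp add: card_image)
        moreover have "card {u, v} \<le> 2" by (simp add: card_insert_if)
        ultimately have "\<not> p ` H \<subseteq> {u, v}" using card_mono[of "{u, v}" "p ` H"] by auto
        then show ?thesis using that by auto
      qed
      have hS: "h \<in> S" using c(3)[OF h(1)] .
      have "{p h} \<in> comps A (S - {h})"
      proof (rule compsI)
        fix a w assume "a \<in> {p h}" "w \<in> S - {h}" "A a w"
        moreover have "B (p h) w" if "A (p h) w" using that h unfolding BA by (auto simp: doubleton_eq_iff)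
        ultimately show "w \<in> {p h}" using c(5)[OF h(1), of w] by auto
      qed (use c(4,6)[OF h(1)] h(1) in \<open>auto intro: connected_set_singleton\<close>)
      then show False using no_sun[OF hS] unfolding sun_set_def by blast
    qed
    then have "{D \<in> comps B S. sun_set B D} = {}" by blast
    then have "suns B S = 0" unfolding ncomps_def by (metis card.empty)
    then show ?thesis using True by simp
  qed
  then show ?thesis unfolding B_def .
qed

text \<open>Without \<open>p h\<close>, the hub \<open>h\<close> must join a longer path. A matching
  of the hubs other than some \<open>k\<close> gives \<open>h\<close> a partner \<open>u\<close>,
  hence the path \<open>h, u, p u\<close>, and leaves \<open>k\<close>, \<open>p k\<close> free as a
  short path that may start at \<open>w\<close>. If \<open>k\<close> is adjacent to
  \<open>h\<close>, all five vertices form one path, and nothing is left over.\<close>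

lemma corona_minus_pendant:
  assumes "corona A H p D" "symp A" "factor_critical_set A H" "h \<in> H" "H \<noteq> {h}"
  shows "path_coverable A (D - {p h})"
    "w \<in> D \<Longrightarrow> w \<noteq> p h \<Longrightarrow> \<exists>r. path_cover_along A (D - {p h}) (w # r)"
proof -
  note c = coronaD[OF assms(1)]
  have Ddef: "D = H \<union> p ` H" using assms(1) unfolding corona_def by auto
  have ex: "\<exists>u. u \<in> H \<and> u \<noteq> k \<and> u \<noteq> h \<and> A h u \<and> path_coverable A (D - {h, p h, k, p k, u, p u})"
    if k: "k \<in> H" "k \<noteq> h" for k
  proof -
    have "matchable A (H - {k})" using k assms(3) unfolding factor_critical_set_def by auto
    then obtain u where u: "u \<in> H - {k}" "u \<noteq> h" "A h u" "matchable A (H - {k} - {u, h})"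
      using matchable_partner[OF _ assms(2), of "H - {k}" h] assms(4) k by auto
    define M where "M = H - {k} - {u, h}"
    have "path_coverable A (M \<union> p ` M)"
      using u(4) unfolding M_def by (intro corona_matchable_coverable[OF assms(1,2)]) auto
    moreover have "M \<union> p ` M = D - {h, p h, k, p k, u, p u}"
      using c(6,7) u(1) k(1) assms(4) unfolding M_def Ddef by auto
    ultimately show ?thesis using u by auto
  qed
  obtain k where k: "k \<in> H" "k \<noteq> h" using assms(4,5) by blast
  \<comment> \<open>The partner found with \<open>k\<close> omitted is itself omitted the second
    time, so \<open>h\<close> obtains two distinct neighbours among the hubs.\<close>
  obtain h' where h': "h' \<in> H" "h' \<noteq> h" "A h h'" using ex[OF k] by auto
  obtain u where u: "u \<in> H" "u \<noteq> h'" "u \<noteq> h" "A h u"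
    "path_coverable A (D - {h, p h, h', p h', u, p u})" using ex[OF h'(1,2)] by auto
  have "path_in A [p h', h', h, u, p u]"
    using c(1,6,7)[OF h'(1)] c(1,6,7)[OF u(1)] c(6)[OF h'(1) assms(4)] c(6)[OF u(1) assms(4)] h' u(1-4)
      sympD[OF assms(2)] unfolding path_in_def by auto
  then have "path_coverable A (set [p h', h', h, u, p u] \<union> (D - {h, p h, h', p h', u, p u}))"
    using u(5) by (intro path_coverable.add) auto
  moreover have "set [p h', h', h, u, p u] \<union> (D - {h, p h, h', p h', u, p u}) = D - {p h}"
    using c(3,4)[OF h'(1)] c(3,4)[OF u(1)] c(3)[OF assms(4)] c(6,7)[OF assms(4)] h'(1,2) u(1,3) assms(4)
      c(7)[OF h'(1) assms(4)] c(7)[OF u(1) assms(4)] by auto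
  ultimately show "path_coverable A (D - {p h})" by simp
  assume w: "w \<in> D" "w \<noteq> p h"
  then obtain k where k: "k \<in> H" "w = k \<or> w = p k" unfolding Ddef by auto
  show "\<exists>r. path_cover_along A (D - {p h}) (w # r)"
  proof (cases "k = h")
    case True
    then have wh: "w = h" using k w by auto
    have "D - {p h} - set [h] = D - {h, p h}" by auto
    then have "path_cover_along A (D - {p h}) [h]"
      using corona_hub_coverable(1)[OF assms(1-4)] c(3)[OF assms(4)] c(6)[OF assms(4) assms(4)]
      unfolding path_cover_along_def path_in_def by simp
    then show ?thesis unfolding wh by blast
  next
    case False
    then obtain u where u: "u \<in> H" "u \<noteq> k" "u \<noteq> h" "A h u"
      "path_coverable A (D - {h, p h, k, p k, u, p u})" using ex[OF k(1)] by auto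
    have "path_in A [h, u, p u]"
      using c(1)[OF u(1)] c(6)[OF u(1) u(1)] c(6)[OF u(1) assms(4)] u(3,4) unfolding path_in_def by auto
    then have "path_coverable A (set [h, u, p u] \<union> (D - {h, p h, k, p k, u, p u}))"
      using u(5) by (intro path_coverable.add) auto
    moreover have "set [h, u, p u] \<union> (D - {h, p h, k, p k, u, p u}) = D - {p h} - {k, p k}"
      using c(3,4)[OF u(1)] c(3)[OF assms(4)] c(6)[OF u(1)] c(6)[OF k(1)] c(6)[OF assms(4) assms(4)]
        c(6)[OF assms(4) k(1)] c(6)[OF assms(4) u(1)] c(7)[OF u(1)]
        k(1) u(1-3) assms(4) False by auto
    ultimately have cov: "path_coverable A (D - {p h} - {k, p k})" by simp
    have "path_in A [k, p k]" "path_in A [p k, k]"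
      using c(1)[OF k(1)] c(6)[OF k(1) k(1)] sympD[OF assms(2)] unfolding path_in_def by auto
    moreover have "{k, p k} \<subseteq> D - {p h}"
      using c(3,4)[OF k(1)] c(6)[OF assms(4) k(1)] c(7)[OF k(1) assms(4)] False by auto
    ultimately have "path_cover_along A (D - {p h}) [k, p k]" "path_cover_along A (D - {p h}) [p k, k]"
      using cov unfolding path_cover_along_def by (auto simp: insert_commute)
    then show ?thesis using k(2) by blast
  qed
qed

section \<open>Assembling a path cover from the components left by a deleted set\<close>

lemma nbrsD: "x \<in> nbrs A X D \<Longrightarrow> x \<in> X \<and> (\<exists>w\<in>D. A x w)"
  unfolding nbrs_def by auto

text \<open>One exceptional piece, made of \<open>Z\<close>, \<open>R'\<close> and
  \<open>F'\<close>, is covered by hand. Elsewhere each remaining vertex of \<open>X\<close> takes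
  two suns and each remaining non-sun component has its own cover.\<close>

lemma sun_nonsun_coverable:
  assumes "symp A" "finite S" "X \<subseteq> S"
    and F: "F = {D \<in> comps A (S - X). sun_set A D}"
    and R: "R = {D \<in> comps A (S - X). \<not> sun_set A D}"
    and sub: "Z \<subseteq> X" "R' \<subseteq> R" "F' \<subseteq> F"
    and spec: "path_coverable A (Z \<union> \<Union>R' \<union> \<Union>F')"
    and rest: "\<And>C. C \<in> R - R' \<Longrightarrow> path_coverable A C"
    and g: "\<And>D. D \<in> F - F' \<Longrightarrow> g D \<in> (X - Z) \<and> g D \<in> nbrs A X D"
    and two: "\<And>x. x \<in> X - Z \<Longrightarrow> card {D \<in> F - F'. g D = x} = 2"
  shows "path_coverable A S"
proof -
  have fin: "finite F" "finite R" unfolding F R using finite_comps[of "S - X" A] assms(2) by auto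
  have dis: "D \<inter> E = {}" if "D \<in> F \<union> R" "E \<in> F \<union> R" "D \<noteq> E" for D E
    using comps_disjoint[of D A "S - X" E] that unfolding F R by blast
  have DX: "D \<inter> X = {}" if "D \<in> F \<union> R" for D
    using compsD(2)[of D A "S - X"] that unfolding F R by blast
  have FR: "D \<noteq> E" if "D \<in> F" "E \<in> R" for D E using that unfolding F R by auto
  have "path_coverable A ((X - Z) \<union> \<Union>{D \<in> F - F'. g D \<in> X - Z})"
  proof (rule assigned_suns_coverable[OF assms(1)])
    show "finite (X - Z)" using assms(2,3) finite_subset by blast
    show "finite (F - F')" using fin by simp
    show "\<exists>w\<in>D. A (g D) w" if "D \<in> F - F'" for D
      using nbrsD g[OF that] by metis
    show "D \<inter> (X - Z) = {}" if "D \<in> F - F'" for D using DX[of D] that by auto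
    show "D \<inter> E = {}" if "D \<in> F - F'" "E \<in> F - F'" "D \<noteq> E" for D E
      using dis[of D E] that by auto
  qed (use two in \<open>auto simp: F\<close>)
  moreover have "{D \<in> F - F'. g D \<in> X - Z} = F - F'" using g by auto
  ultimately have 1: "path_coverable A ((X - Z) \<union> \<Union>(F - F'))" by simp
  have "path_coverable A (\<Union>C\<in>R - R'. C)"
    using fin rest dis by (intro path_coverable_UN) auto
  then have 2: "path_coverable A (\<Union>(R - R'))" by simp
  have "path_coverable A ((X - Z) \<union> \<Union>(F - F') \<union> \<Union>(R - R'))"
  proof (rule path_coverable_Un[OF 1 2])
    have "D \<inter> E = {}" if "D \<in> F - F'" "E \<in> R - R'" for D E
      using that by (intro dis FR) auto
    moreover have "D \<inter> X = {}" if "D \<in> R - R'" for D using DX[of D] that by auto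
    ultimately show "((X - Z) \<union> \<Union>(F - F')) \<inter> \<Union>(R - R') = {}" by blast
  qed
  then have "path_coverable A (((X - Z) \<union> \<Union>(F - F') \<union> \<Union>(R - R')) \<union> (Z \<union> \<Union>R' \<union> \<Union>F'))"
  proof (rule path_coverable_Un[OF _ spec])
    have "D \<inter> E = {}" if "D \<in> (F - F') \<union> (R - R')" "E \<in> R' \<union> F'" for D E
    proof -
      have "D \<noteq> E" "D \<in> F \<union> R" "E \<in> F \<union> R" using that sub FR by blast+
      then show ?thesis using dis by blast
    qed
    then have "\<Union>((F - F') \<union> (R - R')) \<inter> \<Union>(R' \<union> F') = {}" by blast
    moreover have "\<Union>((F - F') \<union> (R - R')) \<inter> X = {}" "\<Union>(R' \<union> F') \<inter> X = {}"
      using DX sub by blast+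
    ultimately show "((X - Z) \<union> \<Union>(F - F') \<union> \<Union>(R - R')) \<inter> (Z \<union> \<Union>R' \<union> \<Union>F') = {}"
      using sub(1) by blast
  qed
  moreover have "((X - Z) \<union> \<Union>(F - F') \<union> \<Union>(R - R')) \<union> (Z \<union> \<Union>R' \<union> \<Union>F') = X \<union> \<Union>(F \<union> R)"
    using sub by blast
  moreover have "F \<union> R = comps A (S - X)" unfolding F R by auto
  ultimately show ?thesis
    using Union_comps[OF assms(1), of "S - X"] assms(3) by (simp add: Un_absorb1)
qed

text \<open>The exceptional piece consists of the vertices \<open>Y\<close> with all suns assigned
  to them. For these suns \<open>g\<close> need not choose a neighbour, since \<open>spec\<close>
  already covers them.\<close>

lemma assignment_coverable:
  assumes "symp A" "finite S" "X \<subseteq> S" "\<And>D. D \<in> comps A (S - X) \<Longrightarrow> sun_set A D"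
    and g: "\<And>D. D \<in> comps A (S - X) \<Longrightarrow> g D \<in> X"
    and Y: "Y \<subseteq> X" "\<And>x. x \<in> X - Y \<Longrightarrow> card {D \<in> comps A (S - X). g D = x} = 2"
      "\<And>D. D \<in> comps A (S - X) \<Longrightarrow> g D \<notin> Y \<Longrightarrow> g D \<in> nbrs A X D"
    and spec: "path_coverable A (Y \<union> \<Union>{D \<in> comps A (S - X). g D \<in> Y})"
  shows "path_coverable A S"
proof -
  let ?D = "comps A (S - X)"
  have F: "?D = {D \<in> ?D. sun_set A D}" and R: "{} = {D \<in> ?D. \<not> sun_set A D}"
    using assms(4) by blast+
  show ?thesis
  proof (rule sun_nonsun_coverable[OF assms(1-3) F R, of Y "{}" "{D \<in> ?D. g D \<in> Y}" g])
    show "path_coverable A (Y \<union> \<Union>{} \<union> \<Union>{D \<in> ?D. g D \<in> Y})" using spec by simp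
    show "g D \<in> X - Y \<and> g D \<in> nbrs A X D" if "D \<in> ?D - {D \<in> ?D. g D \<in> Y}" for D
      using that g[of D] Y(3)[of D] by auto
    show "card {D \<in> ?D - {D \<in> ?D. g D \<in> Y}. g D = x} = 2" if "x \<in> X - Y" for x
    proof -
      have "{D \<in> ?D - {D \<in> ?D. g D \<in> Y}. g D = x} = {D \<in> ?D. g D = x}" using that by blast
      then show ?thesis using Y(2)[OF that] by simp
    qed
  qed (use Y(1) in auto)
qed

text \<open>The critical configuration: one sun is missing for every vertex of \<open>X\<close> to
  receive two, and there is no other component to fill the gap.\<close>

locale near_tight_all_suns =
  fixes A :: "'a \<Rightarrow> 'a \<Rightarrow> bool" and S X :: "'a set"
  assumes symA: "symp A" and irrA: "irreflp A" and finS: "finite S" and conS: "connected_set A S"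
    and XS: "X \<subseteq> S" and X_nonempty: "X \<noteq> {}"
    and all_suns: "\<And>D. D \<in> comps A (S - X) \<Longrightarrow> sun_set A D"
    and near_tight: "card (comps A (S - X)) + 1 = 2 * card X"
    and strict: "\<And>Y. Y \<subseteq> S \<Longrightarrow> Y \<noteq> {} \<Longrightarrow> suns A (S - Y) + 1 \<le> 2 * card Y"
begin

abbreviation "\<D> \<equiv> comps A (S - X)"
abbreviation "N \<equiv> nbrs A X"

lemma finX: "finite X" using finS XS finite_subset by blast

lemma finD: "finite \<D>" using finite_comps[of "S - X" A] finS by simp

lemma N_sub: "N D \<subseteq> X" unfolding nbrs_def by auto

lemma N_nonempty: "D \<in> \<D> \<Longrightarrow> N D \<noteq> {}"
  using comps_nbrs_nonempty[OF symA conS _ XS X_nonempty] by blast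

lemma D_disjoint: "D \<in> \<D> \<Longrightarrow> E \<in> \<D> \<Longrightarrow> D \<noteq> E \<Longrightarrow> D \<inter> E = {}"
  using comps_disjoint[of D A "S - X" E] by blast

lemma D_X: "D \<in> \<D> \<Longrightarrow> D \<subseteq> S \<and> D \<inter> X = {}"
  using compsD(2)[of D A "S - X"] by blast

lemma surplus:
  assumes "T \<subseteq> \<D>" "T \<noteq> {}"
  shows "card T + 1 \<le> 2 * card (\<Union>D\<in>T. N D)"
proof -
  have "card T \<le> suns A (S - (\<Union>D\<in>T. N D))"
    using assms all_suns by (intro card_le_ncomps_nbrs symA finS XS) auto
  moreover have "(\<Union>D\<in>T. N D) \<noteq> {}" using N_nonempty assms by blast
  ultimately show ?thesis
    using strict[of "\<Union>D\<in>T. N D"] N_sub XS by fastforce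
qed

text \<open>One sun \<open>d\<close> is counted twice, once for a \<open>y\<close> in
  \<open>P\<close> and once for a \<open>z\<close> in \<open>Q\<close>. If these differ,
  \<open>y\<close> and \<open>z\<close> each have one further sun, \<open>E\<close> and
  \<open>E'\<close>, and the five parts are covered together. If they coincide, both services of
  \<open>y\<close> come from \<open>d\<close>, so \<open>y\<close> and \<open>d\<close> must be
  covered by themselves.\<close>

lemma coverable_if_split:
  assumes d: "d \<in> \<D>" "N d \<subseteq> P \<union> Q" "P \<noteq> {}" "Q \<noteq> {}" "P \<subseteq> X" "Q \<subseteq> X"
    and two: "\<And>y z E E'. y \<in> P \<Longrightarrow> z \<in> Q \<Longrightarrow> y \<noteq> z \<Longrightarrow> E \<in> \<D> \<Longrightarrow> E' \<in> \<D> \<Longrightarrow> E \<noteq> d \<Longrightarrow> E' \<noteq> d \<Longrightarrow>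
      E \<noteq> E' \<Longrightarrow> y \<in> N E \<Longrightarrow> z \<in> N E' \<Longrightarrow> path_coverable A ({y, z} \<union> (d \<union> E \<union> E'))"
    and one: "\<And>y. y \<in> P \<Longrightarrow> y \<in> Q \<Longrightarrow> path_coverable A (insert y d)"
  shows "path_coverable A S"
proof -
  obtain g z where g: "\<forall>D\<in>\<D> - {d}. g D \<in> N D" "g d \<in> P" "z \<in> Q"
    and card: "\<forall>x\<in>X. card {D \<in> \<D>. g D = x} + (if z = x then 1 else 0) = 2"
    using hall_pairs_split[OF finD finX N_sub near_tight surplus d] by blast
  have gX: "g D \<in> X" if "D \<in> \<D>" for D using g N_sub d(5) that by blast
  have zX: "z \<in> X" using g(3) d(6) by auto
  let ?Y = "{g d, z}"
  show ?thesis
  proof (rule assignment_coverable[OF symA finS XS all_suns gX, where Y = ?Y])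
    show "?Y \<subseteq> X" using gX[OF d(1)] zX by auto
    show "card {D \<in> \<D>. g D = x} = 2" if "x \<in> X - ?Y" for x
    proof -
      have "x \<in> X" "z \<noteq> x" using that by auto
      then show ?thesis using card by auto
    qed
    show "g D \<in> N D" if "D \<in> \<D>" "g D \<notin> ?Y" for D
      using g(1) that by (metis DiffI insertCI singletonD)
    show "path_coverable A (?Y \<union> \<Union>{D \<in> \<D>. g D \<in> ?Y})"
    proof (cases "g d = z")
      case True
      then have "card {D \<in> \<D>. g D = z} = 1" using card zX by auto
      then have "{D \<in> \<D>. g D = z} = {d}" using True d(1)
        by (metis (mono_tags, lifting) card_1_singletonE mem_Collect_eq singletonD)
      then have "{D \<in> \<D>. g D \<in> ?Y} = {d}" using True by simp
      then show ?thesis using one[of z] g True by simp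
    next
      case False
      have "card {D \<in> \<D>. g D = z} = 1" using card zX by auto
      then obtain E' where E': "{D \<in> \<D>. g D = z} = {E'}" by (rule card_1_singletonE)
      have "card {D \<in> \<D>. g D = g d} = 2" using card gX[OF d(1)] False by auto
      then obtain D1 D2 where D12: "{D \<in> \<D>. g D = g d} = {D1, D2}" "D1 \<noteq> D2" by (meson card_2_iff)
      then have "d = D1 \<or> d = D2" using d(1) by blast
      then obtain E where E: "{D \<in> \<D>. g D = g d} = {d, E}" "d \<noteq> E" using D12 by (metis insert_commute)
      have EE: "E \<in> \<D>" "g E = g d" "E' \<in> \<D>" "g E' = z" using E E' by auto
      have ne: "E' \<noteq> d" "E \<noteq> E'" using EE False by auto
      have "path_coverable A ({g d, z} \<union> (d \<union> E \<union> E'))"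
      proof (rule two[OF g(2,3) False EE(1,3) E(2)[symmetric] ne])
        show "g d \<in> N E" using g(1) EE(1,2) E(2) by (metis DiffI singletonD)
        show "z \<in> N E'" using g(1) EE(3,4) ne(1) by (metis DiffI singletonD)
      qed
      moreover have "{D \<in> \<D>. g D \<in> ?Y} = {d, E, E'}" using E(1) E' by auto
      ultimately show ?thesis by (simp add: Un_assoc)
    qed
  qed auto
qed

lemma arm:
  assumes "E \<in> \<D>" "y \<in> N E"
  obtains q where "path_cover_along A (insert y E) (y # q)" "q \<noteq> []"
proof -
  obtain w where w: "w \<in> E" "A y w" using nbrsD[OF assms(2)] by auto
  have "y \<notin> E" using D_X[OF assms(1)] N_sub assms(2) by auto
  then show ?thesis using sun_arm[OF symA all_suns[OF assms(1)] _ w] that by blast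
qed

lemma rev_arm:
  assumes "E \<in> \<D>" "y \<in> N E"
  obtains q where "path_cover_along A (insert y E) (q @ [y])" "q \<noteq> []"
proof -
  obtain q where q: "path_cover_along A (insert y E) (y # q)" "q \<noteq> []" using arm[OF assms] .
  show ?thesis using that[of "rev q"] path_cover_along_rev[OF symA, of _ "y # q"] q by simp
qed

text \<open>One path runs from \<open>E\<close> through \<open>y\<close>, along \<open>q\<close>,
  then through \<open>z\<close> into \<open>E'\<close>; the rest of the three sets is covered
  already.\<close>

lemma bridge_coverable:
  assumes "y \<in> N E" "z \<in> N E'" "y \<noteq> z" "E \<in> \<D>" "E' \<in> \<D>" "E \<noteq> E'"
    "W \<inter> X = {}" "W \<inter> E = {}" "W \<inter> E' = {}" "path_cover_along A W q" "q \<noteq> []" "A y (hd q)" "A z (last q)"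
  shows "path_coverable A ({y, z} \<union> (W \<union> E \<union> E'))"
proof -
  obtain r where r: "path_cover_along A (insert y E) (r @ [y])" "r \<noteq> []" using rev_arm[OF assms(4,1)] .
  obtain s where s: "path_cover_along A (insert z E') (z # s)" "s \<noteq> []" using arm[OF assms(5,2)] .
  have yz: "y \<in> X" "z \<in> X" using assms(1,2) N_sub by auto
  note DX = D_X[OF assms(4)] D_X[OF assms(5)] D_disjoint[OF assms(4,5,6)]
  have "path_cover_along A (W \<union> insert z E') (q @ z # s)"
    by (rule path_cover_along_append[OF assms(10) s(1)])
      (use yz DX assms sympD[OF symA] in auto)
  then have "path_cover_along A (insert y E \<union> (W \<union> insert z E')) ((r @ [y]) @ q @ z # s)"
    by (rule path_cover_along_append[OF r(1)]) (use yz DX assms in auto)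
  then have "path_coverable A (insert y E \<union> (W \<union> insert z E'))"
    by (rule path_cover_along_coverable) (use assms(11) in \<open>cases q; auto\<close>)
  moreover have "insert y E \<union> (W \<union> insert z E') = {y, z} \<union> (W \<union> E \<union> E')" by auto
  ultimately show ?thesis by simp
qed

text \<open>The lone vertex \<open>a\<close> can stand between two vertices of \<open>X\<close>.
  Taking \<open>{y}\<close> and the other neighbours as the two sides excludes the case of equal
  services.\<close>

lemma coverable_if_singleton_two_nbrs:
  assumes "{a} \<in> \<D>" "y \<in> N {a}" "z \<in> N {a}" "y \<noteq> z"
  shows "path_coverable A S"
proof (rule coverable_if_split[OF assms(1), of "{y}" "N {a} - {y}"])
  fix y' z E E' assume h: "y' \<in> {y}" "z \<in> N {a} - {y}" "y' \<noteq> z" "E \<in> \<D>" "E' \<in> \<D>" "E \<noteq> {a}"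
    "E' \<noteq> {a}" "E \<noteq> E'" "y' \<in> N E" "z \<in> N E'"
  have "A y' a" "A z a" using h(1,2) nbrsD[OF assms(2)] nbrsD[of z A X "{a}"] by auto
  then show "path_coverable A ({y', z} \<union> ({a} \<union> E \<union> E'))"
    using h D_X[OF assms(1)] D_disjoint[OF assms(1) h(4)] D_disjoint[OF assms(1) h(5)]
    by (intro bridge_coverable[of y' E z E' "{a}" "[a]"]) (auto simp: path_cover_along_singleton)
qed (use assms N_sub in auto)

text \<open>A vertex \<open>x\<close> that sees only suns with at least two vertices is content with
  one of them. The second service of \<open>d\<close> is therefore fictitious and is charged to
  \<open>x\<close>.\<close>

lemma coverable_if_only_big_nbrs:
  assumes "x \<in> X" "\<And>a. {a} \<in> \<D> \<Longrightarrow> x \<notin> N {a}"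
  shows "path_coverable A S"
proof -
  have "card \<D> \<noteq> 0" using near_tight by presburger
  then have "\<D> \<noteq> {}" by auto
  then obtain d where d: "d \<in> \<D>" by blast
  have big: "path_coverable A (insert x E)" if E: "E \<in> \<D>" "x \<in> N E" for E
  proof -
    obtain w where "w \<in> E" "A x w" using nbrsD[OF E(2)] by auto
    then show ?thesis
      using E assms D_X[OF E(1)] all_suns[OF E(1)] by (intro big_sun_coverable[OF symA, of E x w]) auto
  qed
  show ?thesis
  proof (rule coverable_if_split[OF d, of "N d" "{x}"])
    fix y z E E' assume h: "y \<in> N d" "z \<in> {x}" "y \<noteq> z" "E \<in> \<D>" "E' \<in> \<D>" "E \<noteq> d" "E' \<noteq> d"
      "E \<noteq> E'" "y \<in> N E" "z \<in> N E'"
    obtain v w where vw: "v \<in> d" "A y v" "w \<in> E" "A y w" using nbrsD[OF h(1)] nbrsD[OF h(9)] by auto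
    have y: "y \<in> X" using h(1) N_sub by auto
    note dis = D_X[OF d] D_X[OF h(4)] D_X[OF h(5)] D_disjoint[OF d h(4) h(6)[symmetric]]
      D_disjoint[OF d h(5) h(7)[symmetric]] D_disjoint[OF h(4,5,8)]
    have "path_coverable A (insert y (d \<union> E))"
      using dis y h vw by (intro sun_pair_coverable[OF symA all_suns[OF d] all_suns[OF h(4)], of y v w]) auto
    moreover have "path_coverable A (insert z E')" using big[OF h(5)] h by auto
    ultimately have "path_coverable A (insert y (d \<union> E) \<union> insert z E')"
      by (rule path_coverable_Un) (use dis y h(2,3) assms(1) in auto)
    moreover have "insert y (d \<union> E) \<union> insert z E' = {y, z} \<union> (d \<union> E \<union> E')" by auto
    ultimately show "path_coverable A ({y, z} \<union> (d \<union> E \<union> E'))" by simp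
  next
    fix y assume "y \<in> N d" "y \<in> {x}"
    then show "path_coverable A (insert y d)" using big[OF d] by auto
  qed (use assms N_sub N_nonempty[OF d] in auto)
qed

text \<open>If the services differ, the path enters at \<open>s\<close> and leaves at
  \<open>t\<close>; if both come from the same \<open>y\<close>, it is
  \<open>s, y, t\<close>.\<close>

lemma coverable_if_edge_two_ends:
  assumes d: "{s, t} \<in> \<D>" "s \<noteq> t" "A s t" and ne: "N {s} \<noteq> {}" "N {t} \<noteq> {}"
  shows "path_coverable A S"
proof (rule coverable_if_split[OF d(1), of "N {s}" "N {t}"])
  have st: "path_in A [s, t]" using d unfolding path_in_def by simp
  fix y z E E' assume h: "y \<in> N {s}" "z \<in> N {t}" "y \<noteq> z" "E \<in> \<D>" "E' \<in> \<D>" "E \<noteq> {s, t}"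
    "E' \<noteq> {s, t}" "E \<noteq> E'" "y \<in> N E" "z \<in> N E'"
  have "A y s" "A z t" using nbrsD[OF h(1)] nbrsD[OF h(2)] by auto
  then show "path_coverable A ({y, z} \<union> ({s, t} \<union> E \<union> E'))"
    using h D_X[OF d(1)] D_disjoint[OF d(1) h(4)] D_disjoint[OF d(1) h(5)] path_cover_along_path[OF st]
    by (intro bridge_coverable[of y E z E' "{s, t}" "[s, t]"]) auto
next
  fix y assume y: "y \<in> N {s}" "y \<in> N {t}"
  then have "A s y" "A y t" "y \<notin> {s, t}"
    using nbrsD[OF y(1)] nbrsD[OF y(2)] D_X[OF d(1)] sympD[OF symA] by auto
  then have "path_in A [s, y, t]" using d unfolding path_in_def by auto
  then have "path_coverable A (set [s, y, t] \<union> {})"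
    by (intro path_coverable.add path_coverable.empty) auto
  then show "path_coverable A (insert y {s, t})" by (simp add: insert_commute)
qed (use N_sub ne in \<open>auto simp: nbrs_def\<close>)

text \<open>The service from \<open>y\<close> uses only the pendant vertex \<open>p h\<close>, since
  the rest of \<open>d\<close> can be covered without it. If \<open>z\<close> also attaches at
  \<open>p h\<close>, that vertex is a bridge; otherwise \<open>p h\<close> prolongs the arm of
  \<open>y\<close>, while \<open>z\<close> enters \<open>d - {p h}\<close> at
  \<open>w\<close>.\<close>

lemma coverable_if_pendant_nbr:
  assumes d: "d \<in> \<D>" and H: "factor_critical_set A H" "corona A H p d" and h: "h \<in> H" "H \<noteq> {h}"
    and ne: "N {p h} \<noteq> {}"
  shows "path_coverable A S"
proof (rule coverable_if_split[OF d, of "N {p h}" "N d"])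
  note c = coronaD[OF H(2)]
  have ph: "p h \<in> d" using c(4)[OF h(1)] .
  fix y z E E' assume *: "y \<in> N {p h}" "z \<in> N d" "y \<noteq> z" "E \<in> \<D>" "E' \<in> \<D>" "E \<noteq> d"
    "E' \<noteq> d" "E \<noteq> E'" "y \<in> N E" "z \<in> N E'"
  note dis = D_X[OF d] D_X[OF *(4)] D_X[OF *(5)] D_disjoint[OF d *(4) *(6)[symmetric]]
      D_disjoint[OF d *(5) *(7)[symmetric]] D_disjoint[OF *(4,5,8)]
  have yz: "y \<in> X" "z \<in> X" using * N_sub by auto
  have yp: "A y (p h)" using nbrsD[OF *(1)] by auto
  obtain w where w: "w \<in> d" "A z w" using nbrsD[OF *(2)] by auto
  show "path_coverable A ({y, z} \<union> (d \<union> E \<union> E'))"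
  proof (cases "w = p h")
    case True
    have "path_coverable A ({y, z} \<union> ({p h} \<union> E \<union> E'))"
      using * dis ph yp w True
      by (intro bridge_coverable[of y E z E' "{p h}" "[p h]"]) (auto simp: path_cover_along_singleton)
    moreover have "path_coverable A (d - {p h})"
      using corona_minus_pendant(1)[OF H(2) symA H(1) h] .
    ultimately have "path_coverable A (({y, z} \<union> ({p h} \<union> E \<union> E')) \<union> (d - {p h}))"
      by (rule path_coverable_Un) (use dis yz in auto)
    moreover have "({y, z} \<union> ({p h} \<union> E \<union> E')) \<union> (d - {p h}) = {y, z} \<union> (d \<union> E \<union> E')" using ph by auto
    ultimately show ?thesis by simp
  next
    case False
    obtain r where r: "path_cover_along A (d - {p h}) (w # r)"
      using corona_minus_pendant(2)[OF H(2) symA H(1) h w(1) False] by blast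
    obtain q where q: "path_cover_along A (insert z E') (q @ [z])" "q \<noteq> []" using rev_arm[OF *(5,10)] .
    obtain s where s: "path_cover_along A (insert y E) (s @ [y])" "s \<noteq> []" using rev_arm[OF *(4,9)] .
    have "path_cover_along A (insert z E' \<union> (d - {p h})) ((q @ [z]) @ w # r)"
      by (rule path_cover_along_append[OF q(1) r]) (use dis yz * w in auto)
    then have 1: "path_coverable A (insert z E' \<union> (d - {p h}))"
      by (rule path_cover_along_coverable) (use q(2) in \<open>cases q; auto\<close>)
    have "path_cover_along A (insert y E \<union> {p h}) ((s @ [y]) @ [p h])"
      by (rule path_cover_along_append[OF s(1) path_cover_along_singleton]) (use dis yz * ph yp in auto)
    then have 2: "path_coverable A (insert y E \<union> {p h})"
      by (rule path_cover_along_coverable) (use s(2) in \<open>cases s; auto\<close>)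
    have "path_coverable A ((insert z E' \<union> (d - {p h})) \<union> (insert y E \<union> {p h}))"
      by (rule path_coverable_Un[OF 1 2]) (use dis yz ph *(3) in auto)
    moreover have "(insert z E' \<union> (d - {p h})) \<union> (insert y E \<union> {p h}) = {y, z} \<union> (d \<union> E \<union> E')"
      using ph by auto
    ultimately show ?thesis by simp
  qed
next
  fix y assume y: "y \<in> N d"
  obtain w where w: "w \<in> d" "A y w" using nbrsD[OF y] by auto
  have "\<nexists>v. d = {v}"
    using coronaD(3,4,6)[OF H(2) h(1)] h(1) by (metis singletonD)
  moreover have "y \<notin> d" using y N_sub[of d] D_X[OF d] by blast
  ultimately show "path_coverable A (insert y d)"
    using w by (intro big_sun_coverable[OF symA all_suns[OF d], of y w]) auto
qed (use N_sub ne N_nonempty[OF d] in auto)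

text \<open>If no cover exists, the preceding lemmas give each lone component one neighbour in
  \<open>X\<close>, each vertex of \<open>X\<close> a lone component, and larger suns no edge from
  pendant vertices to \<open>X\<close>. This is exactly the shape of a corona.\<close>

lemma coverable_or_sun: "path_coverable A S \<or> sun_set A S"
proof (rule disjCI)
  assume noS: "\<not> sun_set A S"
  show "path_coverable A S"
  proof (rule ccontr)
    assume no: "\<not> path_coverable A S"
    have uniq: "y = z" if "{a} \<in> \<D>" "y \<in> N {a}" "z \<in> N {a}" for a y z
      using coverable_if_singleton_two_nbrs[OF that] no by blast
    have "\<forall>x\<in>X. \<exists>a. {a} \<in> \<D> \<and> x \<in> N {a}"
      using coverable_if_only_big_nbrs no by blast
    then obtain a where a: "\<And>x. x \<in> X \<Longrightarrow> {a x} \<in> \<D>" "\<And>x. x \<in> X \<Longrightarrow> x \<in> N {a x}" by metis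
    \<comment> \<open>Two lone components with the same single neighbour would contradict
      \<open>surplus\<close>, which would read 2 + 1 \<le> 2.\<close>
    have a_only: "\<exists>x\<in>X. b = a x" if b: "{b} \<in> \<D>" for b
    proof -
      obtain x where x: "x \<in> N {b}" using N_nonempty[OF b] by blast
      then have xX: "x \<in> X" using N_sub by auto
      have "b = a x"
      proof (rule ccontr)
        assume ne: "b \<noteq> a x"
        have "card {{b}, {a x}} + 1 \<le> 2 * card (\<Union>D\<in>{{b}, {a x}}. N D)"
          using b a(1)[OF xX] by (intro surplus) auto
        moreover have "(\<Union>D\<in>{{b}, {a x}}. N D) \<subseteq> {x}"
          using uniq[OF b x] uniq[OF a(1)[OF xX] a(2)[OF xX]] by auto
        then have "card (\<Union>D\<in>{{b}, {a x}}. N D) \<le> 1" using card_mono[of "{x}"] by fastforce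
        moreover have "card {{b}, {a x}} = 2" using ne by (simp add: card_insert_if)
        ultimately show False by linarith
      qed
      then show ?thesis using xX by auto
    qed
    have "\<exists>H p. factor_critical_set A H \<and> corona A H p D \<and> H \<noteq> {} \<and> (\<forall>h\<in>H. N {p h} = {})"
      if D: "D \<in> \<D>" "\<nexists>v. D = {v}" for D
    proof -
      obtain H p where H: "H \<noteq> {}" "factor_critical_set A H" "corona A H p D"
        using all_suns[OF D(1)] D(2) unfolding sun_set_def by blast
      show ?thesis
      proof (cases "\<exists>h. H = {h} \<and> N {p h} \<noteq> {}")
        case True
        then obtain h where h: "H = {h}" "N {p h} \<noteq> {}" by blast
        note c = coronaD[OF H(3), of h]
        have Ddef: "D = {h, p h}" using H(3) h(1) unfolding corona_def by auto
        have "N {h} = {}"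
        proof (rule ccontr)
          assume "N {h} \<noteq> {}"
          moreover have "{h, p h} \<in> \<D>" "h \<noteq> p h" "A h (p h)" using D(1) Ddef c(1) c(6)[of h] h(1) by auto
          ultimately show False using coverable_if_edge_two_ends h(2) no by blast
        qed
        \<comment> \<open>In \<open>K_2\<close> either end can be the hub. The end without
          neighbours in \<open>X\<close> is made the pendant vertex.\<close>
        moreover have "corona A {p h} (\<lambda>_. h) D"
          using c(1,6) h(1) sympD[OF symA] irreflpD[OF irrA] unfolding corona_def Ddef by auto
        moreover have "factor_critical_set A {p h}"
          unfolding factor_critical_set_def by (simp add: matchable.empty)
        ultimately show ?thesis by (intro exI[of _ "{p h}"] exI[of _ "\<lambda>_. h"]) auto
      next
        case False
        have "N {p h} = {}" if "h \<in> H" for h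
          using coverable_if_pendant_nbr[OF D(1) H(2,3) that] False no by blast
        then show ?thesis using H by blast
      qed
    qed
    then obtain HH pp where hp: "\<And>D. D \<in> \<D> \<Longrightarrow> \<nexists>v. D = {v} \<Longrightarrow> factor_critical_set A (HH D) \<and>
        corona A (HH D) (pp D) D \<and> HH D \<noteq> {} \<and> (\<forall>h\<in>HH D. N {pp D h} = {})"
      by metis
    define BB where "BB = {D \<in> \<D>. \<nexists>v. D = {v}}"
    have B: "D \<in> \<D>" "corona A (HH D) (pp D) D" "\<And>h. h \<in> HH D \<Longrightarrow> N {pp D h} = {}" "\<nexists>v. D = {v}"
      if "D \<in> BB" for D using hp that unfolding BB_def by auto
    \<comment> \<open>The hubs of \<open>S\<close> are the vertices of \<open>X\<close>, with the
      lone components as pendant vertices, and the hubs of the larger suns, which keep their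
      own.\<close>
    define H where "H = X \<union> (\<Union>D\<in>BB. HH D)"
    define co where "co v = (THE D. D \<in> \<D> \<and> v \<in> D)" for v
    have co: "co v = D" if "D \<in> \<D>" "v \<in> D" for v D
      unfolding co_def using that D_disjoint by (intro the_equality) blast+
    define p where "p v = (if v \<in> X then a v else pp (co v) v)" for v
    have HHD: "HH D \<subseteq> D" if "D \<in> BB" for D using B(2)[OF that] unfolding corona_def by auto
    have pX: "p x = a x" if "x \<in> X" for x using that unfolding p_def by simp
    have pB: "p h = pp D h" if "D \<in> BB" "h \<in> HH D" for D h
    proof -
      have "h \<in> D" using HHD that by auto
      moreover have "h \<notin> X" using D_X[OF B(1)[OF that(1)]] \<open>h \<in> D\<close> by auto
      ultimately show ?thesis using co[OF B(1)[OF that(1)]] unfolding p_def by simp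
    qed
    have pB_in: "p h \<in> D" "p h \<notin> HH D" "A h (p h)" if "D \<in> BB" "h \<in> HH D" for D h
      using coronaD[OF B(2)[OF that(1)] that(2)] pB[OF that] by auto
    have Hcases: "(h \<in> X \<Longrightarrow> R) \<Longrightarrow> (\<And>D. D \<in> BB \<Longrightarrow> h \<in> HH D \<Longrightarrow> R) \<Longrightarrow> R" if "h \<in> H" for h R
      using that unfolding H_def by blast
    have p_comp: "\<exists>D\<in>\<D>. p h \<in> D \<and> (h \<in> X \<and> D = {p h} \<or> D \<in> BB \<and> h \<in> HH D)" if "h \<in> H" for h
      using Hcases[OF that] a(1) pX pB_in(1) B(1) by (metis singletonI)
    have cor: "corona A H p S"
      unfolding corona_def
    proof (intro conjI ballI allI impI)
      show "S = H \<union> p ` H"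
      proof
        show "S \<subseteq> H \<union> p ` H"
        proof
          fix v assume v: "v \<in> S"
          show "v \<in> H \<union> p ` H"
          proof (cases "v \<in> X")
            case False
            then obtain D where D: "D \<in> \<D>" "v \<in> D" using comps_cover[OF symA, of v "S - X"] v by blast
            show ?thesis
            proof (cases "D \<in> BB")
              case True
              have "D = HH D \<union> pp D ` HH D" using B(2)[OF True] unfolding corona_def by auto
              then have "v \<in> HH D \<union> p ` HH D" using D(2) pB[OF True] by auto
              then show ?thesis using True unfolding H_def by blast
            next
              case False
              then have "D = {v}" using D unfolding BB_def by auto
              then obtain x where "x \<in> X" "v = a x" using a_only D(1) by blast
              then have "x \<in> H" "v = p x" using pX unfolding H_def by auto
              then show ?thesis by blast
            qed
          qed (auto simp: H_def)
        qed
        have "H \<subseteq> S" using XS HHD B(1) D_X unfolding H_def by blast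
        moreover have "p ` H \<subseteq> S" using p_comp D_X by blast
        ultimately show "H \<union> p ` H \<subseteq> S" by blast
      qed
      show "inj_on p H"
      proof (rule inj_onI)
        fix g h assume gh: "g \<in> H" "h \<in> H" "p g = p h"
        obtain D where D: "D \<in> \<D>" "p g \<in> D" "g \<in> X \<and> D = {p g} \<or> D \<in> BB \<and> g \<in> HH D"
          using p_comp[OF gh(1)] by blast
        obtain E where E: "E \<in> \<D>" "p h \<in> E" "h \<in> X \<and> E = {p h} \<or> E \<in> BB \<and> h \<in> HH E"
          using p_comp[OF gh(2)] by blast
        have ED: "E = D" using D_disjoint[OF D(1) E(1)] D(2) E(2) gh(3) by auto
        show "g = h"
        proof (cases "D \<in> BB")
          case True
          then have "g \<in> HH D" "h \<in> HH D" using D(3) E(3) B(4) ED by auto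
          then show ?thesis using gh(3) pB[OF True] coronaD(7)[OF B(2)[OF True]] by auto
        next
          case False
          then have "g \<in> X" "h \<in> X" using D(3) E(3) ED by auto
          then show ?thesis using gh(3) pX uniq[OF a(1) a(2), of g h] a(2)[of h] by auto
        qed
      qed
      show "H \<inter> p ` H = {}"
      proof (rule ccontr)
        assume "H \<inter> p ` H \<noteq> {}"
        then obtain g where g: "g \<in> H" "p g \<in> H" by blast
        obtain D where D: "D \<in> \<D>" "p g \<in> D" "g \<in> X \<and> D = {p g} \<or> D \<in> BB \<and> g \<in> HH D"
          using p_comp[OF g(1)] by blast
        have "p g \<notin> X" using D D_X by blast
        then obtain E where E: "E \<in> BB" "p g \<in> HH E" using g(2) unfolding H_def by blast
        then have "E = D" using D_disjoint[OF D(1) B(1)[OF E(1)]] D(2) HHD by blast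
        then show False using D(3) E pB_in(2)[of D g] B(4)[OF E(1)] by auto
      qed
      fix h assume h: "h \<in> H"
      show "A h (p h)" using Hcases[OF h] pB_in(3) a(2) pX nbrsD by (metis singletonD)
      fix w assume w: "w \<in> S" "A (p h) w"
      obtain D where D: "D \<in> \<D>" "p h \<in> D" "h \<in> X \<and> D = {p h} \<or> D \<in> BB \<and> h \<in> HH D"
        using p_comp[OF h] by blast
      show "w = h"
      proof (cases "w \<in> X")
        case True
        then have "w \<in> N {p h}" using w(2) sympD[OF symA] unfolding nbrs_def by blast
        then show ?thesis
          using D(3) pX[of h] uniq[OF a(1)[of h] _ a(2)[of h]] pB[of D h] B(3)[of D h] by auto
      next
        case False
        then have wD: "w \<in> D" using compsD(4)[OF D(1,2)] w by auto
        then show ?thesis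
          using D(3) w(2) irreflpD[OF irrA] pB[of D h] coronaD(5)[OF B(2)[of D], of h w] by auto
      qed
    qed
    have HS: "H \<subseteq> S" using cor unfolding corona_def by auto
    have finH: "finite H" using HS finS finite_subset by blast
    have "factor_critical_set A H"
      unfolding factor_critical_set_def
    proof
      fix v assume v: "v \<in> H"
      show "matchable A (H - {v})"
      proof (rule matchable_if_factor_critical_comps[OF _ symA])
        show "finite (H - {v})" using finH by simp
        fix Y assume Y: "Y \<subseteq> H - {v}"
        have finY: "finite Y" using finite_subset[OF Y] finH by simp
        have Z: "insert v Y \<subseteq> H" using Y v by auto
        \<comment> \<open>Writing \<open>c\<close> for the number of factor-critical components, |Y|
          + 1 + c is at most 2(|Y| + 1) - 1, so c \<le> |Y|: the single unit of surplus pays for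
          omitting \<open>v\<close>.\<close>
        have "card (insert v Y) + ncomps (factor_critical_set A) A (H - insert v Y) \<le> suns A (S - insert v Y)"
          by (rule corona_sun_comps[OF cor symA finS Z])
        moreover have "suns A (S - insert v Y) + 1 \<le> 2 * card (insert v Y)"
          using Z HS by (intro strict) auto
        moreover have "v \<notin> Y" using Y by blast
        then have "card (insert v Y) = card Y + 1" using finY by simp
        moreover have "H - {v} - Y = H - insert v Y" by auto
        ultimately show "ncomps (factor_critical_set A) A (H - {v} - Y) \<le> card Y" by simp
      qed
    qed
    moreover have "H \<noteq> {}" using X_nonempty unfolding H_def by auto
    ultimately show False using noS cor unfolding sun_set_def by blast
  qed
qed

end

section \<open>The induction for Kaneko's theorem\<close>

definition weight :: "('a \<Rightarrow> 'a \<Rightarrow> bool) \<Rightarrow> 'a set \<Rightarrow> nat" where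
  "weight A S = card S + card {(u, v). u \<in> S \<and> v \<in> S \<and> A u v}"

lemma finite_adj: "finite S \<Longrightarrow> finite {(u, v). u \<in> S \<and> v \<in> S \<and> A u v}"
  by (rule finite_subset[of _ "S \<times> S"]) auto

lemma weight_less_verts:
  assumes "finite S" "T \<subset> S" "\<And>u v. B u v \<Longrightarrow> A u v"
  shows "weight B T < weight A S"
proof -
  have "card {(u, v). u \<in> T \<and> v \<in> T \<and> B u v} \<le> card {(u, v). u \<in> S \<and> v \<in> S \<and> A u v}"
    using assms by (intro card_mono finite_adj) auto
  moreover have "card T < card S" using assms psubset_card_mono by blast
  ultimately show ?thesis unfolding weight_def by linarith
qed

lemma weight_remove_edge:
  assumes "finite S" "u \<in> S" "v \<in> S" "A u v"
  shows "weight (remove_edge A u v) S < weight A S"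
proof -
  have "{(a, b). a \<in> S \<and> b \<in> S \<and> remove_edge A u v a b} \<subset> {(a, b). a \<in> S \<and> b \<in> S \<and> A a b}"
  proof
    show "{(a, b). a \<in> S \<and> b \<in> S \<and> remove_edge A u v a b} \<noteq> {(a, b). a \<in> S \<and> b \<in> S \<and> A a b}"
    proof
      assume "{(a, b). a \<in> S \<and> b \<in> S \<and> remove_edge A u v a b} = {(a, b). a \<in> S \<and> b \<in> S \<and> A a b}"
      moreover have "(u, v) \<in> {(a, b). a \<in> S \<and> b \<in> S \<and> A a b}" using assms by simp
      moreover have "(u, v) \<notin> {(a, b). a \<in> S \<and> b \<in> S \<and> remove_edge A u v a b}"
        unfolding remove_edge_def by simp
      ultimately show False by metis
    qed
  qed (auto simp: remove_edge_def)
  then show ?thesis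
    unfolding weight_def using psubset_card_mono[OF finite_adj[OF assms(1)]] by simp
qed

text \<open>Deleting \<open>Y\<close> inside a non-sun component is read as deleting
  \<open>X \<union> Y\<close> from \<open>S\<close>, so equality or near-equality at
  \<open>X\<close> passes a bound on to that component.\<close>

lemma nonsun_comp_bound:
  assumes "finite S" "X \<subseteq> S" "C \<in> comps A (S - X)" "\<not> sun_set A C" "Y \<subseteq> C"
  shows "suns A (S - X) + suns A (C - Y) \<le> suns A (S - (X \<union> Y))"
    "card (X \<union> Y) = card X + card Y" "X \<union> Y \<subseteq> S"
proof -
  have "suns A (S - X) + suns A (C - Y) \<le> suns A (S - X - Y)"
    by (rule ncomps_split[where P = "sun_set A", OF _ assms(3,5,4)]) (use assms(1) in simp)
  moreover have "S - X - Y = S - (X \<union> Y)" by auto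
  ultimately show "suns A (S - X) + suns A (C - Y) \<le> suns A (S - (X \<union> Y))" by simp
  have C: "C \<subseteq> S - X" using compsD(2)[OF assms(3)] .
  then have "X \<inter> Y = {}" using assms(5) by auto
  moreover have "finite X" "finite Y"
    using C assms(1,2,5) finite_subset[of X S] finite_subset[of Y S] by auto
  ultimately show "card (X \<union> Y) = card X + card Y" by (simp add: card_Un_disjoint)
  show "X \<union> Y \<subseteq> S" using C assms by auto
qed

text \<open>When some non-sun component \<open>C\<close> remains beside a nearly tight
  \<open>X\<close>, it takes the place of the missing sun: a neighbour \<open>x\<close> of
  \<open>C\<close> receives one sun on one side and a path into \<open>C\<close> on the
  other.\<close>

lemma strict_path_coverable:
  fixes A :: "'a \<Rightarrow> 'a \<Rightarrow> bool"
  assumes "finite S" "symp A" "irreflp A" "connected_set A S" "S \<noteq> {}" "\<not> sun_set A S"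
    and strict: "\<And>X. X \<subseteq> S \<Longrightarrow> X \<noteq> {} \<Longrightarrow> suns A (S - X) + 1 \<le> 2 * card X"
    and IH: "\<And>(B :: 'a \<Rightarrow> 'a \<Rightarrow> bool) T. weight B T < weight A S \<Longrightarrow> finite T \<Longrightarrow> symp B \<Longrightarrow> irreflp B \<Longrightarrow>
      (\<And>X. X \<subseteq> T \<Longrightarrow> suns B (T - X) \<le> 2 * card X) \<Longrightarrow> path_coverable B T"
  shows "path_coverable A S"
proof -
  define near where "near X \<longleftrightarrow> X \<subseteq> S \<and> X \<noteq> {} \<and> suns A (S - X) + 1 = 2 * card X" for X
  show ?thesis
  proof (cases "\<exists>X. near X")
    case False
    have slack: "suns A (S - X) + 2 \<le> 2 * card X" if "X \<subseteq> S" "X \<noteq> {}" for X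
    proof -
      have "suns A (S - X) + 1 \<noteq> 2 * card X" using False that unfolding near_def by blast
      then show ?thesis using strict[OF that] by linarith
    qed
    obtain u where u: "u \<in> S" using assms(5) by blast
    have "S \<noteq> {u}" using assms(6) unfolding sun_set_def by blast
    then obtain v where v: "v \<in> S - {u}" "A u v"
      using assms(4) u unfolding connected_set_def by (metis empty_subsetI insert_not_empty insert_subset singletonD)
    have "path_coverable (remove_edge A u v) S"
    proof (rule IH)
      show "weight (remove_edge A u v) S < weight A S"
        using weight_remove_edge[of S u v A] assms(1) u v by auto
      show "symp (remove_edge A u v)"
        using sympD[OF assms(2)] unfolding remove_edge_def by (intro sympI) (auto simp: insert_commute)
      show "irreflp (remove_edge A u v)"
        using irreflpD[OF assms(3)] unfolding remove_edge_def by (intro irreflpI) auto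
      show "suns (remove_edge A u v) (S - X) \<le> 2 * card X" if "X \<subseteq> S" for X
        using u v slack that by (intro suns_remove_edge assms(1,2,4,6)) auto
    qed (fact assms(1))
    then show ?thesis by (rule path_coverable_mono) (simp add: remove_edge_def)
  next
    case True
    then obtain X0 where X0: "near X0" by blast
    have bnd: "\<forall>X. near X \<longrightarrow> card X < Suc (card S)"
      using card_mono[OF assms(1)] unfolding near_def by (simp add: less_Suc_eq_le)
    obtain X where X: "near X" and max: "\<And>Y. near Y \<Longrightarrow> card Y \<le> card X"
      using ex_has_greatest_nat[of near X0 card, OF X0 bnd] by auto
    have XS: "X \<subseteq> S" "X \<noteq> {}" and cX: "suns A (S - X) + 1 = 2 * card X" using X unfolding near_def by auto
    have finX: "finite X" using XS assms(1) finite_subset by blast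
    define F where "F = {D \<in> comps A (S - X). sun_set A D}"
    define R where "R = {D \<in> comps A (S - X). \<not> sun_set A D}"
    have finF: "finite F" unfolding F_def using finite_comps[of "S - X" A] assms(1) by simp
    have cF: "card F + 1 = 2 * card X" using cX unfolding F_def ncomps_def .
    show ?thesis
    proof (cases "R = {}")
      case True
      have RF: "comps A (S - X) = F" using True unfolding R_def F_def by blast
      interpret near_tight_all_suns A S X
      proof
        show "sun_set A D" if "D \<in> comps A (S - X)" for D using that True unfolding R_def by blast
        show "card (comps A (S - X)) + 1 = 2 * card X" unfolding RF by (rule cF)
      qed (use assms XS strict in auto)
      show ?thesis using coverable_or_sun assms(6) by blast
    next
      case False
      then obtain C where C: "C \<in> R" by blast
      have Cc: "C \<in> comps A (S - X)" "\<not> sun_set A C" using C unfolding R_def by auto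
      have CS: "C \<subseteq> S - X" using compsD(2)[OF Cc(1)] .
      have "card F \<noteq> 0" using cF by presburger
      then obtain d where d: "d \<in> F" using finF by fastforce
      have dc: "d \<in> comps A (S - X)" using d unfolding F_def by auto
      have nbrs_ne: "nbrs A X D \<noteq> {}" if "D \<in> comps A (S - X)" for D
        using comps_nbrs_nonempty[OF assms(2,4) that XS] .
      have nbrs_sub: "nbrs A X D \<subseteq> X" for D unfolding nbrs_def by auto
      obtain x where x: "x \<in> nbrs A X C" using nbrs_ne[OF Cc(1)] by blast
      obtain v where v: "x \<in> X" "v \<in> C" "A x v" using nbrsD[OF x] by auto
      have surplus: "card T + 1 \<le> 2 * card (\<Union>D\<in>T. nbrs A X D)" if T: "T \<subseteq> F" "T \<noteq> {}" for T
      proof -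
        have "card T \<le> suns A (S - (\<Union>D\<in>T. nbrs A X D))"
          using T unfolding F_def by (intro card_le_ncomps_nbrs assms(1,2) XS) auto
        moreover have "(\<Union>D\<in>T. nbrs A X D) \<noteq> {}" using nbrs_ne T unfolding F_def by blast
        moreover have "(\<Union>D\<in>T. nbrs A X D) \<subseteq> S" using nbrs_sub XS by blast
        ultimately show ?thesis using strict[of "\<Union>D\<in>T. nbrs A X D"] by linarith
      qed
      \<comment> \<open>The fictitious second service of an arbitrary sun \<open>d\<close> is forced
        onto \<open>x\<close>, which leaves \<open>x\<close> with just one real sun and room for
        \<open>C\<close>.\<close>
      obtain g z where g: "\<forall>D\<in>F - {d}. g D \<in> nbrs A X D" "g d \<in> nbrs A X d" "z \<in> {x}"
        and two: "\<forall>y\<in>X. card {D \<in> F. g D = y} + (if z = y then 1 else 0) = 2"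
        using hall_pairs_split[OF finF finX nbrs_sub cF surplus d, of "nbrs A X d" "{x}"]
          nbrs_ne[OF dc] nbrs_sub v(1) by blast
      have gF: "g D \<in> nbrs A X D" if "D \<in> F" for D using g that by (cases "D = d") auto
      have "card {D \<in> F. g D = x} = 1" using two v(1) g(3) by auto
      then obtain E where E: "{D \<in> F. g D = x} = {E}" by (rule card_1_singletonE)
      have EF: "E \<in> F" "g E = x" using E by auto
      have Ec: "E \<in> comps A (S - X)" "sun_set A E" using EF(1) unfolding F_def by auto
      have CE: "C \<inter> E = {}" using comps_disjoint[of C A "S - X" E] Cc Ec by blast
      have ES: "E \<subseteq> S - X" using compsD(2)[OF Ec(1)] .
      have bound: "suns A (K - Y) + 2 * card X \<le> suns A (S - (X \<union> Y)) + 1"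
        "card (X \<union> Y) = card X + card Y" "X \<union> Y \<subseteq> S" if "K \<in> R" "Y \<subseteq> K" for K Y
        using nonsun_comp_bound[OF assms(1) XS(1), of K A Y] that cX unfolding R_def by auto
      have "\<exists>r. path_cover_along A (insert x C) (x # v # r)"
      proof (rule strict_comp_cover_along[OF assms(2,3)])
        show "finite C" using CS assms(1) finite_subset by blast
        show "connected_set A C" using compsD(3)[OF Cc(1)] .
        show "x \<notin> C" using CS v(1) by auto
        show "suns A (C - Y) + 1 \<le> 2 * card Y" if Y: "Y \<subseteq> C" "Y \<noteq> {}" for Y
        proof -
          have "finite Y" using Y(1) \<open>finite C\<close> finite_subset by blast
          then have "card Y > 0" using Y(2) by (simp add: card_gt_0_iff)
          \<comment> \<open>By maximality of \<open>X\<close> the larger set has slack two; one unit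
            is lost to the near-equality at \<open>X\<close>, and one remains for the strict bound
            on \<open>C\<close>.\<close>
          then have "\<not> near (X \<union> Y)" using max[of "X \<union> Y"] bound(2)[OF C Y(1)] by auto
          then have "suns A (S - (X \<union> Y)) + 1 \<noteq> 2 * card (X \<union> Y)"
            using bound(3)[OF C Y(1)] XS(2) unfolding near_def by blast
          then have "suns A (S - (X \<union> Y)) + 2 \<le> 2 * card (X \<union> Y)"
            using strict[of "X \<union> Y"] bound(3)[OF C Y(1)] XS(2) by fastforce
          then show ?thesis using bound(1,2)[OF C Y(1)] by linarith
        qed
        fix B assume B: "symp B" "irreflp B" "\<And>u w. B u w \<Longrightarrow> A u w"
          "\<And>Z. Z \<subseteq> insert x C \<Longrightarrow> suns B (insert x C - Z) \<le> 2 * card Z"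
        \<comment> \<open>The sun \<open>E\<close> lies outside, so the induction hypothesis applies
          although \<open>C\<close> has been enlarged by \<open>x\<close>.\<close>
        have "insert x C \<subset> S"
          using CS ES CE XS v(1) sun_set_nonempty[OF Ec(2)] by blast
        then show "path_coverable B (insert x C)"
          using B assms(1) weight_less_verts[of S "insert x C" B A] finite_subset[of "insert x C" S]
          by (intro IH) auto
      qed (use Cc v in auto)
      then obtain r where r: "path_cover_along A (insert x C) (x # v # r)" by blast
      obtain w where w: "w \<in> E" "A x w" using nbrsD[OF gF[OF EF(1)]] EF(2) by auto
      obtain s where s: "path_cover_along A E (w # s)" using sun_cover_along[OF Ec(2) assms(2) w(1)] by blast
      have s': "path_cover_along A E (rev s @ [w])"
        using s path_cover_along_rev[OF assms(2), of E "w # s"] by simp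
      have "path_cover_along A (E \<union> insert x C) ((rev s @ [w]) @ x # v # r)"
        by (rule path_cover_along_append[OF s' r]) (use CE ES v(1) w sympD[OF assms(2)] in auto)
      then have spec: "path_coverable A (E \<union> insert x C)" by (rule path_cover_along_coverable) simp
      show ?thesis
      proof (rule sun_nonsun_coverable[OF assms(2,1) XS(1) F_def R_def, of "{x}" "{C}" "{E}" g])
        show "path_coverable A ({x} \<union> \<Union>{C} \<union> \<Union>{E})" using spec by (simp add: Un_commute)
        show "g D \<in> X - {x} \<and> g D \<in> nbrs A X D" if "D \<in> F - {E}" for D
        proof -
          have D: "D \<in> F" "D \<noteq> E" using that by auto
          then have "g D \<noteq> x" using E by blast
          then show ?thesis using gF[OF D(1)] nbrs_sub[of D] by auto
        qed
        show "card {D \<in> F - {E}. g D = y} = 2" if "y \<in> X - {x}" for y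
        proof -
          have "{D \<in> F - {E}. g D = y} = {D \<in> F. g D = y}" using that EF by auto
          moreover have "y \<in> X" "z \<noteq> y" using that g(3) by auto
          ultimately show ?thesis using two[rule_format, of y] by simp
        qed
        fix K assume K: "K \<in> R - {C}"
        have Kc: "K \<in> comps A (S - X)" using K unfolding R_def by auto
        have KS: "K \<subset> S" using compsD(2)[OF Kc] XS by blast
        show "path_coverable A K"
        proof (rule IH[OF weight_less_verts[OF assms(1) KS] _ assms(2,3)])
          show "finite K" using KS assms(1) finite_subset by blast
          fix Y assume Y: "Y \<subseteq> K"
          have "K \<in> R" using K by simp
          note b = bound[OF this Y]
          show "suns A (K - Y) \<le> 2 * card Y" using b strict[of "X \<union> Y"] XS(2) by simp
        qed
      qed (use v(1) C EF(1) in auto)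
    qed
  qed
qed

theorem kaneko:
  assumes "finite S" "symp A" "irreflp A" "\<And>X. X \<subseteq> S \<Longrightarrow> suns A (S - X) \<le> 2 * card X"
  shows "path_coverable A S"
  using assms
proof (induction "weight A S" arbitrary: A S rule: less_induct)
  case less
  note fin = less.prems(1) and sym = less.prems(2) and irr = less.prems(3) and cond = less.prems(4)
  define tight where "tight X \<longleftrightarrow> X \<subseteq> S \<and> suns A (S - X) = 2 * card X" for X
  \<comment> \<open>At the empty set the hypothesis allows no sun component at all, so equality
    holds there and a largest tight set exists.\<close>
  have t0: "tight {}" using cond[of "{}"] unfolding tight_def by simp
  have bnd: "\<forall>X. tight X \<longrightarrow> card X < Suc (card S)"
    using card_mono[OF fin] unfolding tight_def by (simp add: less_Suc_eq_le)
  obtain X where X: "tight X" and max: "\<And>Y. tight Y \<Longrightarrow> card Y \<le> card X"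
    using ex_has_greatest_nat[of tight "{}" card, OF t0 bnd] by auto
  have XS: "X \<subseteq> S" and cX: "suns A (S - X) = 2 * card X" using X unfolding tight_def by auto
  have finX: "finite X" using XS fin finite_subset by blast
  define F where "F = {D \<in> comps A (S - X). sun_set A D}"
  define R where "R = {D \<in> comps A (S - X). \<not> sun_set A D}"
  have finF: "finite F" unfolding F_def using finite_comps[of "S - X" A] fin by simp
  show ?case
  \<comment> \<open>Here \<open>S\<close> is connected and the largest tight set is empty, so every
    other bound is strict. In the opposite case all non-sun components are proper subsets and
    inherit the hypothesis.\<close>
  proof (cases "S \<in> R")
    case True
    then have SR: "S \<in> comps A (S - X)" "\<not> sun_set A S" unfolding R_def by auto
    then have X0: "X = {}" using compsD(2)[OF SR(1)] XS by auto
    show ?thesis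
    proof (rule strict_path_coverable[OF fin sym irr])
      show "connected_set A S" "S \<noteq> {}" using compsD(1,3)[OF SR(1)] by auto
      fix Y assume Y: "Y \<subseteq> S" "Y \<noteq> {}"
      have "finite Y" using Y(1) fin finite_subset by blast
      then have "card Y > 0" using Y(2) by (simp add: card_gt_0_iff)
      then have "\<not> tight Y" using max[of Y] X0 by auto
      then have "suns A (S - Y) \<noteq> 2 * card Y" using Y unfolding tight_def by simp
      then show "suns A (S - Y) + 1 \<le> 2 * card Y" using cond[OF Y(1)] by linarith
    qed (use SR less.hyps in auto)
  next
    case False
    have "\<exists>g. (\<forall>D\<in>F. g D \<in> nbrs A X D) \<and> (\<forall>x\<in>X. card {D \<in> F. g D = x} = 2)"
    proof (rule hall_pairs[OF finF finX])
      show "card F = 2 * card X" using cX unfolding F_def ncomps_def .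
      fix T assume "T \<subseteq> F"
      then have "card T \<le> suns A (S - (\<Union>D\<in>T. nbrs A X D))"
        unfolding F_def by (intro card_le_ncomps_nbrs fin sym XS)
      also have "\<dots> \<le> 2 * card (\<Union>D\<in>T. nbrs A X D)"
        using XS by (intro cond) (auto simp: nbrs_def)
      finally show "card T \<le> 2 * card (\<Union>D\<in>T. nbrs A X D)" .
    qed (auto simp: nbrs_def)
    then obtain g where g: "\<And>D. D \<in> F \<Longrightarrow> g D \<in> nbrs A X D" "\<And>x. x \<in> X \<Longrightarrow> card {D \<in> F. g D = x} = 2"
      by blast
    show ?thesis
    proof (rule sun_nonsun_coverable[OF sym fin XS F_def R_def, of "{}" "{}" "{}" g])
      show "path_coverable A ({} \<union> \<Union>{} \<union> \<Union>{})" by (simp add: path_coverable.empty)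
      show "g D \<in> X - {} \<and> g D \<in> nbrs A X D" if "D \<in> F - {}" for D
        using g(1)[of D] that by (auto simp: nbrs_def)
      fix K assume "K \<in> R - {}"
      then have K: "K \<in> comps A (S - X)" "\<not> sun_set A K" "K \<noteq> S" using False unfolding R_def by auto
      then have KS: "K \<subset> S" using compsD(2)[OF K(1)] by blast
      show "path_coverable A K"
      proof (rule less.hyps[OF weight_less_verts[OF fin KS] _ sym irr])
        show "finite K" using KS fin finite_subset by blast
        fix Y assume Y: "Y \<subseteq> K"
        show "suns A (K - Y) \<le> 2 * card Y"
          using nonsun_comp_bound[OF fin XS K(1,2) Y] cond[of "X \<union> Y"] cX by simp
      qed
    qed (use g(2) in auto)
  qed
qed

section \<open>Transfer to graphs\<close>

definition adj :: "'a ugraph \<Rightarrow> 'a \<Rightarrow> 'a \<Rightarrow> bool" where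
  "adj G u v \<longleftrightarrow> {u, v} \<in> edges G"

lemma symp_adj: "symp (adj G)"
  by (rule sympI) (simp add: adj_def insert_commute)

lemma simple_graphD:
  assumes "simple_graph G"
  shows "finite (verts G)" "adj G u v \<Longrightarrow> u \<in> verts G" "adj G u v \<Longrightarrow> v \<in> verts G"
    "adj G u v \<Longrightarrow> u \<noteq> v"
proof -
  show "finite (verts G)" using assms unfolding simple_graph_def by blast
  have *: "\<exists>u\<in>verts G. \<exists>v\<in>verts G. u \<noteq> v \<and> e = {u, v}" if "e \<in> edges G" for e
    using assms that unfolding simple_graph_def by blast
  show "u \<in> verts G" "v \<in> verts G" "u \<noteq> v" if "adj G u v"
    using *[of "{u, v}"] that unfolding adj_def by (auto simp: doubleton_eq_iff)
qed

lemma irreflp_adj: "simple_graph G \<Longrightarrow> irreflp (adj G)"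
  using simple_graphD(4) by (metis irreflpI)

lemma verts_induced [simp]: "verts (induced_subgraph G S) = S"
  by (simp add: induced_subgraph_def)

lemma adj_induced [simp]: "adj (induced_subgraph G S) u v \<longleftrightarrow> adj G u v \<and> u \<in> S \<and> v \<in> S"
  by (auto simp: induced_subgraph_def adj_def)

lemma simple_induced: "simple_graph G \<Longrightarrow> S \<subseteq> verts G \<Longrightarrow> simple_graph (induced_subgraph G S)"
  using finite_subset by (fastforce simp: simple_graph_def induced_subgraph_def)

lemma verts_delete_verts [simp]: "verts (delete_verts G X) = verts G - X"
  by (simp add: delete_verts_def)

lemma adj_delete_verts [simp]:
  "adj (delete_verts G X) u v \<longleftrightarrow> adj G u v \<and> u \<in> verts G - X \<and> v \<in> verts G - X"
  by (simp add: delete_verts_def)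

lemma simple_delete_verts: "simple_graph G \<Longrightarrow> simple_graph (delete_verts G X)"
  unfolding delete_verts_def by (rule simple_induced) auto

lemma induced_induced: "C \<subseteq> S \<Longrightarrow> induced_subgraph (induced_subgraph G S) C = induced_subgraph G C"
  by (auto simp: induced_subgraph_def)

section \<open>Components by reachability and by cuts\<close>

lemma reachable_closed:
  assumes "reachable G u v" "u \<in> T" "\<And>x y. x \<in> T \<Longrightarrow> adj G x y \<Longrightarrow> y \<in> T"
  shows "v \<in> T"
  using assms(1) unfolding reachable_def
  by (induction rule: rtrancl_induct) (use assms(2,3) in \<open>auto simp: adj_def\<close>)

lemma connected_graph_imp_connected_set:
  assumes "simple_graph G" "connected_graph G"
  shows "connected_set (adj G) (verts G)"
proof (rule connected_setI)
  fix T assume T: "T \<subseteq> verts G" "T \<noteq> {}" "\<And>u v. u \<in> T \<Longrightarrow> v \<in> verts G \<Longrightarrow> adj G u v \<Longrightarrow> v \<in> T"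
  obtain t where t: "t \<in> T" using T(2) by blast
  have "v \<in> T" if "v \<in> verts G" for v
  proof (rule reachable_closed)
    show "reachable G t v" using assms(2) t T(1) that unfolding connected_graph_def by blast
    show "y \<in> T" if "x \<in> T" "adj G x y" for x y
      using T(3) that simple_graphD(3)[OF assms(1)] by blast
  qed (fact t)
  then show "T = verts G" using T(1) by blast
qed

lemma reachable_class_comps:
  assumes "simple_graph G" "u \<in> verts G"
  shows "{v \<in> verts G. reachable G u v} \<in> comps (adj G) (verts G)"
proof (rule compsI)
  let ?K = "{v \<in> verts G. reachable G u v}"
  let ?r = "{(x, y). {x, y} \<in> edges G}"
  have symr: "sym (?r\<^sup>*)" by (rule sym_rtrancl) (auto simp: sym_def insert_commute)
  show "?K \<noteq> {}" using assms(2) unfolding reachable_def by auto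
  show closed: "w \<in> ?K" if "v \<in> ?K" "w \<in> verts G" "adj G v w" for v w
    using that unfolding reachable_def adj_def by (auto intro: rtrancl_into_rtrancl)
  show "connected_set (adj G) ?K"
  proof (rule connected_setI)
    fix T assume T: "T \<subseteq> ?K" "T \<noteq> {}" "\<And>u v. u \<in> T \<Longrightarrow> v \<in> ?K \<Longrightarrow> adj G u v \<Longrightarrow> v \<in> T"
    obtain t where t: "t \<in> T" using T(2) by blast
    have ut: "reachable G u t" using t T(1) by auto
    have "v \<in> T" if v: "v \<in> ?K" for v
    proof (rule reachable_closed[OF _ t])
      show "reachable G t v"
      proof -
        have "(t, u) \<in> ?r\<^sup>*" using ut symD[OF symr] unfolding reachable_def by blast
        moreover have "(u, v) \<in> ?r\<^sup>*" using v unfolding reachable_def by simp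
        ultimately show ?thesis unfolding reachable_def by (rule rtrancl_trans)
      qed
      fix x y assume xy: "x \<in> T" "adj G x y"
      have "x \<in> ?K" using xy(1) T(1) by blast
      then have "y \<in> ?K" using simple_graphD(3)[OF assms(1) xy(2)] xy(2) by (rule closed)
      then show "y \<in> T" using T(3) xy by blast
    qed
    then show "T = ?K" using T(1) by blast
  qed
qed auto

lemma components_eq:
  assumes "simple_graph G"
  shows "components G = induced_subgraph G ` comps (adj G) (verts G)"
proof -
  have "C \<in> (\<lambda>u. {v \<in> verts G. reachable G u v}) ` verts G" if C: "C \<in> comps (adj G) (verts G)" for C
  proof -
    obtain u where u: "u \<in> C" "u \<in> verts G" using compsD(1,2)[OF C] by blast
    have "C = {v \<in> verts G. reachable G u v}"
      using u by (intro comps_disjoint[OF C reachable_class_comps[OF assms u(2)]]) (auto simp: reachable_def)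
    then show ?thesis using u(2) by blast
  qed
  then have "comps (adj G) (verts G) = (\<lambda>u. {v \<in> verts G. reachable G u v}) ` verts G"
    using reachable_class_comps[OF assms] by blast
  then show ?thesis unfolding components_def by auto
qed

text \<open>An induced subgraph determines its vertex set, so counting component graphs amounts to
  counting their vertex sets.\<close>

lemma sun_delete_verts:
  assumes "simple_graph G"
  shows "sun (delete_verts G X) = ncomps (\<lambda>C. is_sun (induced_subgraph G C)) (adj G) (verts G - X)"
proof -
  let ?G = "delete_verts G X"
  have c: "comps (adj ?G) (verts ?G) = comps (adj G) (verts G - X)"
    by (simp, rule comps_cong) simp
  have ind: "induced_subgraph ?G C = induced_subgraph G C" if "C \<in> comps (adj G) (verts G - X)" for C
    using compsD(2)[OF that] unfolding delete_verts_def by (rule induced_induced)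
  have "{C \<in> components ?G. is_sun C}
      = induced_subgraph G ` {C \<in> comps (adj G) (verts G - X). is_sun (induced_subgraph G C)}"
    unfolding components_eq[OF simple_delete_verts[OF assms]] c using ind by force
  moreover have "inj_on (induced_subgraph G) K" for K by (rule inj_onI) (metis verts_induced)
  ultimately show ?thesis unfolding sun_def ncomps_def by (simp add: card_image)
qed

text \<open>That matching edges stay inside \<open>S\<close> is carried along so that the old edges
  cannot meet a newly matched pair.\<close>

lemma matchable_perfect_matching:
  assumes "matchable (adj G) S"
  shows "\<exists>M. M \<subseteq> edges G \<and> (\<forall>e\<in>M. e \<subseteq> S) \<and> (\<forall>v\<in>S. \<exists>!e. e \<in> M \<and> v \<in> e)"
  using assms
proof induction
  case (add S u v)
  then obtain M where M: "M \<subseteq> edges G" "\<forall>e\<in>M. e \<subseteq> S" "\<forall>v\<in>S. \<exists>!e. e \<in> M \<and> v \<in> e" by blast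
  have "\<exists>!e. e \<in> insert {u, v} M \<and> w \<in> e" if w: "w \<in> insert u (insert v S)" for w
  proof (cases "w \<in> S")
    case True
    then have "w \<notin> {u, v}" using add by auto
    then have eq: "e \<in> insert {u, v} M \<and> w \<in> e \<longleftrightarrow> e \<in> M \<and> w \<in> e" for e by blast
    show ?thesis unfolding eq using M(3) True by blast
  next
    case False
    then have "w \<in> {u, v}" using w by auto
    then have eq: "e \<in> insert {u, v} M \<and> w \<in> e \<longleftrightarrow> e = {u, v}" for e using M(2) False by blast
    show ?thesis unfolding eq by blast
  qed
  moreover have "insert {u, v} M \<subseteq> edges G" using M(1) add(2) unfolding adj_def by simp
  moreover have "e \<subseteq> insert u (insert v S)" if "e \<in> insert {u, v} M" for e using M(2) that by blast
  ultimately show ?case by (intro exI[of _ "insert {u, v} M"] conjI ballI)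
qed (intro exI[of _ "{}"], simp)

lemma factor_critical_set_imp:
  assumes "factor_critical_set (adj G) H"
  shows "factor_critical (induced_subgraph G H)"
  unfolding factor_critical_def
proof
  fix v assume "v \<in> verts (induced_subgraph G H)"
  then have "matchable (adj G) (H - {v})" using assms unfolding factor_critical_set_def by simp
  from matchable_perfect_matching[OF this]
  obtain M where "M \<subseteq> edges G \<and> (\<forall>e\<in>M. e \<subseteq> H - {v}) \<and> (\<forall>w\<in>H - {v}. \<exists>!e. e \<in> M \<and> w \<in> e)" ..
  then have "perfect_matching (delete_verts (induced_subgraph G H) {v}) M"
    unfolding perfect_matching_def delete_verts_def induced_subgraph_def by auto
  then show "\<exists>M. perfect_matching (delete_verts (induced_subgraph G H) {v}) M" by blast
qed

lemma add_pendants_edges: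
  fixes K :: "'a ugraph"
  shows "{Inl u, Inl v} \<in> edges (add_pendants K) \<longleftrightarrow> {u, v} \<in> edges K"
  "{Inl u, Inr v} \<in> edges (add_pendants K) \<longleftrightarrow> u = v \<and> v \<in> verts K"
  "{Inr u, Inl v} \<in> edges (add_pendants K) \<longleftrightarrow> u = v \<and> v \<in> verts K"
  "{Inr u, Inr v} \<notin> edges (add_pendants K)"
proof -
  have *: "Inr v \<notin> Inl ` e" for v :: 'a and e :: "'a set" by auto
  have eq: "{Inl u, Inl v} = (Inl ` e :: ('a + 'a) set) \<longleftrightarrow> e = {u, v}" for e
  proof
    assume "{Inl u, Inl v} = (Inl ` e :: ('a + 'a) set)"
    then have "(Inl ` {u, v} :: ('a + 'a) set) = Inl ` e" by simp
    then show "e = {u, v}" using inj_image_eq_iff[OF inj_Inl, of "{u, v}" e] by metis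
  qed simp
  have "{Inl u, Inl v} \<in> (\<lambda>e. Inl ` e :: ('a + 'a) set) ` edges K \<longleftrightarrow> {u, v} \<in> edges K"
    unfolding image_iff eq by blast
  then show "{Inl u, Inl v} \<in> edges (add_pendants K) \<longleftrightarrow> {u, v} \<in> edges K"
    unfolding add_pendants_def by (simp add: doubleton_eq_iff)
  have "{x, Inr v} \<noteq> Inl ` e" for x and v :: 'a and e :: "'a set" using * by (metis insertCI)
  then show "{Inl u, Inr v} \<in> edges (add_pendants K) \<longleftrightarrow> u = v \<and> v \<in> verts K"
    "{Inr u, Inr v} \<notin> edges (add_pendants K)"
    unfolding add_pendants_def by (auto simp: doubleton_eq_iff)
  have "{Inr u, x} \<noteq> Inl ` e" for x and u :: 'a and e :: "'a set" using * by (metis insertCI)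
  then show "{Inr u, Inl v} \<in> edges (add_pendants K) \<longleftrightarrow> u = v \<and> v \<in> verts K"
    unfolding add_pendants_def by (auto simp: doubleton_eq_iff)
qed

text \<open>This inclusion gives \<open>suns\<close> at most \<open>sun\<close>, which transfers the
  hypothesis of Kaneko's theorem from graphs to sets.\<close>

lemma sun_set_imp_is_sun:
  assumes G: "simple_graph G" and C: "C \<subseteq> verts G" "sun_set (adj G) C"
  shows "is_sun (induced_subgraph G C)"
proof (cases "\<exists>v. C = {v}")
  case True
  then obtain v where v: "C = {v}" by blast
  have "\<not> adj G v v" using simple_graphD(4)[OF G] by blast
  then have "graph_iso (induced_subgraph G C) (complete_graph 1)"
    unfolding graph_iso_def v complete_graph_def
    by (intro exI[of _ "\<lambda>_. 0"]) (auto simp: bij_betw_def adj_def induced_subgraph_def)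
  then show ?thesis unfolding is_sun_def by blast
next
  case False
  then obtain H p where H: "factor_critical_set (adj G) H" "corona (adj G) H p C"
    using C(2) unfolding sun_set_def by blast
  note c = coronaD[OF H(2)]
  let ?K = "induced_subgraph G H"
  have Cdef: "C = H \<union> p ` H" and inj: "inj_on p H" using H(2) unfolding corona_def by auto
  define f where "f w = (if w \<in> H then Inl w else Inr (the_inv_into H p w))" for w
  have fH: "f h = Inl h" if "h \<in> H" for h using that unfolding f_def by simp
  have fp: "f (p h) = Inr h" if "h \<in> H" for h
    using that c(2) the_inv_into_f_f[OF inj that] unfolding f_def by simp
  have "bij_betw f C (verts (add_pendants ?K))"
    unfolding bij_betw_def
  proof
    show "inj_on f C"
      unfolding Cdef by (rule inj_onI) (auto simp: fH fp)
    show "f ` C = verts (add_pendants ?K)"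
    proof -
      have "f ` H = Inl ` H" using fH by (rule image_cong[OF refl])
      moreover have "f ` p ` H = Inr ` H" unfolding image_image using fp by (rule image_cong[OF refl])
      ultimately show ?thesis unfolding Cdef image_Un by (simp add: add_pendants_def)
    qed
  qed
  moreover have "{u, v} \<in> edges (induced_subgraph G C) \<longleftrightarrow> {f u, f v} \<in> edges (add_pendants ?K)"
    if uvC: "u \<in> C" "v \<in> C" for u v
  proof -
    have sub: "H \<subseteq> C" unfolding Cdef by auto
    have sym: "adj G x y \<Longrightarrow> adj G y x" for x y using sympD[OF symp_adj] .
    have e: "{u, v} \<in> edges (induced_subgraph G C) \<longleftrightarrow> adj G u v"
      using that unfolding induced_subgraph_def adj_def by auto
    consider "u \<in> H" "v \<in> H" | h where "u \<in> H" "h \<in> H" "v = p h" | h where "h \<in> H" "u = p h" "v \<in> H"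
      | h k where "h \<in> H" "u = p h" "k \<in> H" "v = p k"
    proof -
      have "u \<in> H \<or> (\<exists>h\<in>H. u = p h)" "v \<in> H \<or> (\<exists>h\<in>H. v = p h)" using uvC unfolding Cdef by auto
      then show ?thesis using that by fast
    qed
    then show ?thesis
    proof cases
      case 1
      then show ?thesis unfolding e by (simp add: fH add_pendants_edges induced_subgraph_def adj_def)
    next
      case 2
      then show ?thesis unfolding e using c(1)[of u] c(5)[of h u] that(1) sym
        by (auto simp: fH fp add_pendants_edges)
    next
      case 3
      then show ?thesis unfolding e using c(1)[of v] c(5)[of h v] that(2) sym
        by (auto simp: fH fp add_pendants_edges)
    next
      case 4
      then have "\<not> adj G u v" using c(5)[of h v] c(2)[of k] that by blast
      then show ?thesis unfolding e using 4 by (simp add: fp add_pendants_edges)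
    qed
  qed
  ultimately have "graph_iso (induced_subgraph G C) (add_pendants ?K)"
    unfolding graph_iso_def by (metis verts_induced)
  moreover have "simple_graph ?K" using C(1) Cdef by (intro simple_induced[OF G]) auto
  ultimately show ?thesis using factor_critical_set_imp[OF H(1)] unfolding is_sun_def by blast
qed

text \<open>In a graph with pendants added, a vertex mapped to some \<open>Inr h\<close> can be
  adjacent only to the preimage of \<open>Inl h\<close>; in \<open>K_1\<close> and
  \<open>K_2\<close> any vertex serves.\<close>

lemma is_sun_low_degree:
  assumes G: "simple_graph G" and C: "C \<subseteq> verts G" "C \<noteq> {}" "is_sun (induced_subgraph G C)"
  shows "\<exists>v\<in>C. card {w \<in> C. adj G v w} \<le> 1"
proof -
  have finC: "finite C" using C(1) simple_graphD(1)[OF G] finite_subset by blast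
  have small: ?thesis if "card C \<le> 2"
  proof -
    obtain v where v: "v \<in> C" using C(2) by blast
    have "{w \<in> C. adj G v w} \<subseteq> C - {v}" using simple_graphD(4)[OF G] by blast
    then have "card {w \<in> C. adj G v w} \<le> card (C - {v})" using finC by (intro card_mono) auto
    then show ?thesis using that v finC by (intro bexI[of _ v]) auto
  qed
  have iso: "card C = n" if "graph_iso (induced_subgraph G C) (complete_graph n)" for n
    using that bij_betw_same_card unfolding graph_iso_def complete_graph_def by fastforce
  consider "graph_iso (induced_subgraph G C) (complete_graph 1)"
    | "graph_iso (induced_subgraph G C) (complete_graph 2)"
    | H :: "'a ugraph" where "graph_iso (induced_subgraph G C) (add_pendants H)"
    using C(3) unfolding is_sun_def by blast
  then show ?thesis
  proof cases
    case 3
    then obtain f where f: "bij_betw f C (verts (add_pendants H))"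
      and e: "\<forall>u\<in>C. \<forall>v\<in>C. {u, v} \<in> edges (induced_subgraph G C) \<longleftrightarrow> {f u, f v} \<in> edges (add_pendants H)"
      unfolding graph_iso_def by auto
    have fC: "f ` C = Inl ` verts H \<union> Inr ` verts H" and inj: "inj_on f C"
      using f unfolding bij_betw_def add_pendants_def by auto
    have "verts H \<noteq> {}" using fC C(2) by auto
    then obtain h where "h \<in> verts H" by blast
    then have "Inr h \<in> f ` C" using fC by simp
    then obtain v where v: "v \<in> C" "f v = Inr h" by (metis imageE)
    have fw: "f w = Inl h" if "w \<in> C" "adj G v w" for w
    proof -
      have "{v, w} \<in> edges (induced_subgraph G C)"
        using that v(1) unfolding induced_subgraph_def adj_def by simp
      then have "{Inr h, f w} \<in> edges (add_pendants H)" using e v that(1) by metis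
      then show ?thesis by (cases "f w") (auto simp: add_pendants_edges)
    qed
    have "w = w'" if "w \<in> {w \<in> C. adj G v w}" "w' \<in> {w \<in> C. adj G v w}" for w w'
      using that fw inj by (metis (mono_tags, lifting) inj_onD mem_Collect_eq)
    then have "card {w \<in> C. adj G v w} \<le> Suc 0"
      using finC by (subst card_le_Suc0_iff_eq) auto
    then show ?thesis using v(1) by (intro bexI[of _ v]) simp_all
  qed (use iso small in auto)
qed

section \<open>From path covers to path factors\<close>

lemma path_coverable_lists:
  assumes "path_coverable A S"
  shows "\<exists>Q. S = \<Union>(set ` Q) \<and> (\<forall>p\<in>Q. path_in A p \<and> 3 \<le> length p) \<and>
    (\<forall>p\<in>Q. \<forall>q\<in>Q. set p \<inter> set q \<noteq> {} \<longrightarrow> p = q)"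
  using assms
proof induction
  case empty
  then show ?case by (intro exI[of _ "{}"]) simp
next
  case (add S p)
  then obtain Q where Q: "S = \<Union>(set ` Q)" "\<forall>p\<in>Q. path_in A p \<and> 3 \<le> length p"
    "\<forall>p\<in>Q. \<forall>q\<in>Q. set p \<inter> set q \<noteq> {} \<longrightarrow> p = q" by blast
  have "set p \<inter> set q = {}" if "q \<in> Q" for q using that Q(1) add(4) by blast
  then have "\<forall>x\<in>insert p Q. \<forall>q\<in>insert p Q. set x \<inter> set q \<noteq> {} \<longrightarrow> x = q"
    using Q(3) by (metis inf_commute insert_iff)
  then show ?case using Q add by (intro exI[of _ "insert p Q"]) auto
qed

lemma path_factor_if_coverable:
  assumes G: "simple_graph G" and cov: "path_coverable (adj G) (verts G)"
  shows "\<exists>F. path_factor 3 G F"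
proof -
  obtain Q where "verts G = \<Union>(set ` Q) \<and> (\<forall>p\<in>Q. path_in (adj G) p \<and> 3 \<le> length p) \<and>
    (\<forall>p\<in>Q. \<forall>q\<in>Q. set p \<inter> set q \<noteq> {} \<longrightarrow> p = q)"
    using path_coverable_lists[OF cov] ..
  then have Q: "verts G = \<Union>(set ` Q)" "\<And>p. p \<in> Q \<Longrightarrow> path_in (adj G) p \<and> 3 \<le> length p"
    "\<And>p q. p \<in> Q \<Longrightarrow> q \<in> Q \<Longrightarrow> set p \<inter> set q \<noteq> {} \<Longrightarrow> p = q"
    by simp_all
  define F where "F = (verts G, {{p ! i, p ! Suc i} | p i. p \<in> Q \<and> Suc i < length p})"
  have vF: "verts F = verts G" unfolding F_def by simp
  have adjG: "adj G (p ! i) (p ! Suc i)" if "p \<in> Q" "Suc i < length p" for p i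
    using Q(2)[OF that(1)] that(2) unfolding path_in_def by (simp add: successively_conv_nth)
  have adjF: "adj F u v \<longleftrightarrow> (\<exists>p i. p \<in> Q \<and> Suc i < length p \<and> {u, v} = {p ! i, p ! Suc i})" for u v
    unfolding F_def adj_def by auto
  have sub: "edges F \<subseteq> edges G" using adjG unfolding F_def adj_def by auto
  then have FG: "adj G u v" if "adj F u v" for u v using that unfolding adj_def by auto
  have simF: "simple_graph F"
    using G sub unfolding simple_graph_def vF by blast
  \<comment> \<open>A vertex determines its path and its position there, so adjacency in
    \<open>F\<close> reduces to consecutive positions of one list.\<close>
  have nthQ: "p ! i = q ! j \<longleftrightarrow> p = q \<and> i = j"
    if "p \<in> Q" "q \<in> Q" "i < length p" "j < length q" for p q i j
  proof
    assume eq: "p ! i = q ! j"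
    have "p ! i \<in> set p" "q ! j \<in> set q" using that by auto
    then have "p = q" using Q(3)[OF that(1,2)] eq by auto
    moreover have "distinct p" using Q(2)[OF that(1)] unfolding path_in_def by simp
    ultimately show "p = q \<and> i = j" using eq that by (simp add: nth_eq_iff_index_eq)
  qed simp
  have adj_nth: "adj F (p ! i) (p ! j) \<longleftrightarrow> j = Suc i \<or> i = Suc j"
    if p: "p \<in> Q" "i < length p" "j < length p" for p i j
  proof
    assume "adj F (p ! i) (p ! j)"
    then obtain q k where q: "q \<in> Q" "Suc k < length q" "{p ! i, p ! j} = {q ! k, q ! Suc k}"
      unfolding adjF by blast
    then have "p ! i = q ! k \<and> p ! j = q ! Suc k \<or> p ! i = q ! Suc k \<and> p ! j = q ! k"
      by (auto simp: doubleton_eq_iff)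
    then show "j = Suc i \<or> i = Suc j" using nthQ p q by auto
  next
    assume "j = Suc i \<or> i = Suc j"
    then show "adj F (p ! i) (p ! j)" unfolding adjF using p by (metis insert_commute)
  qed
  have comp: "set p \<in> comps (adj F) (verts F)" if p: "p \<in> Q" for p
  proof (rule compsI)
    show "set p \<noteq> {}" using Q(2)[OF p] by auto
    show "set p \<subseteq> verts F" using p Q(1) vF by auto
    show "v \<in> set p" if uv: "u \<in> set p" "v \<in> verts F" "adj F u v" for u v
    proof -
      obtain q k where q: "q \<in> Q" "Suc k < length q" "{u, v} = {q ! k, q ! Suc k}"
        using uv(3) unfolding adjF by blast
      then have "u \<in> set q" "v \<in> set q" by (auto simp: doubleton_eq_iff)
      then show ?thesis using Q(3)[OF p q(1)] uv(1) by auto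
    qed
    show "connected_set (adj F) (set p)"
    proof (rule connected_setI)
      fix T assume T: "T \<subseteq> set p" "T \<noteq> {}" "\<And>u v. u \<in> T \<Longrightarrow> v \<in> set p \<Longrightarrow> adj F u v \<Longrightarrow> v \<in> T"
      have step: "p ! i \<in> T \<longleftrightarrow> p ! Suc i \<in> T" if "Suc i < length p" for i
        using T(3)[of "p ! i" "p ! Suc i"] T(3)[of "p ! Suc i" "p ! i"] adj_nth[OF p] that by auto
      have all: "p ! i \<in> T \<longleftrightarrow> p ! 0 \<in> T" if "i < length p" for i
        using that by (induction i) (use step in auto)
      obtain t where "t \<in> T" using T(2) by blast
      then obtain i where "i < length p" "p ! i \<in> T" using T(1) by (metis in_set_conv_nth subsetD)
      then have "p ! j \<in> T" if "j < length p" for j using all that by blast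
      then show "T = set p" using T(1) by (auto simp: in_set_conv_nth)
    qed
  qed
  have "\<exists>n\<ge>3. graph_iso K (path_graph n)" if K: "K \<in> components F" for K
  proof -
    obtain C where C: "C \<in> comps (adj F) (verts F)" "K = induced_subgraph F C"
      using K unfolding components_eq[OF simF] by blast
    obtain u where u: "u \<in> C" "u \<in> verts F" using compsD(1,2)[OF C(1)] by blast
    then obtain p where p: "p \<in> Q" "u \<in> set p" using Q(1) vF by auto
    have Cp: "C = set p" using u(1) p(2) by (intro comps_disjoint[OF C(1) comp[OF p(1)]]) auto
    have dp: "distinct p" using Q(2)[OF p(1)] unfolding path_in_def by simp
    define f where "f = the_inv_into {..<length p} ((!) p)"
    have bij: "bij_betw ((!) p) {..<length p} (set p)" using dp by (intro bij_betw_nth) auto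
    then have inj: "inj_on ((!) p) {..<length p}" by (rule bij_betw_imp_inj_on)
    have fb: "bij_betw f (set p) {..<length p}"
      unfolding f_def using bij by (rule bij_betw_the_inv_into)
    have fn: "f (p ! i) = i" if "i < length p" for i
      unfolding f_def using inj that by (intro the_inv_into_f_f) auto
    have "graph_iso K (path_graph (length p))"
      unfolding graph_iso_def
    proof (intro exI[of _ f] conjI ballI)
      show "bij_betw f (verts K) (verts (path_graph (length p)))"
        using fb unfolding C(2) Cp path_graph_def by simp
      fix u v assume uv: "u \<in> verts K" "v \<in> verts K"
      then have "u \<in> set p" "v \<in> set p" unfolding C(2) Cp by auto
      then obtain i j where ij: "i < length p" "u = p ! i" "j < length p" "v = p ! j"
        by (metis in_set_conv_nth)
      have "{u, v} \<in> edges K \<longleftrightarrow> adj F u v"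
        using \<open>u \<in> set p\<close> \<open>v \<in> set p\<close> unfolding C(2) Cp induced_subgraph_def adj_def by simp
      also have "\<dots> \<longleftrightarrow> j = Suc i \<or> i = Suc j" using adj_nth[OF p(1)] ij by simp
      also have "\<dots> \<longleftrightarrow> {i, j} \<in> edges (path_graph (length p))"
        using ij unfolding path_graph_def by (auto simp: doubleton_eq_iff)
      finally show "{u, v} \<in> edges K \<longleftrightarrow> {f u, f v} \<in> edges (path_graph (length p))"
        using fn ij by simp
    qed
    then show ?thesis using Q(2)[OF p(1)] by blast
  qed
  then have "path_factor 3 G F" using vF sub unfolding path_factor_def spanning_subgraph_def by blast
  then show ?thesis by blast
qed

theorem kaneko_path_factor:
  assumes "simple_graph G" "\<And>X. X \<subseteq> verts G \<Longrightarrow> sun (delete_verts G X) \<le> 2 * card X"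
  shows "\<exists>F. path_factor 3 G F"
proof (rule path_factor_if_coverable[OF assms(1)])
  show "path_coverable (adj G) (verts G)"
  proof (rule kaneko[OF simple_graphD(1)[OF assms(1)] symp_adj irreflp_adj[OF assms(1)]])
    fix X assume X: "X \<subseteq> verts G"
    let ?P = "\<lambda>C. is_sun (induced_subgraph G C)"
    have "suns (adj G) (verts G - X) \<le> ncomps ?P (adj G) (verts G - X)"
      unfolding ncomps_def
    proof (rule card_mono)
      show "finite {C \<in> comps (adj G) (verts G - X). ?P C}"
        using finite_comps[of "verts G - X" "adj G"] simple_graphD(1)[OF assms(1)] by simp
      show "{C \<in> comps (adj G) (verts G - X). sun_set (adj G) C} \<subseteq> {C \<in> comps (adj G) (verts G - X). ?P C}"
      proof
        fix C assume C: "C \<in> {C \<in> comps (adj G) (verts G - X). sun_set (adj G) C}"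
        then have "C \<subseteq> verts G" using compsD(2)[of C "adj G" "verts G - X"] by blast
        then show "C \<in> {C \<in> comps (adj G) (verts G - X). ?P C}"
          using C sun_set_imp_is_sun[OF assms(1)] by simp
      qed
    qed
    also have "\<dots> \<le> 2 * card X" using assms(2)[OF X] unfolding sun_delete_verts[OF assms(1)] .
    finally show "suns (adj G) (verts G - X) \<le> 2 * card X" .
  qed
qed

section \<open>Connectivity and toughness\<close>

lemma complete_connected_set:
  assumes "complete G" "S \<subseteq> verts G"
  shows "connected_set (adj G) S"
proof (rule connected_setI)
  fix T assume T: "T \<subseteq> S" "T \<noteq> {}" "\<And>u v. u \<in> T \<Longrightarrow> v \<in> S \<Longrightarrow> adj G u v \<Longrightarrow> v \<in> T"
  obtain t where t: "t \<in> T" using T(2) by blast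
  have "v \<in> T" if "v \<in> S" for v
  proof (cases "v = t")
    case False
    have "t \<in> verts G" "v \<in> verts G" using t T(1) that assms(2) by auto
    then have "adj G t v" using assms(1) False unfolding complete_def adj_def by metis
    then show ?thesis by (rule T(3)[OF t that])
  qed (use t in simp)
  then show "T = S" using T(1) by blast
qed

lemma vertex_connectivity_le:
  assumes "simple_graph G" "\<not> complete G" "X \<subset> verts G" "\<not> connected_graph (delete_verts G X)"
  shows "vertex_connectivity G \<le> card X"
proof -
  let ?S = "{card X | X. X \<subset> verts G \<and> \<not> connected_graph (delete_verts G X)}"
  have "?S \<subseteq> card ` Pow (verts G)" by auto
  then have "finite ?S" using simple_graphD(1)[OF assms(1)] finite_subset by blast
  then have "Min ?S \<le> card X" using assms(3,4) by (intro Min_le) auto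
  then show ?thesis using assms(2) unfolding vertex_connectivity_def by simp
qed

lemma not_connected_if_isolated:
  assumes "simple_graph G" "u \<in> verts G - X" "w \<in> verts G - X" "u \<noteq> w"
    "\<And>v. v \<in> verts G - X \<Longrightarrow> \<not> adj G u v"
  shows "\<not> connected_graph (delete_verts G X)"
proof
  assume "connected_graph (delete_verts G X)"
  then have "connected_set (adj (delete_verts G X)) (verts G - X)"
    using connected_graph_imp_connected_set[OF simple_delete_verts[OF assms(1)]] by simp
  then have "{u} = verts G - X" by (rule connected_setD) (use assms in auto)
  then have "w \<in> {u}" using assms(3) by simp
  then show False using assms(4) by simp
qed

text \<open>For a non-complete graph, deleting all vertices but two non-adjacent ones disconnects
  it, which bounds the connectivity by the order minus 2.\<close>

lemma card_verts_vertex_connectivity: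
  assumes "simple_graph G" "k < vertex_connectivity G"
  shows "k + 2 \<le> card (verts G)"
proof (cases "complete G")
  case True
  then show ?thesis using assms(2) unfolding vertex_connectivity_def by simp
next
  case False
  then obtain u w where uw: "u \<in> verts G" "w \<in> verts G" "u \<noteq> w" "\<not> adj G u w"
    unfolding complete_def adj_def by blast
  have "\<not> connected_graph (delete_verts G (verts G - {u, w}))"
    using uw simple_graphD(4)[OF assms(1)]
    by (intro not_connected_if_isolated[OF assms(1), of u _ w]) auto
  then have "k < card (verts G - {u, w})"
    using vertex_connectivity_le[OF assms(1) False, of "verts G - {u, w}"] uw assms(2) by force
  also have "card (verts G - {u, w}) \<le> card (verts G) - 2"
    using uw simple_graphD(1)[OF assms(1)] by (simp add: card_Diff_subset)
  finally show ?thesis by simp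
qed

lemma connected_set_delete:
  assumes "simple_graph G" "k < vertex_connectivity G" "X \<subseteq> verts G" "card X \<le> k"
  shows "connected_set (adj G) (verts G - X)" "verts G - X \<noteq> {}"
proof -
  have "X \<noteq> verts G" using card_verts_vertex_connectivity[OF assms(1,2)] assms(4) by auto
  then show "verts G - X \<noteq> {}" using assms(3) by blast
  show "connected_set (adj G) (verts G - X)"
  proof (cases "complete G")
    case True
    then show ?thesis by (rule complete_connected_set) simp
  next
    case False
    then have "connected_graph (delete_verts G X)"
      using vertex_connectivity_le[OF assms(1) False, of X] assms \<open>X \<noteq> verts G\<close> by force
    then have "connected_set (adj (delete_verts G X)) (verts G - X)"
      using connected_graph_imp_connected_set[OF simple_delete_verts[OF assms(1)]] by simp
    then show ?thesis using connected_set_cong[of "verts G - X" "adj (delete_verts G X)" "adj G"] by simp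
  qed
qed

text \<open>If \<open>v\<close> had at most \<open>k\<close> neighbours, deleting them would leave a
  connected graph with \<open>v\<close> isolated; so \<open>v\<close> and its neighbours would be
  all vertices, too few for the connectivity.\<close>

lemma min_degree_vertex_connectivity:
  assumes "simple_graph G" "k < vertex_connectivity G" "v \<in> verts G"
  shows "k < card {w \<in> verts G. adj G v w}"
proof (rule ccontr)
  let ?N = "{w \<in> verts G. adj G v w}"
  assume "\<not> k < card ?N"
  then have le: "card ?N \<le> k" by simp
  have vN: "v \<in> verts G - ?N" using assms(3) simple_graphD(4)[OF assms(1)] by blast
  have "connected_set (adj G) (verts G - ?N)"
    using connected_set_delete(1)[OF assms(1,2) _ le] by blast
  then have "{v} = verts G - ?N" by (rule connected_setD) (use vN in auto)
  then have "verts G = insert v ?N" by blast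
  then have "card (verts G) \<le> card ?N + 1"
    using card_insert_le_m1 by (metis (no_types, lifting) Suc_eq_plus1 card.infinite card_insert_if finite_insert le_SucI le_refl)
  then show False using le card_verts_vertex_connectivity[OF assms(1,2)] by simp
qed

lemma sun_toughness_le:
  assumes "simple_graph G" "\<not> complete G" "X \<subseteq> verts G" "2 \<le> sun (delete_verts G X)"
  shows "sun_toughness G \<le> ereal (real (card X) / real (sun (delete_verts G X)))"
proof -
  let ?f = "\<lambda>X. ereal (real (card X) / real (sun (delete_verts G X)))"
  let ?S = "{?f X | X. X \<subseteq> verts G \<and> 2 \<le> sun (delete_verts G X)}"
  have "?S \<subseteq> ?f ` Pow (verts G)" by auto
  then have "finite ?S" using simple_graphD(1)[OF assms(1)] finite_subset by blast
  then have "Min ?S \<le> ?f X" using assms(3,4) by (intro Min_le) auto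
  then show ?thesis using assms(2) unfolding sun_toughness_def by simp
qed

theorem theorem7:
  fixes G :: "'a ugraph" and m :: nat
  assumes "m \<ge> 1"
    and "simple_graph G"
    and "vertex_connectivity G \<ge> 2 * m + 1"
    and "sun_toughness G \<ge> ereal ((real m + 1) / (real m + 2))"
  shows "path_factor_deleted 3 m G"
  unfolding path_factor_deleted_def
proof (intro allI impI, elim conjE)
  fix E' assume E': "E' \<subseteq> edges G" "card E' = m"
  let ?G' = "delete_edges G E'" and ?V = "verts G"
  let ?P = "\<lambda>C. is_sun (induced_subgraph G C)" and ?P' = "\<lambda>C. is_sun (induced_subgraph ?G' C)"
  note G = assms(2)
  have k: "2 * m < vertex_connectivity G" using assms(3) by simp
  have V': "verts ?G' = ?V" by (simp add: delete_edges_def)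
  have G': "simple_graph ?G'" using G unfolding simple_graph_def delete_edges_def by auto
  have adj': "adj ?G' u v \<longleftrightarrow> adj G u v \<and> {u, v} \<notin> E'" for u v
    by (auto simp: adj_def delete_edges_def)
  have finV: "finite ?V" using simple_graphD(1)[OF G] .
  have finE: "finite E'" using E'(2) assms(1) by (metis card.infinite not_one_le_zero)
  define U where "U = \<Union>E'"
  have two: "finite e \<and> card e \<le> 2" if "e \<in> E'" for e
    using G E'(1) that unfolding simple_graph_def by (metis card_2_iff finite.emptyI finite_insert order_refl subsetD)
  have finU: "finite U" unfolding U_def using finE two by blast
  have "card U \<le> (\<Sum>e\<in>E'. card e)" unfolding U_def by (rule card_Union_le_sum_card)
  also have "\<dots> \<le> (\<Sum>e\<in>E'. 2)" using two by (intro sum_mono) auto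
  finally have cU: "card U \<le> 2 * m" using E'(2) by simp
  have untouched: "D \<in> comps (adj G) (?V - X) \<and> (?P' D \<longleftrightarrow> ?P D)"
    if D: "D \<in> comps (adj ?G') (?V - X)" "D \<inter> U = {}" for D X
  proof
    have agree: "adj ?G' u v \<longleftrightarrow> adj G u v" if "u \<in> D" for u v
      using that D(2) unfolding adj' U_def by blast
    have "connected_set (adj G) D"
      using compsD(3)[OF D(1)] connected_set_cong[of D "adj ?G'" "adj G"] agree by simp
    then show "D \<in> comps (adj G) (?V - X)" using compsD[OF D(1)] agree by (intro compsI) auto
    have "e \<notin> E'" if "e \<subseteq> D" "e \<in> edges G" for e
    proof
      assume "e \<in> E'"
      moreover have "e \<noteq> {}" using G that(2) unfolding simple_graph_def by auto
      ultimately show False using that(1) D(2) unfolding U_def by blast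
    qed
    then have "induced_subgraph ?G' D = induced_subgraph G D"
      unfolding induced_subgraph_def delete_edges_def by auto
    then show "?P' D \<longleftrightarrow> ?P D" by simp
  qed
  have "sun (delete_verts ?G' X) \<le> 2 * card X" if X: "X \<subseteq> ?V" for X
  proof -
    let ?n' = "ncomps ?P' (adj ?G') (?V - X)" and ?n = "ncomps ?P (adj G) (?V - X)"
    have finX: "finite X" using X finV finite_subset by blast
    have sun': "sun (delete_verts ?G' X) = ?n'" using sun_delete_verts[OF G', of X] unfolding V' .
    have sun: "sun (delete_verts G X) = ?n" using sun_delete_verts[OF G, of X] .
    have n'n: "?n' \<le> ?n + 2 * m"
    proof -
      have "?n' \<le> ?n + card U"
        by (rule ncomps_le_hitting) (use finV finU untouched[of _ X] in auto)
      then show ?thesis using cU by linarith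
    qed
    have few: "?n \<le> 1" if "connected_set (adj G) (?V - X)"
    proof -
      have "comps (adj G) (?V - X) \<subseteq> {?V - X}"
      proof
        fix C assume C: "C \<in> comps (adj G) (?V - X)"
        then have "?V - X \<noteq> {}" using compsD(1,2)[OF C] by auto
        then show "C \<in> {?V - X}" using C self_comps[OF that] by simp
      qed
      then have "{C \<in> comps (adj G) (?V - X). ?P C} \<subseteq> {?V - X}" by blast
      then have "card {C \<in> comps (adj G) (?V - X). ?P C} \<le> card {?V - X}" by (rule card_mono[rotated]) simp
      then show ?thesis unfolding ncomps_def by simp
    qed
    consider "card X < m" | "m \<le> card X" "card X \<le> 2 * m" | "2 * m < card X" by linarith
    then have "?n' \<le> 2 * card X"
    proof cases
      case 1
      have "\<not> ?P' D" if D: "D \<in> comps (adj ?G') (?V - X)" for D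
      proof
        assume "?P' D"
        moreover have DV: "D \<noteq> {}" "D \<subseteq> ?V" using compsD(1,2)[OF D] by auto
        ultimately obtain v where v: "v \<in> D" "card {w \<in> D. adj ?G' v w} \<le> 1"
          using is_sun_low_degree[OF G', of D] unfolding V' by blast
        \<comment> \<open>The far ends of deleted edges at \<open>v\<close>. Every neighbour of
          \<open>v\<close> in \<open>G\<close> lies in \<open>X\<close>, in the sun, or here, which
          allows only (m - 1) + 1 + m of them.\<close>
        let ?W = "{w. {v, w} \<in> E'}"
        have inj: "inj_on (\<lambda>w. {v, w}) ?W" by (rule inj_onI) (auto simp: doubleton_eq_iff)
        have W: "card ?W \<le> m"
          using card_inj_on_le[OF inj _ finE] E'(2) by auto
        have finW: "finite ?W"
          using inj_on_finite[OF inj _ finE] by auto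
        have sub: "{w \<in> ?V. adj G v w} \<subseteq> X \<union> {w \<in> D. adj ?G' v w} \<union> ?W"
          using compsD(4)[OF D v(1)] unfolding adj' by blast
        have "finite D" using DV(2) finV finite_subset by blast
        then have "card {w \<in> ?V. adj G v w} \<le> card (X \<union> {w \<in> D. adj ?G' v w} \<union> ?W)"
          using sub finX finW by (intro card_mono) auto
        also have "\<dots> \<le> card X + card {w \<in> D. adj ?G' v w} + card ?W"
          by (meson add_le_mono1 card_Un_le order_trans)
        finally have "card {w \<in> ?V. adj G v w} \<le> 2 * m" using v(2) W 1 by linarith
        moreover have "2 * m < card {w \<in> ?V. adj G v w}"
          using v(1) DV(2) by (intro min_degree_vertex_connectivity[OF G k]) auto
        ultimately show False by simp
      qed
      then have "{D \<in> comps (adj ?G') (?V - X). ?P' D} = {}" by blast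
      then have "?n' = 0" unfolding ncomps_def by (metis card.empty)
      then show ?thesis by simp
    next
      case 2
      note con = connected_set_delete[OF G k X 2(2)]
      have "?n' \<le> 2 * m"
      \<comment> \<open>The estimate \<open>n'n\<close> would give 2m + 1, one too many when |X| =
        m. But a component avoiding all ends of deleted edges is the whole connected set
        \<open>?V - X\<close>, hence the only one.\<close>
      proof (cases "\<exists>D\<in>comps (adj ?G') (?V - X). D \<inter> U = {}")
        case True
        then obtain D where D: "D \<in> comps (adj ?G') (?V - X)" "D \<inter> U = {}" by blast
        then have "D = ?V - X" using untouched[OF D] self_comps[OF con] by auto
        then have "comps (adj ?G') (?V - X) = {D}" using comps_connected[OF D(1)] by simp
        then have "{C \<in> comps (adj ?G') (?V - X). ?P' C} \<subseteq> {D}" by blast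
        then have "card {C \<in> comps (adj ?G') (?V - X). ?P' C} \<le> card {D}" by (rule card_mono[rotated]) simp
        then show ?thesis using assms(1) unfolding ncomps_def by simp
      next
        case False
        then have "{C \<in> comps (adj ?G') (?V - X). ?P' C} \<subseteq> {C \<in> comps (adj ?G') (?V - X). C \<inter> U \<noteq> {}}"
          by blast
        then have "?n' \<le> card {C \<in> comps (adj ?G') (?V - X). C \<inter> U \<noteq> {}}"
          unfolding ncomps_def using finite_comps[of "?V - X" "adj ?G'"] finV by (intro card_mono) auto
        also have "\<dots> \<le> card U" by (rule card_comps_hitting[OF finU])
        finally show ?thesis using cU by simp
      qed
      then show ?thesis using 2(1) by linarith
    next
      case 3
      show ?thesis
      proof (cases "?n \<le> 1")
        case True
        then show ?thesis using n'n 3 by linarith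
      next
        case False
        have "\<not> complete G"
          using complete_connected_set[of G "?V - X"] few False by blast
        then have "sun_toughness G \<le> ereal (real (card X) / real ?n)"
          using sun_toughness_le[OF G _ X] False unfolding sun by simp
        then have "ereal ((real m + 1) / (real m + 2)) \<le> ereal (real (card X) / real ?n)"
          using assms(4) by (rule order_trans[rotated])
        then have "(real m + 1) / (real m + 2) \<le> real (card X) / real ?n" by simp
        then have "(real m + 1) * real ?n \<le> real (card X) * (real m + 2)"
          using False by (simp add: divide_simps mult_ac)
        then have "real ((m + 1) * ?n) \<le> real (card X * (m + 2))" by (simp add: algebra_simps)
        then have tough: "(m + 1) * ?n \<le> card X * (m + 2)" by linarith
        show ?thesis
        proof (rule ccontr)
          assume "\<not> ?n' \<le> 2 * card X"
          \<comment> \<open>Eliminating \<open>?n\<close> from this and \<open>tough\<close> leaves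
            an upper bound on m|X| that misses the lower bound from |X| \<ge> 2m + 1 by one.\<close>
          then have "2 * card X + 1 \<le> ?n + 2 * m" using n'n by linarith
          then have "(m + 1) * (2 * card X + 1) \<le> (m + 1) * (?n + 2 * m)" by (rule mult_left_mono) simp
          also have "\<dots> \<le> card X * (m + 2) + (m + 1) * (2 * m)" using tough by (simp add: distrib_left)
          finally have "m * card X + m + 1 \<le> 2 * (m * m) + 2 * m" by (simp add: algebra_simps)
          moreover have "m * (2 * m + 1) \<le> m * card X" using 3 by (intro mult_left_mono) auto
          then have "2 * (m * m) + m \<le> m * card X" by (simp add: algebra_simps)
          ultimately show False by linarith
        qed
      qed
    qed
    then show ?thesis unfolding sun' .
  qed
  then show "\<exists>F. path_factor 3 ?G' F"
    using kaneko_path_factor[OF G'] unfolding V' by blast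
qed

end
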